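(* Let $0\le \alpha\le 1$ and let $\mathcal{X}\subset\mathbb{C}^{\mathbb{Z}}$ be the space of Fourier transforms $\{\widehat{\mu}(n)\}_{n\in\mathbb{Z}}$ of all finite, complex Borel measures $\mu$ on the circle $\mathbb{T}=\mathbb{R}/\mathbb{Z}$ with $\dim(\mu)\le\alpha$. (i) If $\alpha<1/2$ then $\mathcal{X}$ admits recovery. (ii) If $\alpha>1/2$ then $\mathcal{X}\setminus\{0\}$ does not admit detection.
   Context: Fourier transform: $\widehat{\mu}(n)=\int_{\mathbb{T}} e^{-2\pi i n t}\,d\mu(t)$, $n\in\mathbb{Z}$. The dimension of a complex measure $\mu$ on $\mathbb{T}$ is $\dim(\mu):=\min\{\dim(E): E\subset\mathbb{T}\text{ Borel}, |\mu|(\mathbb{T}\setminus E)=0\}$, where $\dim(E)$ is the Hausdorff dimension of $E$. Noise: $\xi=(\xi_n)_{n\in\mathbb{Z}}$ is a sequence of independent standard complex Gaussian random variables, meaning that the real and imaginary parts of each $\xi_n$ are independent and each distributed as $N(0,1)$. A set $\mathcal{X}\subset\mathbb{C}^{\mathbb{Z}}$ admits recovery if there is a Borel measurable map $T:\mathbb{C}^{\mathbb{Z}}\to\mathbb{C}^{\mathbb{Z}}$ such that for each $x\in\mathcal{X}$, $T(x+\xi)=x$ almost surely. A set $\mathcal{X}\subset\mathbb{C}^{\mathbb{Z}}$ admits detection if there is a Borel measurable map $T:\mathbb{C}^{\mathbb{Z}}\to\{0,1\}$ such that $T(\xi)=0$ almost surely and, for every $x\in\mathcal{X}$, $T(x+\xi)=1$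 almost surely. (Borel structure is that of the product topology.) *)

theory Defs
  imports "HOL-Probability.Probability"
begin

section \<open>The circle\<close>

definition circle_rel :: "real \<Rightarrow> real \<Rightarrow> bool"
  where "circle_rel x y \<longleftrightarrow> x - y \<in> \<int>"

quotient_type circle = real / circle_rel
  morphisms rep_circle to_circle
proof (rule equivpI)
  show "reflp circle_rel"
    by (simp add: reflp_def circle_rel_def)
  show "symp circle_rel"
    by (metis circle_rel_def minus_diff_eq minus_in_Ints_iff sympI)
  show "transp circle_rel"
    unfolding transp_def circle_rel_def
    by (metis Ints_add diff_add_cancel add_diff_eq)
qed

definition dist_to_int :: "real \<Rightarrow> real"
  where "dist_to_int t = \<bar>t - of_int (round t)\<bar>"

lemma dist_to_int_le: "dist_to_int t \<le> \<bar>t - of_int n\<bar>"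
  unfolding dist_to_int_def by (rule round_diff_minimal)

lemma dist_to_int_add_int: "dist_to_int (t + of_int n) = dist_to_int t"
proof -
  have "dist_to_int (s + of_int m) \<le> dist_to_int s" for s :: real and m
    using dist_to_int_le[of "s + of_int m" "round s + m"] by (simp add: dist_to_int_def)
  from this[of t n] this[of "t + of_int n" "- n"] show ?thesis
    by simp
qed

lemma dist_to_int_minus: "dist_to_int (- t) = dist_to_int t"
proof -
  have "dist_to_int (- s) \<le> dist_to_int s" for s :: real
    using dist_to_int_le[of "- s" "- round s"] by (simp add: dist_to_int_def)
  from this[of t] this[of "- t"] show ?thesis
    by simp
qed

lemma dist_to_int_triangle: "dist_to_int (s + t) \<le> dist_to_int s + dist_to_int t"
  using dist_to_int_le[of "s + t" "round s + round t"] by (simp add: dist_to_int_def)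

lemma dist_to_int_eq_0_iff: "dist_to_int t = 0 \<longleftrightarrow> t \<in> \<int>"
proof
  assume "dist_to_int t = 0"
  then have "t = of_int (round t)" by (simp add: dist_to_int_def)
  then show "t \<in> \<int>" by (metis Ints_of_int)
qed (auto simp: dist_to_int_def elim: Ints_cases)

instantiation circle :: metric_space
begin

lift_definition dist_circle :: "circle \<Rightarrow> circle \<Rightarrow> real"
  is "\<lambda>x y. dist_to_int (x - y)"
proof -
  fix x x' y y' :: real
  assume "circle_rel x x'" "circle_rel y y'"
  then obtain m n where "x = x' + of_int m" "y = y' + of_int n"
    unfolding circle_rel_def by (metis Ints_cases diff_add_cancel add.commute)
  then have "x - y = (x' - y') + of_int (m - n)" by simp
  then show "dist_to_int (x - y) = dist_to_int (x' - y')"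
    by (metis dist_to_int_add_int)
qed

definition uniformity_circle :: "(circle \<times> circle) filter"
  where "uniformity_circle = (INF e\<in>{0<..}. principal {(x, y). dist x y < e})"

definition open_circle :: "circle set \<Rightarrow> bool"
  where "open_circle U \<longleftrightarrow> (\<forall>x\<in>U. eventually (\<lambda>(x', y). x' = x \<longrightarrow> y \<in> U) uniformity)"

instance
proof
  fix x y z :: circle
  show "dist x y = 0 \<longleftrightarrow> x = y"
    by transfer (simp add: dist_to_int_eq_0_iff circle_rel_def)
  show "dist x y \<le> dist x z + dist y z"
  proof transfer
    fix x y z :: real
    show "dist_to_int (x - y) \<le> dist_to_int (x - z) + dist_to_int (y - z)"
      using dist_to_int_triangle[of "x - z" "z - y"] dist_to_int_minus[of "y - z"] by simp
  qed
qed (fact uniformity_circle_def open_circle_def)+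

end

text \<open>The metric topology is the quotient topology of \<open>\<real>/\<int>\<close>.\<close>

lemma dist_to_circle_le: "dist (to_circle x) (to_circle y) \<le> \<bar>x - y\<bar>"
  using dist_to_int_le[of "x - y" 0] by (simp add: dist_circle.abs_eq)

lemma open_circle_iff: "open U \<longleftrightarrow> open (to_circle -` U)" for U :: "circle set"
proof
  assume U: "open U"
  have "continuous_on UNIV to_circle"
    unfolding continuous_on_iff
    by (metis dist_to_circle_le dist_real_def le_less_trans)
  then show "open (to_circle -` U)"
    using U by (rule open_vimage[rotated])
next
  assume V: "open (to_circle -` U)"
  show "open U"
    unfolding open_dist
  proof
    fix a assume "a \<in> U"
    obtain x where x: "a = to_circle x"
      by (metis Quotient_circle Quotient_abs_rep)
    with V \<open>a \<in> U\<close> obtain e where "e > 0" and e: "\<And>y. dist y x < e \<Longrightarrow> y \<in> to_circle -` U"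
      by (auto simp: open_dist)
    have "b \<in> U" if "dist b a < e" for b
    proof -
      obtain y where y: "b = to_circle y"
        by (metis Quotient_circle Quotient_abs_rep)
      define y' where "y' = y - of_int (round (y - x))"
      have "to_circle y' = b"
        unfolding y y'_def circle.abs_eq_iff by (simp add: circle_rel_def)
      moreover have "dist y' x = dist b a"
        by (simp add: x y y'_def dist_circle.abs_eq dist_to_int_def dist_real_def algebra_simps)
      ultimately show ?thesis
        using e[of y'] that by simp
    qed
    with \<open>e > 0\<close> show "\<exists>e>0. \<forall>b. dist b a < e \<longrightarrow> b \<in> U" by blast
  qed
qed

lift_definition fourier_char :: "int \<Rightarrow> circle \<Rightarrow> complex"
  is "\<lambda>n t. exp (- 2 * pi * \<i> * of_int n * of_real t)"
proof -
  fix n :: int and s t :: real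
  assume "circle_rel s t"
  then obtain m where "s = t + of_int m"
    unfolding circle_rel_def by (metis Ints_cases diff_add_cancel add.commute)
  then have "- 2 * pi * \<i> * of_int n * of_real s
      = - 2 * pi * \<i> * of_int n * of_real t + (of_int (2 * (- n * m)) * pi) * \<i>"
    by (simp add: algebra_simps)
  then show "exp (- 2 * pi * \<i> * of_int n * of_real s) = exp (- 2 * pi * \<i> * of_int n * of_real t)"
    by (simp only: exp_eq) blast
qed

lemma continuous_on_fourier_char: "continuous_on UNIV (fourier_char n)"
proof -
  have "open (fourier_char n -` B)" if "open B" for B
  proof -
    have "to_circle -` (fourier_char n -` B)
        = (\<lambda>t. exp (- 2 * pi * \<i> * of_int n * of_real t)) -` B"
      by (auto simp: fourier_char.abs_eq)
    moreover have "open \<dots>"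
      by (rule open_vimage[OF that]) (intro continuous_intros)
    ultimately show ?thesis
      by (simp add: open_circle_iff)
  qed
  then show ?thesis
    by (simp add: continuous_on_open_vimage)
qed


section \<open>Complex measures\<close>

text \<open>Only the values on measurable sets are meaningful; a complex measure is automatically finite.\<close>

definition complex_measure :: "'a measure \<Rightarrow> ('a set \<Rightarrow> complex) \<Rightarrow> bool"
  where "complex_measure M \<mu> \<longleftrightarrow>
    (\<forall>A :: nat \<Rightarrow> 'a set. range A \<subseteq> sets M \<longrightarrow> disjoint_family A \<longrightarrow>
      (\<lambda>i. \<mu> (A i)) sums \<mu> (\<Union>i. A i))"

definition total_variation :: "'a measure \<Rightarrow> ('a set \<Rightarrow> complex) \<Rightarrow> 'a set \<Rightarrow> ennreal"
  where "total_variation M \<mu> E =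
    (SUP A \<in> {A :: nat \<Rightarrow> 'a set. range A \<subseteq> sets M \<and> disjoint_family A \<and> (\<Union>i. A i) = E}.
      \<Sum>i. ennreal (norm (\<mu> (A i))))"

text \<open>The positive part \<open>\<nu>\<^sup>+\<close> of the Jordan decomposition of a finite signed measure.\<close>

definition upper_variation :: "'a measure \<Rightarrow> ('a set \<Rightarrow> real) \<Rightarrow> 'a measure"
  where "upper_variation M \<nu> =
    measure_of (space M) (sets M) (\<lambda>E. SUP A \<in> {A \<in> sets M. A \<subseteq> E}. ennreal (\<nu> A))"

context
  fixes M :: "'a measure" and \<nu> :: "'a set \<Rightarrow> real"
  assumes sums: "\<And>A :: nat \<Rightarrow> 'a set. range A \<subseteq> sets M \<Longrightarrow> disjoint_family A \<Longrightarrow>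
    (\<lambda>i. \<nu> (A i)) sums \<nu> (\<Union>i. A i)"
begin

lemma signed_empty: "\<nu> {} = 0"
proof -
  have "(\<lambda>i::nat. \<nu> {}) sums \<nu> {}"
    using sums[of "\<lambda>i. {}"] by (simp add: disjoint_family_on_def)
  then have "(\<lambda>i::nat. \<nu> {}) \<longlonglongrightarrow> 0"
    by (rule summable_LIMSEQ_zero[OF sums_summable])
  then show ?thesis
    by (simp add: LIMSEQ_const_iff)
qed

lemma signed_union:
  assumes "A \<in> sets M" "B \<in> sets M" "A \<inter> B = {}"
  shows "\<nu> (A \<union> B) = \<nu> A + \<nu> B"
proof -
  have "disjoint_family (binaryset A B)"
    using assms(3) by (auto simp: disjoint_family_on_def binaryset_def)
  moreover have "range (binaryset A B) \<subseteq> sets M"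
    using assms by (auto simp: range_binaryset_eq)
  ultimately have "(\<lambda>i. \<nu> (binaryset A B i)) sums \<nu> (A \<union> B)"
    using sums by (metis UN_binaryset_eq)
  with binaryset_sums[of \<nu> A B, OF signed_empty] show ?thesis
    using sums_unique2 by blast
qed

lemma upper_variation_superadditive:
  assumes E: "E \<in> sets M" and F: "F \<in> sets M" and disj: "E \<inter> F = {}"
  shows "(SUP A \<in> {A \<in> sets M. A \<subseteq> E}. ennreal (\<nu> A)) + (SUP A \<in> {A \<in> sets M. A \<subseteq> F}. ennreal (\<nu> A))
    \<le> (SUP A \<in> {A \<in> sets M. A \<subseteq> E \<union> F}. ennreal (\<nu> A))" (is "?f E + ?f F \<le> ?f (E \<union> F)")
proof -
  have ne: "{A \<in> sets M. A \<subseteq> G} \<noteq> {}" for G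
    using sets.empty_sets[of M] by blast
  have "ennreal (\<nu> A) + ennreal (\<nu> B) \<le> ?f (E \<union> F)"
    if "A \<in> sets M" "A \<subseteq> E" "B \<in> sets M" "B \<subseteq> F" for A B
  proof -
    define A' B' where "A' = (if \<nu> A \<ge> 0 then A else {})" and "B' = (if \<nu> B \<ge> 0 then B else {})"
    have "A' \<in> sets M" "B' \<in> sets M" "A' \<subseteq> E" "B' \<subseteq> F" "\<nu> A' \<ge> 0" "\<nu> B' \<ge> 0"
      using that by (auto simp: A'_def B'_def signed_empty)
    moreover have "ennreal (\<nu> A) = ennreal (\<nu> A')" "ennreal (\<nu> B) = ennreal (\<nu> B')"
      by (auto simp: A'_def B'_def signed_empty ennreal_neg)
    moreover have "\<nu> (A' \<union> B') = \<nu> A' + \<nu> B'"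
      using calculation disj by (intro signed_union) auto
    ultimately have "ennreal (\<nu> A) + ennreal (\<nu> B) = ennreal (\<nu> (A' \<union> B'))"
      by simp
    also have "\<dots> \<le> ?f (E \<union> F)"
      using \<open>A' \<in> sets M\<close> \<open>B' \<in> sets M\<close> \<open>A' \<subseteq> E\<close> \<open>B' \<subseteq> F\<close> by (intro SUP_upper) auto
    finally show ?thesis .
  qed
  then show ?thesis
    by (simp only: ennreal_SUP_add_left[OF ne, symmetric] ennreal_SUP_add_right[OF ne])
       (intro SUP_least, auto)
qed

lemma emeasure_upper_variation:
  assumes "E \<in> sets M"
  shows "emeasure (upper_variation M \<nu>) E = (SUP A \<in> {A \<in> sets M. A \<subseteq> E}. ennreal (\<nu> A))"
  unfolding upper_variation_def
proof (rule emeasure_measure_of_sigma)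
  show "E \<in> sets M" by (fact assms)
  let ?f = "\<lambda>E. SUP A \<in> {A \<in> sets M. A \<subseteq> E}. ennreal (\<nu> A)"
  show "sigma_algebra (space M) (sets M)" ..
  have empty: "?f {} = 0"
  proof -
    have "{A \<in> sets M. A \<subseteq> {}} = {{}}" by auto
    then show ?thesis by (simp add: signed_empty)
  qed
  then show "positive (sets M) ?f"
    by (simp add: positive_def)
  show "countably_additive (sets M) ?f"
  proof (rule countably_additiveI)
    fix E :: "nat \<Rightarrow> 'a set"
    assume E: "range E \<subseteq> sets M" "disjoint_family E" "(\<Union>i. E i) \<in> sets M"
    define f where "f = ?f"
    have f_mono: "f A \<le> f B" if "A \<subseteq> B" for A B
      unfolding f_def using that by (intro SUP_subset_mono) auto
    have f_upper: "ennreal (\<nu> A) \<le> f B" if "A \<in> sets M" "A \<subseteq> B" for A B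
      unfolding f_def using that by (intro SUP_upper) simp
    have f_add: "f A + f B \<le> f (A \<union> B)" if "A \<in> sets M" "B \<in> sets M" "A \<inter> B = {}" for A B
      unfolding f_def using that by (rule upper_variation_superadditive)
    have Em: "E i \<in> sets M" for i
      using E(1) by blast
    have fin: "(\<Sum>i<n. f (E i)) \<le> f (\<Union>i<n. E i)" for n
    proof (induction n)
      case 0
      show ?case by simp
    next
      case (Suc n)
      have disj: "(\<Union>i<n. E i) \<inter> E n = {}"
      proof -
        have "E i \<inter> E n = {}" if "i < n" for i
          using disjoint_family_onD[OF E(2)] that by simp
        then show ?thesis by blast
      qed
      have meas: "(\<Union>i<n. E i) \<in> sets M"
        using Em by (intro sets.finite_UN) simp_all
      have "(\<Sum>i<Suc n. f (E i)) \<le> f (\<Union>i<n. E i) + f (E n)"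
        using add_right_mono[OF Suc] by simp
      also have "\<dots> \<le> f ((\<Union>i<n. E i) \<union> E n)"
        by (rule f_add[OF meas Em disj])
      also have "(\<Union>i<n. E i) \<union> E n = (\<Union>i<Suc n. E i)"
        by (simp add: lessThan_Suc Un_commute)
      finally show ?case .
    qed
    have "(\<Sum>i. f (E i)) \<le> f (\<Union>i. E i)"
    proof (rule suminf_le_const)
      show "(\<Sum>i<n. f (E i)) \<le> f (\<Union>i. E i)" for n
        using fin[of n] f_mono[of "\<Union>i<n. E i" "\<Union>i. E i"] by (meson UN_mono order_trans subset_UNIV subset_refl)
    qed simp
    moreover have "f (\<Union>i. E i) \<le> (\<Sum>i. f (E i))"
      unfolding f_def[THEN fun_cong, of "\<Union>i. E i"]
    proof (rule SUP_least)
      fix A assume "A \<in> {A \<in> sets M. A \<subseteq> (\<Union>i. E i)}"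
      then have A: "A \<in> sets M" "(\<Union>i. A \<inter> E i) = A" by blast+
      have "(\<lambda>i. \<nu> (A \<inter> E i)) sums \<nu> (\<Union>i. A \<inter> E i)"
      proof (rule sums)
        show "range (\<lambda>i. A \<inter> E i) \<subseteq> sets M"
          using A(1) Em by blast
        show "disjoint_family (\<lambda>i. A \<inter> E i)"
          using E(2) unfolding disjoint_family_on_def by blast
      qed
      then have "(\<lambda>n. ennreal (\<Sum>i<n. \<nu> (A \<inter> E i))) \<longlonglongrightarrow> ennreal (\<nu> A)"
        unfolding A(2) sums_def by (rule tendsto_ennrealI)
      moreover have "ennreal (\<Sum>i<n. \<nu> (A \<inter> E i)) \<le> (\<Sum>i. f (E i))" for n
      proof -
        have "ennreal (\<Sum>i<n. \<nu> (A \<inter> E i)) \<le> ennreal (\<Sum>i<n. max 0 (\<nu> (A \<inter> E i)))"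
          by (intro ennreal_leI sum_mono) simp
        also have "\<dots> = (\<Sum>i<n. ennreal (max 0 (\<nu> (A \<inter> E i))))"
          by (rule sum_ennreal[symmetric]) simp
        also have "\<dots> = (\<Sum>i<n. ennreal (\<nu> (A \<inter> E i)))"
          by (intro sum.cong) (simp_all add: max_def ennreal_neg)
        also have "\<dots> \<le> (\<Sum>i<n. f (E i))"
          using A(1) Em by (intro sum_mono f_upper) auto
        also have "\<dots> \<le> (\<Sum>i. f (E i))"
          by (rule sum_le_suminf) simp_all
        finally show ?thesis .
      qed
      ultimately show "ennreal (\<nu> A) \<le> (\<Sum>i. f (E i))"
        by (intro LIMSEQ_le_const2) blast+
    qed
    ultimately show "(\<Sum>i. ?f (E i)) = ?f (\<Union>i. E i)"
      unfolding f_def by (rule antisym)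
  qed
qed

end

definition signed_integral :: "'a measure \<Rightarrow> ('a set \<Rightarrow> real) \<Rightarrow> ('a \<Rightarrow> complex) \<Rightarrow> complex"
  where "signed_integral M \<nu> f =
    (\<integral>x. f x \<partial>upper_variation M \<nu>) - (\<integral>x. f x \<partial>upper_variation M (\<lambda>A. - \<nu> A))"

definition cmeasure_integral :: "'a measure \<Rightarrow> ('a set \<Rightarrow> complex) \<Rightarrow> ('a \<Rightarrow> complex) \<Rightarrow> complex"
  where "cmeasure_integral M \<mu> f =
    signed_integral M (\<lambda>A. Re (\<mu> A)) f + \<i> * signed_integral M (\<lambda>A. Im (\<mu> A)) f"

definition fourier_transform :: "(circle set \<Rightarrow> complex) \<Rightarrow> int \<Rightarrow> complex"
  where "fourier_transform \<mu> n = cmeasure_integral borel \<mu> (fourier_char n)"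


section \<open>Hausdorff dimension\<close>

text \<open>The gauge uses \<open>0\<^sup>0 = 1\<close>, so that the case \<open>s = 0\<close> is counting measure.\<close>

definition hausdorff_gauge :: "real \<Rightarrow> 'a::metric_space set \<Rightarrow> ennreal"
  where "hausdorff_gauge s U =
    (if U = {} then 0 else if s = 0 then 1 else ennreal (diameter U powr s))"

definition hausdorff_premeasure :: "real \<Rightarrow> real \<Rightarrow> 'a::metric_space set \<Rightarrow> ennreal"
  where "hausdorff_premeasure s \<delta> E =
    (INF U \<in> {U :: nat \<Rightarrow> 'a set. E \<subseteq> (\<Union>i. U i) \<and> (\<forall>i. bounded (U i) \<and> diameter (U i) \<le> \<delta>)}.
      \<Sum>i. hausdorff_gauge s (U i))"

definition hausdorff_outer_measure :: "real \<Rightarrow> 'a::metric_space set \<Rightarrow> ennreal"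
  where "hausdorff_outer_measure s E = (SUP \<delta> \<in> {0<..}. hausdorff_premeasure s \<delta> E)"

definition hausdorff_dim :: "'a::metric_space set \<Rightarrow> ennreal"
  where "hausdorff_dim E = (INF s \<in> {s. 0 \<le> s \<and> hausdorff_outer_measure s E = 0}. ennreal s)"

text \<open>The infimum is attained, see \<open>cmeasure_dim_attained\<close> below.\<close>

definition cmeasure_dim :: "('a::metric_space set \<Rightarrow> complex) \<Rightarrow> ennreal"
  where "cmeasure_dim \<mu> =
    (INF E \<in> {E \<in> sets borel. total_variation borel \<mu> (UNIV - E) = 0}. hausdorff_dim E)"

lemma hausdorff_dim_mono:
  assumes "E \<subseteq> F"
  shows "hausdorff_dim E \<le> hausdorff_dim F"
proof -
  have "hausdorff_premeasure s \<delta> E \<le> hausdorff_premeasure s \<delta> F" for s \<delta>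
    unfolding hausdorff_premeasure_def using assms by (intro INF_superset_mono) auto
  then have "hausdorff_outer_measure s E \<le> hausdorff_outer_measure s F" for s
    unfolding hausdorff_outer_measure_def by (intro SUP_mono) blast
  then show ?thesis
    unfolding hausdorff_dim_def by (intro INF_superset_mono) (auto, metis le_zero_eq)
qed

lemma total_variation_eq_0_iff:
  assumes "complex_measure M \<mu>" "E \<in> sets M"
  shows "total_variation M \<mu> E = 0 \<longleftrightarrow> (\<forall>A \<in> sets M. A \<subseteq> E \<longrightarrow> \<mu> A = 0)"
proof
  assume *: "total_variation M \<mu> E = 0"
  show "\<forall>A \<in> sets M. A \<subseteq> E \<longrightarrow> \<mu> A = 0"
  proof (intro ballI impI)
    fix A assume A: "A \<in> sets M" "A \<subseteq> E"
    let ?P = "binaryset A (E - A)"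
    have "(\<Union>i. ?P i) = E" using A by (auto simp: UN_binaryset_eq)
    moreover have "range ?P \<subseteq> sets M" using A assms by (auto simp: range_binaryset_eq)
    moreover have "disjoint_family ?P" by (auto simp: disjoint_family_on_def binaryset_def)
    ultimately have "(\<Sum>i. ennreal (norm (\<mu> (?P i)))) \<le> total_variation M \<mu> E"
      unfolding total_variation_def by (intro SUP_upper) auto
    then have "(\<Sum>i. ennreal (norm (\<mu> (?P i)))) = 0" using * by simp
    then have "ennreal (norm (\<mu> (?P 0))) = 0" by (simp add: suminf_eq_zero_iff)
    then show "\<mu> A = 0" by (simp add: binaryset_def)
  qed
next
  assume *: "\<forall>A \<in> sets M. A \<subseteq> E \<longrightarrow> \<mu> A = 0"
  have "(\<Sum>i. ennreal (norm (\<mu> (A i)))) = 0"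
    if "range A \<subseteq> sets M" "(\<Union>i. A i) = E" for A :: "nat \<Rightarrow> 'a set"
  proof -
    have "\<mu> (A i) = 0" for i using * that by auto
    then show ?thesis by simp
  qed
  then have "total_variation M \<mu> E \<le> 0"
    unfolding total_variation_def by (intro SUP_least) (metis (mono_tags, lifting) mem_Collect_eq order_refl)
  then show "total_variation M \<mu> E = 0" by simp
qed

lemma cmeasure_dim_attained:
  assumes \<mu>: "complex_measure borel \<mu>"
  obtains E where "E \<in> sets borel" "total_variation borel \<mu> (UNIV - E) = 0"
    "cmeasure_dim \<mu> = hausdorff_dim E"
proof -
  let ?S = "{E \<in> sets borel. total_variation borel \<mu> (UNIV - E) = 0}"
  have ne: "?S \<noteq> {}"
  proof -
    have "\<mu> {} = 0"
    proof -
      have "(\<lambda>i::nat. \<mu> {}) sums \<mu> {}"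
        using \<mu>[unfolded complex_measure_def, rule_format, of "\<lambda>i. {}"]
        by (simp add: disjoint_family_on_def)
      then have "(\<lambda>i::nat. \<mu> {}) \<longlonglongrightarrow> 0"
        by (rule summable_LIMSEQ_zero[OF sums_summable])
      then show ?thesis
        by (simp add: LIMSEQ_const_iff)
    qed
    then have "total_variation borel \<mu> {} = 0"
      using total_variation_eq_0_iff[OF \<mu>, of "{}"] by simp
    then have "UNIV \<in> ?S" by simp
    then show ?thesis by blast
  qed
  then obtain d where d: "range d \<subseteq> hausdorff_dim ` ?S" "d \<longlonglongrightarrow> Inf (hausdorff_dim ` ?S)"
    using Inf_as_limit[of "hausdorff_dim ` ?S"] by blast
  then have "\<forall>n. \<exists>E. E \<in> ?S \<and> d n = hausdorff_dim E"
    by (auto simp: image_iff subset_iff)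
  then obtain F where F: "\<And>n::nat. F n \<in> ?S" "\<And>n. d n = hausdorff_dim (F n)"
    by metis
  define E where "E = (\<Inter>n. F n)"
  have E: "E \<in> sets borel" using F(1) by (auto simp: E_def)
  have "\<mu> A = 0" if A: "A \<in> sets borel" "A \<subseteq> UNIV - E" for A
  proof -
    have F0: "\<mu> B = 0" if "B \<in> sets borel" "B \<subseteq> UNIV - F n" for B n
      using F(1)[of n] that total_variation_eq_0_iff[OF \<mu>, of "UNIV - F n"] by auto
    let ?D = "disjointed (\<lambda>n. A - F n)"
    have "range ?D \<subseteq> sets borel"
      using A F(1) by (intro sets.range_disjointed_sets) auto
    moreover have "?D n \<subseteq> UNIV - F n" for n
      using disjointed_subset[of "\<lambda>n. A - F n" n] by auto
    ultimately have "\<mu> (?D n) = 0" for n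
      by (intro F0) auto
    moreover have "(\<lambda>n. \<mu> (?D n)) sums \<mu> (\<Union>n. ?D n)"
      using \<mu> \<open>range ?D \<subseteq> sets borel\<close> disjoint_family_disjointed
      unfolding complex_measure_def by blast
    moreover have "(\<Union>n. ?D n) = A"
      using A by (auto simp: UN_disjointed_eq E_def)
    ultimately show ?thesis
      by (metis (no_types, lifting) sums_0 sums_unique2 ext)
  qed
  then have null: "total_variation borel \<mu> (UNIV - E) = 0"
    using E total_variation_eq_0_iff[OF \<mu>, of "UNIV - E"] by auto
  have "hausdorff_dim E \<le> d n" for n
    unfolding F(2) by (rule hausdorff_dim_mono) (auto simp: E_def)
  then have "hausdorff_dim E \<le> cmeasure_dim \<mu>"
    unfolding cmeasure_dim_def by (intro LIMSEQ_le_const[OF d(2)]) auto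
  moreover have "cmeasure_dim \<mu> \<le> hausdorff_dim E"
    unfolding cmeasure_dim_def using E null by (intro INF_lower) auto
  ultimately show ?thesis
    using that E null by (metis order.antisym)
qed

definition fourier_space :: "real \<Rightarrow> (int \<Rightarrow> complex) set"
  where "fourier_space \<alpha> =
    {fourier_transform \<mu> | \<mu>. complex_measure borel \<mu> \<and> cmeasure_dim \<mu> \<le> ennreal \<alpha>}"


section \<open>Noise, recovery and detection\<close>

definition complex_gaussian_noise :: "'w measure \<Rightarrow> (int \<Rightarrow> 'w \<Rightarrow> complex) \<Rightarrow> bool"
  where "complex_gaussian_noise P \<xi> \<longleftrightarrow>
    prob_space P \<and>
    prob_space.indep_vars P (\<lambda>_. borel) \<xi> UNIV \<and>
    (\<forall>n. prob_space.indep_var P borel (\<lambda>\<omega>. Re (\<xi> n \<omega>)) borel (\<lambda>\<omega>. Im (\<xi> n \<omega>)) \<and>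
      distributed P lborel (\<lambda>\<omega>. Re (\<xi> n \<omega>)) std_normal_density \<and>
      distributed P lborel (\<lambda>\<omega>. Im (\<xi> n \<omega>)) std_normal_density)"

text \<open>
  On \<^typ>\<open>int \<Rightarrow> complex\<close>, \<^const>\<open>borel\<close> is the Borel algebra of the product topology.
\<close>

definition admits_recovery ::
    "'w measure \<Rightarrow> (int \<Rightarrow> 'w \<Rightarrow> complex) \<Rightarrow> (int \<Rightarrow> complex) set \<Rightarrow> bool"
  where "admits_recovery P \<xi> X \<longleftrightarrow>
    (\<exists>T :: (int \<Rightarrow> complex) \<Rightarrow> int \<Rightarrow> complex. T \<in> borel \<rightarrow>\<^sub>M borel \<and>
      (\<forall>x\<in>X. AE \<omega> in P. T (\<lambda>n. x n + \<xi> n \<omega>) = x))"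

definition admits_detection ::
    "'w measure \<Rightarrow> (int \<Rightarrow> 'w \<Rightarrow> complex) \<Rightarrow> (int \<Rightarrow> complex) set \<Rightarrow> bool"
  where "admits_detection P \<xi> X \<longleftrightarrow>
    (\<exists>T :: (int \<Rightarrow> complex) \<Rightarrow> nat. T \<in> borel \<rightarrow>\<^sub>M count_space {0, 1} \<and>
      (AE \<omega> in P. T (\<lambda>n. \<xi> n \<omega>) = 0) \<and>
      (\<forall>x\<in>X. AE \<omega> in P. T (\<lambda>n. x n + \<xi> n \<omega>) = 1))"

end

theory Submission
  imports Defs
begin

text \<open>
  Recovery. For a dyadic arc \<open>I\<close> of length \<open>2\<^sup>-\<^sup>k\<close> the observation determines \<open>\<mu>(I) + W(I)\<close>, where almost
  surely \<open>|W(I)| \<le> |I|\<^sup>\<beta>\<close> for all short \<open>I\<close>, whenever \<open>\<beta> < 1/2\<close>. If \<open>\<mu>\<close> lives on a set of dimension less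
  than \<open>s < \<beta>\<close>, then almost every point lies in infinitely many arcs with \<open>|\<mu>(I)| > 2|I|\<^sup>s\<close>: otherwise,
  covering the exceptional points economically would show that they carry no mass. Hence the maximal arcs of
  level at least \<open>n\<close> with observed value at least \<open>|I|\<^sup>s\<close> exhaust \<open>\<mu>\<close>, and on them the noise is negligible
  with respect to \<open>|\<mu>|\<close>, uniformly as \<open>n \<rightarrow> \<infinity>\<close>.

  Detection. Let \<open>\<mu>\<close> be the natural measure of a random Cantor set: each cell has \<open>N\<close> slots of \<open>M < N\<close>
  subcells, one of which is kept at random. The likelihood ratio of the mixture of the shifted noises,
  restricted to finitely many frequencies, has second moment \<open>E exp(\<Sum> Re \<mu>\<^sub>j cnj \<mu>'\<^sub>j)\<close> with \<open>\<mu>'\<close> an independent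
  copy. Positive definiteness bounds it by the same expression over all frequencies of \<open>\<int> / (N M)\<^sup>k\<close>, which
  is \<open>E exp((M/N)\<^sup>k Z\<^sub>k)\<close> for the number \<open>Z\<^sub>k\<close> of common cells of level \<open>k\<close>. Here \<open>Z\<^sub>k\<close> is a supercritical
  branching process with mean \<open>(N/M)\<^sup>k\<close> and bounded offspring, so these moments are bounded. Therefore the
  mixture is not singular to the noise. With \<open>N = M + 1\<close> large the dimension is as close to \<open>1/2\<close> as desired.
\<close>

section \<open>The circle and its dyadic arcs\<close>

text \<open>The exponent 1/2 is the size of the noise: by Parseval, white noise tested against the
  indicator of an arc has variance of the order of its length, and Gaussian tails let the union over
  the \<open>2 ^ k\<close> arcs of a level cost only a factor linear in \<open>k\<close>. As the
  data are Fourier coefficients, arcs are observed through trigonometric polynomials, which must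
  converge boundedly at every point, because \<open>\<mu>\<close> may be singular, and fast in mean
  square, because of the noise. Since \<open>\<mu>\<close> is complex, a small value on an arc does
  not make its total variation there small; exceptional points are therefore handled through unions
  of arcs that nearly coincide with a given set. For detection, the transform of a singular measure
  is not square summable, so a single shift of the noise is singular to the noise and densities
  exist on finitely many frequencies only; what stays bounded is the second moment of the averaged
  density. Slots fix the index of a cell, so two copies share cells index by index; a common cell
  has \<open>N\<close> slots, in each of which the copies agree with probability
  \<open>1 / M\<close>. Thus \<open>M < N\<close> means at once supercriticality and
  \<open>log N / log (N M) > 1 / 2\<close>.\<close>

lift_definition circle_coord :: "circle \<Rightarrow> real" is frac
proof -
  fix x y :: real
  assume "circle_rel x y"
  then obtain m where "x = y + of_int m"
    unfolding circle_rel_def by (metis Ints_cases diff_add_cancel add.commute)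
  then show "frac x = frac y"
    by (simp add: frac_def)
qed

lemma circle_coord_to_circle: "circle_coord (to_circle t) = frac t"
  by (simp add: circle_coord.abs_eq)

lemma to_circle_eq_iff: "to_circle s = to_circle t \<longleftrightarrow> s - t \<in> \<int>"
  by (simp add: circle.abs_eq_iff circle_rel_def)

lemma circle_coord_bounds: "0 \<le> circle_coord x" "circle_coord x < 1"
  by (transfer, simp add: frac_lt_1)+

lemma to_circle_coord [simp]: "to_circle (circle_coord x) = x"
proof (induct x rule: circle.abs_induct)
  case (1 y)
  have "frac y - y = of_int (- \<lfloor>y\<rfloor>)" by (simp add: frac_def)
  then show ?case
    unfolding circle_coord_to_circle to_circle_eq_iff by (metis Ints_of_int)
qed

lemma circle_coord_id: "0 \<le> t \<Longrightarrow> t < 1 \<Longrightarrow> circle_coord (to_circle t) = t"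
  by (simp add: circle_coord_to_circle frac_eq)

lemma continuous_on_to_circle: "continuous_on S to_circle"
  unfolding continuous_on_iff by (metis dist_to_circle_le dist_real_def le_less_trans)

lemma measurable_to_circle [measurable]: "to_circle \<in> borel_measurable borel"
  by (rule borel_measurable_continuous_onI[OF continuous_on_to_circle])

lemma compact_to_circle_image: "compact (to_circle ` {a..b})"
  by (intro compact_continuous_image continuous_on_to_circle compact_Icc)

lemma compact_UNIV_circle: "compact (UNIV :: circle set)"
proof -
  have "to_circle ` {0..1} = UNIV"
    using circle_coord_bounds to_circle_coord
    by (metis UNIV_eq_I atLeastAtMost_iff image_eqI less_le_not_le)
  then show ?thesis using compact_to_circle_image[of 0 1] by simp
qed

lemma measurable_circle_coord [measurable]: "circle_coord \<in> borel_measurable borel"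
proof (rule borel_measurableI_le)
  fix a :: real
  have "{x. circle_coord x \<le> a} = (if a < 0 then {} else if a < 1 then to_circle ` {0..a} else UNIV)"
  proof -
    have "x \<in> to_circle ` {0..a}" if "circle_coord x \<le> a" for x
      using that circle_coord_bounds[of x] to_circle_coord[of x]
      by (metis atLeastAtMost_iff image_eqI)
    moreover have "circle_coord x \<le> a" if "x \<in> to_circle ` {0..a}" "a < 1" for x
      using that by (auto simp: circle_coord_id)
    moreover have "circle_coord x \<le> a" if "1 \<le> a" for x
      using circle_coord_bounds[of x] that by linarith
    moreover have "\<not> circle_coord x \<le> a" if "a < 0" for x
      using circle_coord_bounds[of x] that by linarith
    ultimately show ?thesis by auto
  qed
  then show "{x \<in> space borel. circle_coord x \<le> a} \<in> sets borel"
    using compact_imp_closed[OF compact_to_circle_image[of 0 a]] by auto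
qed

lemma fourier_char_to_circle:
  "fourier_char n (to_circle t) = exp (\<i> * of_real (- 2 * pi * of_int n * t))"
  by (simp add: fourier_char.abs_eq algebra_simps)

lemma fourier_char_coord:
  "fourier_char n x = exp (\<i> * of_real (- 2 * pi * of_int n * circle_coord x))"
  by (metis fourier_char_to_circle to_circle_coord)

lemma norm_fourier_char [simp]: "norm (fourier_char n x) = 1"
  by (simp only: fourier_char_coord norm_exp_i_times)

lemma measurable_fourier_char [measurable]: "fourier_char n \<in> borel_measurable borel"
  by (rule borel_measurable_continuous_onI[OF continuous_on_fourier_char])

lemma fourier_char_add: "fourier_char (m + n) x = fourier_char m x * fourier_char n x"
  by (simp add: fourier_char_coord exp_add[symmetric] algebra_simps)

lemma fourier_char_0 [simp]: "fourier_char 0 x = 1"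
  by (simp add: fourier_char_coord)

lemma cnj_fourier_char: "cnj (fourier_char n x) = fourier_char (- n) x"
proof -
  have "cnj (fourier_char n x) = exp (cnj (\<i> * of_real (- 2 * pi * of_int n * circle_coord x)))"
    unfolding fourier_char_coord by (rule exp_cnj)
  also have "\<dots> = fourier_char (- n) x"
    unfolding fourier_char_coord by (rule arg_cong[of _ _ exp]) simp
  finally show ?thesis .
qed

lemma norm_exp_i_diff_le: "norm (exp (\<i> * of_real s) - exp (\<i> * of_real t)) \<le> \<bar>s - t\<bar>"
proof -
  have "exp (\<i> * of_real s) - exp (\<i> * of_real t)
      = exp (\<i> * of_real t) * (exp (\<i> * of_real (s - t)) - 1)"
    by (simp add: algebra_simps exp_add[symmetric])
  then have "norm (exp (\<i> * of_real s) - exp (\<i> * of_real t)) = 2 * \<bar>sin ((s - t) / 2)\<bar>"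
    by (simp only: norm_mult norm_exp_i_times dist_exp_i_1)
  also have "\<dots> \<le> \<bar>s - t\<bar>"
    using abs_sin_le_one abs_sin_x_le_abs_x[of "(s - t) / 2"] by simp
  finally show ?thesis .
qed

lemma fourier_char_lipschitz:
  "norm (fourier_char n (to_circle s) - fourier_char n (to_circle t)) \<le> 2 * pi * \<bar>of_int n\<bar> * \<bar>s - t\<bar>"
proof -
  have "\<bar>- 2 * pi * of_int n * s - - 2 * pi * of_int n * t\<bar> = 2 * pi * \<bar>of_int n\<bar> * \<bar>s - t\<bar>"
    by (simp add: right_diff_distrib[symmetric] abs_mult abs_minus_commute)
  then show ?thesis
    unfolding fourier_char_to_circle
    using norm_exp_i_diff_le[of "- 2 * pi * of_int n * s" "- 2 * pi * of_int n * t"] by simp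
qed

section \<open>Half-open dyadic arcs, a partition of the circle at each level\<close>

definition dyadic_index :: "nat \<Rightarrow> circle \<Rightarrow> nat"
  where "dyadic_index k x = nat \<lfloor>2 ^ k * circle_coord x\<rfloor>"

definition dyadic_arc :: "nat \<Rightarrow> nat \<Rightarrow> circle set"
  where "dyadic_arc k j = {x. dyadic_index k x = j}"

lemma dyadic_index_eq_iff:
  "dyadic_index k x = j \<longleftrightarrow> real j / 2 ^ k \<le> circle_coord x \<and> circle_coord x < (real j + 1) / 2 ^ k"
proof -
  have "dyadic_index k x = j \<longleftrightarrow> \<lfloor>2 ^ k * circle_coord x\<rfloor> = int j"
    unfolding dyadic_index_def using circle_coord_bounds(1)[of x] by (auto simp: nat_eq_iff)
  then show ?thesis
    by (simp add: floor_eq_iff field_simps)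
qed

lemma dyadic_index_less: "dyadic_index k x < 2 ^ k"
proof -
  have "real (dyadic_index k x) / 2 ^ k < 1"
    using dyadic_index_eq_iff[of k x "dyadic_index k x"] circle_coord_bounds[of x] by linarith
  then have "real (dyadic_index k x) < real (2 ^ k)" by simp
  then show ?thesis by (simp only: of_nat_less_iff)
qed

text \<open>This encodes the nesting of the arcs: dropping the last \<open>m\<close> binary digits
  of an index gives the ancestor \<open>m\<close> levels up.\<close>

lemma dyadic_index_div: "dyadic_index k x = dyadic_index (k + m) x div 2 ^ m"
proof -
  have "\<lfloor>2 ^ k * circle_coord x\<rfloor> = \<lfloor>2 ^ (k + m) * circle_coord x / real_of_int (2 ^ m)\<rfloor>"
    by (simp add: power_add)
  also have "\<dots> = \<lfloor>2 ^ (k + m) * circle_coord x\<rfloor> div 2 ^ m"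
    by (rule floor_divide_real_eq_div) simp
  finally show ?thesis
    unfolding dyadic_index_def using circle_coord_bounds(1)[of x]
    by (simp add: nat_div_distrib nat_power_eq)
qed

lemma measurable_dyadic_index [measurable]: "dyadic_index k \<in> borel \<rightarrow>\<^sub>M count_space UNIV"
  unfolding dyadic_index_def[abs_def] by measurable

lemma dyadic_arc_sets [measurable, simp]: "dyadic_arc k j \<in> sets borel"
  unfolding dyadic_arc_def by measurable

lemma real_Suc_le_power:
  assumes "j < 2 ^ k"
  shows "real j + 1 \<le> 2 ^ k"
proof -
  have "real (Suc j) \<le> real (2 ^ k)"
    using assms by (simp only: of_nat_le_iff Suc_le_eq)
  then show ?thesis by simp
qed

text \<open>Closed sets have indicators that are limits of continuous functions, which is how arcs
  are approximated below. The closed arc minus its right endpoint works from level 1 on; at level 0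
  the two endpoints coincide, and removing one would remove a point of the arc.\<close>

lemma dyadic_arc_diff_closed:
  assumes "k \<ge> 1"
  obtains F F' where "closed F" "closed F'" "F' \<subseteq> F" "dyadic_arc k j = F - F'"
proof (cases "j < 2 ^ k")
  case False
  then have "dyadic_arc k j = {} - {}"
    using dyadic_index_less by (auto simp: dyadic_arc_def)
  then show ?thesis using that[of "{}" "{}"] by simp
next
  case True
  let ?a = "real j / 2 ^ k" and ?b = "(real j + 1) / 2 ^ k"
  have j: "real j + 1 \<le> 2 ^ k"
    using real_Suc_le_power[OF True] .
  have pk: "(2::real) \<le> 2 ^ k"
    using assms power_increasing[of 1 k "2::real"] by simp
  have b: "?b \<le> 1" and ab: "?a < ?b"
    using j by (simp_all add: field_simps)
  have len: "?b - ?a \<le> 1 / 2" using pk by (simp add: field_simps)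
  have "dyadic_arc k j = to_circle ` {?a..?b} - {to_circle ?b}"
  proof (intro set_eqI iffI)
    fix x assume "x \<in> dyadic_arc k j"
    then have x: "?a \<le> circle_coord x" "circle_coord x < ?b"
      by (auto simp: dyadic_arc_def dyadic_index_eq_iff)
    then have "x \<in> to_circle ` {?a..?b}"
      by (intro image_eqI[of _ _ "circle_coord x"]) auto
    moreover have "x \<noteq> to_circle ?b"
    proof
      assume "x = to_circle ?b"
      then have "circle_coord x - ?b \<in> \<int>"
        using to_circle_eq_iff[of "circle_coord x" ?b] by simp
      moreover have "-1 < circle_coord x - ?b" "circle_coord x - ?b < 0"
        using x len by linarith+
      moreover obtain z where "circle_coord x - ?b = real_of_int z"
        using calculation(1) by (rule Ints_cases)
      ultimately have "-1 < real_of_int z" "real_of_int z < 0" by simp_all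
      then have "-1 < z" "z < 0" by simp_all
      then show False by presburger
    qed
    ultimately show "x \<in> to_circle ` {?a..?b} - {to_circle ?b}" by simp
  next
    fix x assume "x \<in> to_circle ` {?a..?b} - {to_circle ?b}"
    then obtain t where t': "x = to_circle t" "?a \<le> t" "t \<le> ?b" "t \<noteq> ?b"
      by (elim DiffE imageE) auto
    then have t: "x = to_circle t" "?a \<le> t" "t < ?b" by simp_all
    moreover have "0 \<le> t" by (rule order_trans[OF _ t(2)]) simp
    moreover have "t < 1" by (rule less_le_trans[OF t(3) b])
    ultimately have "circle_coord x = t"
      using circle_coord_id by simp
    then show "x \<in> dyadic_arc k j"
      using t by (simp add: dyadic_arc_def dyadic_index_eq_iff)
  qed
  moreover have "closed (to_circle ` {?a..?b})"
    by (rule compact_imp_closed[OF compact_to_circle_image])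
  moreover have "to_circle ?b \<in> to_circle ` {?a..?b}" using ab by simp
  ultimately show ?thesis
    using that[of "to_circle ` {?a..?b}" "{to_circle ?b}"] by simp
qed

section \<open>Normalised Lebesgue measure and orthogonality of the characters\<close>

definition circle_haar :: "circle measure"
  where "circle_haar = distr (restrict_space lborel {0..<1}) borel to_circle"

lemma sets_circle_haar [simp, measurable_cong]: "sets circle_haar = sets borel"
  by (simp add: circle_haar_def)

lemma space_circle_haar [simp]: "space circle_haar = UNIV"
  by (simp add: circle_haar_def)

lemma measurable_to_circle_restrict [measurable]:
  "to_circle \<in> restrict_space lborel {0..<1} \<rightarrow>\<^sub>M borel"
  by (intro measurable_restrict_space1) simp

interpretation circle_haar: prob_space circle_haar
  unfolding circle_haar_def
  by (intro prob_space.prob_space_distr)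
     (auto intro!: prob_spaceI simp: emeasure_restrict_space)

lemma measure_circle_haar_dyadic_arc:
  assumes "j < 2 ^ k"
  shows "measure circle_haar (dyadic_arc k j) = 1 / 2 ^ k"
proof -
  have j: "real j + 1 \<le> 2 ^ k"
    using real_Suc_le_power[OF assms] .
  have "to_circle -` dyadic_arc k j \<inter> {0..<1} = {real j / 2 ^ k ..< (real j + 1) / 2 ^ k}"
  proof (intro set_eqI iffI)
    fix t assume "t \<in> to_circle -` dyadic_arc k j \<inter> {0..<1}"
    then show "t \<in> {real j / 2 ^ k ..< (real j + 1) / 2 ^ k}"
      using circle_coord_id[of t] by (simp add: dyadic_arc_def dyadic_index_eq_iff)
  next
    fix t assume t: "t \<in> {real j / 2 ^ k ..< (real j + 1) / 2 ^ k}"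
    moreover have "(real j + 1) / 2 ^ k \<le> 1" "0 \<le> real j / 2 ^ k" using j by (auto simp: field_simps)
    ultimately have "0 \<le> t" "t < 1"
      unfolding atLeastLessThan_iff by linarith+
    with t show "t \<in> to_circle -` dyadic_arc k j \<inter> {0..<1}"
      by (simp add: dyadic_arc_def dyadic_index_eq_iff circle_coord_id)
  qed
  note pre = this
  let ?A = "{real j / 2 ^ k ..< (real j + 1) / 2 ^ k}"
  have sub: "?A \<subseteq> {0..<1}"
    using pre by (metis Int_lower2)
  have "measure circle_haar (dyadic_arc k j)
      = measure (restrict_space lborel {0..<1}) (to_circle -` dyadic_arc k j \<inter> {0..<1})"
    unfolding circle_haar_def
    by (subst measure_distr[OF measurable_to_circle_restrict dyadic_arc_sets]) (simp only: space_restrict_space2 sets_lborel space_restrict_space space_lborel space_borel Int_UNIV_right)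
  also have "\<dots> = measure lborel ?A"
    unfolding pre using sub measure_restrict_space[of "{0..<1}" lborel ?A] by (simp only: sets_lborel) force
  also have "\<dots> = (real j + 1) / 2 ^ k - real j / 2 ^ k"
    by (rule measure_lborel_Ico) (rule divide_right_mono, simp_all)
  also have "\<dots> = 1 / 2 ^ k" by (simp add: add_divide_distrib)
  finally show ?thesis .
qed

lemma integral_circle_haar:
  fixes f :: "circle \<Rightarrow> complex"
  assumes [measurable]: "f \<in> borel_measurable borel"
  shows "(\<integral>x. f x \<partial>circle_haar) = (LINT t:{0..<1}|lborel. f (to_circle t))"
  unfolding circle_haar_def
  by (subst integral_distr) (auto simp: integral_restrict_space set_lebesgue_integral_def)

lemma integral_fourier_char: "(\<integral>x. fourier_char n x \<partial>circle_haar) = (if n = 0 then 1 else 0)"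
proof (cases "n = 0")
  case True
  then show ?thesis using circle_haar.prob_space by simp
next
  case False
  define F where "F t = exp (\<i> * of_real (- 2 * pi * of_int n * t)) / (\<i> * of_real (- 2 * pi * of_int n))" for t :: real
  have nz: "\<i> * of_real (- 2 * pi * of_int n) \<noteq> (0::complex)" using False by simp
  have "(LINT t:{0..1}|lborel. fourier_char n (to_circle t)) = F 1 - F 0"
    unfolding set_lebesgue_integral_def
  proof (rule integral_FTC_Icc)
    fix t :: real
    show "(F has_vector_derivative fourier_char n (to_circle t)) (at t within {0..1})"
      unfolding F_def fourier_char_to_circle
      using nz by (auto intro!: derivative_eq_intros has_vector_derivative_real_field simp: )
  qed (auto simp: fourier_char_to_circle intro!: continuous_intros)
  also have "F 1 = F 0"
  proof -
    have "exp (\<i> * of_real (- 2 * pi * of_int n * 1)) = exp (complex_of_real (2 * real_of_int (- n) * pi) * \<i>)"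
      by (rule arg_cong[of _ _ exp]) simp
    also have "\<dots> = 1" by (rule exp_integer_2pi) simp
    finally have "exp (\<i> * of_real (- 2 * pi * of_int n * 1)) = (1::complex)" .
    then show ?thesis by (simp add: F_def)
  qed
  finally have "(LINT t:{0..1}|lborel. fourier_char n (to_circle t)) = 0" by simp
  moreover have "(LINT t:{0..1}|lborel. fourier_char n (to_circle t))
      = (LINT t:{0..<1}|lborel. fourier_char n (to_circle t))"
  proof (rule set_integral_cong_set)
    have [measurable]: "(\<lambda>t. fourier_char n (to_circle t)) \<in> borel_measurable lborel" by measurable
    show "set_borel_measurable lborel {0..1} (\<lambda>t. fourier_char n (to_circle t))"
      "set_borel_measurable lborel {0..<1} (\<lambda>t. fourier_char n (to_circle t))"
      unfolding set_borel_measurable_def by measurable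
    show "AE t in lborel. (t \<in> {0..<1::real}) = (t \<in> {0..1})"
      using AE_lborel_singleton[of "1::real"] by eventually_elim auto
  qed
  ultimately show ?thesis
    using False by (simp add: integral_circle_haar)
qed

section \<open>Jordan decomposition of complex measures\<close>

definition signed_measure_on :: "'a measure \<Rightarrow> ('a set \<Rightarrow> real) \<Rightarrow> bool"
  where "signed_measure_on M \<nu> \<longleftrightarrow>
    (\<forall>A :: nat \<Rightarrow> 'a set. range A \<subseteq> sets M \<longrightarrow> disjoint_family A \<longrightarrow>
      (\<lambda>i. \<nu> (A i)) sums \<nu> (\<Union>i. A i))"

lemma signed_measure_on_sums:
  assumes "signed_measure_on M \<nu>" "range A \<subseteq> sets M" "disjoint_family A"
  shows "(\<lambda>i. \<nu> (A i)) sums \<nu> (\<Union>i. A i)"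
  using assms unfolding signed_measure_on_def by blast

lemma signed_measure_on_uminus: "signed_measure_on M \<nu> \<Longrightarrow> signed_measure_on M (\<lambda>A. - \<nu> A)"
  unfolding signed_measure_on_def by (auto intro: sums_minus)

lemma signed_measure_on_Re: "complex_measure M \<mu> \<Longrightarrow> signed_measure_on M (\<lambda>A. Re (\<mu> A))"
  and signed_measure_on_Im: "complex_measure M \<mu> \<Longrightarrow> signed_measure_on M (\<lambda>A. Im (\<mu> A))"
  unfolding complex_measure_def signed_measure_on_def
  by (auto intro: sums_Re sums_Im)

lemma sets_upper_variation [simp, measurable_cong]: "sets (upper_variation M \<nu>) = sets M"
  by (simp add: upper_variation_def sets.space_closed)

lemma space_upper_variation [simp]: "space (upper_variation M \<nu>) = space M"
  by (simp add: upper_variation_def sets.space_closed)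

context
  fixes M :: "'a measure" and \<nu> :: "'a set \<Rightarrow> real"
  assumes signed: "signed_measure_on M \<nu>"
begin

lemmas signed_sums = signed_measure_on_sums[OF signed]

lemma emeasure_upper_variation':
  "E \<in> sets M \<Longrightarrow> emeasure (upper_variation M \<nu>) E = (SUP A \<in> {A \<in> sets M. A \<subseteq> E}. ennreal (\<nu> A))"
  by (rule emeasure_upper_variation[OF signed_sums])

lemma signed_Diff:
  assumes "A \<in> sets M" "E \<in> sets M" "A \<subseteq> E"
  shows "\<nu> (E - A) = \<nu> E - \<nu> A"
proof -
  have "\<nu> (A \<union> (E - A)) = \<nu> A + \<nu> (E - A)"
    using assms by (intro signed_union[OF signed_sums]) auto
  moreover have "A \<union> (E - A) = E" using assms by auto
  ultimately show ?thesis by simp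
qed

text \<open>A set of infinite upper variation can be split into a piece of measure at least 1 in absolute
  value and another piece of infinite upper variation; iterating contradicts countable additivity.\<close>

lemma finite_upper_variation: "emeasure (upper_variation M \<nu>) (space M) < \<infinity>"
proof (rule ccontr)
  let ?up = "upper_variation M \<nu>"
  assume "\<not> emeasure ?up (space M) < \<infinity>"
  then have top: "emeasure ?up (space M) = \<infinity>" by (simp add: less_top[symmetric])
  have step: "\<exists>B. B \<in> sets M \<and> B \<subseteq> E \<and> emeasure ?up B = \<infinity> \<and> \<bar>\<nu> (E - B)\<bar> \<ge> 1"
    if E: "E \<in> sets M" "emeasure ?up E = \<infinity>" for E
  proof -
    \<comment> \<open>With \<open>\<nu> A\<close> above \<open>1 + \<bar>\<nu> E\<bar>\<close>, both
      \<open>A\<close> and \<open>E - A\<close> have measure at least 1 in absolute value, so either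
      of them may be the discarded piece.\<close>
    have "ennreal (1 + \<bar>\<nu> E\<bar>) < (SUP A \<in> {A \<in> sets M. A \<subseteq> E}. ennreal (\<nu> A))"
      unfolding emeasure_upper_variation'[OF E(1), symmetric] E(2) infinity_ennreal_def by (rule ennreal_less_top)
    then obtain A where A: "A \<in> sets M" "A \<subseteq> E" "ennreal (1 + \<bar>\<nu> E\<bar>) < ennreal (\<nu> A)"
      by (auto simp: less_SUP_iff)
    then have gt: "1 + \<bar>\<nu> E\<bar> < \<nu> A"
      using ennreal_leI[of "\<nu> A" "1 + \<bar>\<nu> E\<bar>"] by (meson not_le)
    have "\<nu> (E - A) = \<nu> E - \<nu> A" by (rule signed_Diff[OF A(1) E(1) A(2)])
    then have lt: "\<bar>\<nu> (E - A)\<bar> \<ge> 1" using gt by linarith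
    have "emeasure ?up A + emeasure ?up (E - A) = emeasure ?up E"
      using A E by (subst plus_emeasure) (auto simp: Un_absorb1 Un_Diff_cancel)
    then have "emeasure ?up A = \<infinity> \<or> emeasure ?up (E - A) = \<infinity>"
      using E(2) by (auto simp: ennreal_add_eq_top)
    then show ?thesis
    proof
      assume "emeasure ?up A = \<infinity>"
      with A lt show ?thesis by blast
    next
      assume "emeasure ?up (E - A) = \<infinity>"
      moreover have "E - (E - A) = A" using A by auto
      ultimately show ?thesis using A E gt by (intro exI[of _ "E - A"]) auto
    qed
  qed
  define S where "S = {E \<in> sets M. emeasure ?up E = \<infinity>}"
  have "\<forall>E\<in>S. \<exists>B. B \<in> S \<and> B \<subseteq> E \<and> \<bar>\<nu> (E - B)\<bar> \<ge> 1"
    unfolding S_def using step by blast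
  then obtain next_set where nx: "\<And>E. E \<in> S \<Longrightarrow> next_set E \<in> S"
    "\<And>E. E \<in> S \<Longrightarrow> next_set E \<subseteq> E" "\<And>E. E \<in> S \<Longrightarrow> \<bar>\<nu> (E - next_set E)\<bar> \<ge> 1"
    by metis
  define F where "F n = (next_set ^^ n) (space M)" for n
  have FSuc: "F (Suc n) = next_set (F n)" for n by (simp add: F_def)
  have FS: "F n \<in> S" for n
  proof (induct n)
    case 0
    show ?case by (simp add: F_def S_def top)
  next
    case (Suc n)
    then show ?case unfolding FSuc by (rule nx(1))
  qed
  have dec: "F (Suc n) \<subseteq> F n" for n using nx(2)[OF FS[of n]] by (simp add: FSuc)
  have decseq: "F n \<subseteq> F m" if "m \<le> n" for m n
    using that dec by (rule lift_Suc_antimono_le[of F, rotated])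
  define D where "D n = F n - F (Suc n)" for n
  have "disjoint_family D"
  proof -
    have "D m \<inter> D n = {}" if "m < n" for m n
      using decseq[of "Suc m" n] that by (auto simp: D_def)
    then show ?thesis
      unfolding disjoint_family_on_def by (metis Int_commute linorder_neqE_nat)
  qed
  moreover have "range D \<subseteq> sets M"
    using FS by (auto simp: D_def S_def)
  ultimately have "(\<lambda>i. \<nu> (D i)) \<longlonglongrightarrow> 0"
    using signed_sums[of D] by (blast intro: summable_LIMSEQ_zero sums_summable)
  then have "eventually (\<lambda>i. \<bar>\<nu> (D i)\<bar> < 1) sequentially"
    using order_tendstoD(2)[OF tendsto_rabs_zero, of "\<lambda>i. \<nu> (D i)" sequentially 1] by simp
  then obtain i where "\<bar>\<nu> (D i)\<bar> < 1"
    by (auto dest: eventually_happens)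
  moreover have "\<bar>\<nu> (D i)\<bar> \<ge> 1" using nx(3)[OF FS] by (simp add: D_def FSuc)
  ultimately show False by simp
qed

lemma finite_measure_upper_variation: "finite_measure (upper_variation M \<nu>)"
  using finite_upper_variation by (intro finite_measureI) (simp add: less_top[symmetric])

lemma upper_variation_null:
  assumes "A \<in> sets M" "\<And>B. B \<in> sets M \<Longrightarrow> B \<subseteq> A \<Longrightarrow> \<nu> B \<le> 0"
  shows "emeasure (upper_variation M \<nu>) A = 0"
proof -
  have "emeasure (upper_variation M \<nu>) A \<le> 0"
    unfolding emeasure_upper_variation'[OF assms(1)]
    by (rule SUP_least) (use assms in \<open>auto simp: ennreal_neg\<close>)
  then show ?thesis by simp
qed

lemma le_measure_upper_variation:
  assumes "A \<in> sets M" "B \<in> sets M" "B \<subseteq> A"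
  shows "\<nu> B \<le> measure (upper_variation M \<nu>) A"
proof -
  interpret finite_measure "upper_variation M \<nu>" by (rule finite_measure_upper_variation)
  have "ennreal (\<nu> B) \<le> emeasure (upper_variation M \<nu>) A"
    unfolding emeasure_upper_variation'[OF assms(1)] using assms by (intro SUP_upper) auto
  then show ?thesis
    by (simp add: emeasure_eq_measure)
qed

lemma measure_upper_variation_le:
  assumes "A \<in> sets M" "\<And>B. B \<in> sets M \<Longrightarrow> B \<subseteq> A \<Longrightarrow> \<nu> B \<le> c"
  shows "measure (upper_variation M \<nu>) A \<le> c"
proof -
  interpret finite_measure "upper_variation M \<nu>" by (rule finite_measure_upper_variation)
  have "emeasure (upper_variation M \<nu>) A \<le> ennreal c"
    unfolding emeasure_upper_variation'[OF assms(1)] using assms(2) by (intro SUP_least) (auto intro: ennreal_leI)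
  moreover have "0 \<le> c" using assms(2)[of "{}"] signed_empty[OF signed_sums] by simp
  ultimately show ?thesis
    by (simp add: emeasure_eq_measure)
qed

end

text \<open>Complementation inside \<open>A\<close> exchanges the two suprema: by
  \<open>signed_Diff\<close>, \<open>\<nu> B\<close> exceeds \<open>\<nu> A\<close> by minus the
  value of \<open>\<nu>\<close> on \<open>A - B\<close>.\<close>

lemma jordan_decomposition:
  assumes s: "signed_measure_on M \<nu>" and A: "A \<in> sets M"
  shows "\<nu> A = measure (upper_variation M \<nu>) A - measure (upper_variation M (\<lambda>A. - \<nu> A)) A"
proof -
  note s' = signed_measure_on_uminus[OF s]
  let ?p = "measure (upper_variation M \<nu>) A" and ?n = "measure (upper_variation M (\<lambda>A. - \<nu> A)) A"
  have "\<nu> B \<le> \<nu> A + ?n" if "B \<in> sets M" "B \<subseteq> A" for B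
    using le_measure_upper_variation[OF s' A, of "A - B"] signed_Diff[OF s that(1) A that(2)] that A by auto
  then have "?p \<le> \<nu> A + ?n" by (rule measure_upper_variation_le[OF s A])
  moreover have "- \<nu> B \<le> ?p - \<nu> A" if "B \<in> sets M" "B \<subseteq> A" for B
    using le_measure_upper_variation[OF s A, of "A - B"] signed_Diff[OF s that(1) A that(2)] that A by auto
  then have "?n \<le> ?p - \<nu> A" by (rule measure_upper_variation_le[OF s' A])
  ultimately show ?thesis by linarith
qed

text \<open>Any finite measure dominating the four Jordan parts serves as well as the total variation.\<close>

definition dominating_measure :: "'a measure \<Rightarrow> ('a set \<Rightarrow> complex) \<Rightarrow> 'a measure"
  where "dominating_measure M \<mu> = measure_of (space M) (sets M)
    (\<lambda>A. emeasure (upper_variation M (\<lambda>A. Re (\<mu> A))) A + emeasure (upper_variation M (\<lambda>A. - Re (\<mu> A))) A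
       + (emeasure (upper_variation M (\<lambda>A. Im (\<mu> A))) A + emeasure (upper_variation M (\<lambda>A. - Im (\<mu> A))) A))"

lemma sets_dominating_measure [simp, measurable_cong]: "sets (dominating_measure M \<mu>) = sets M"
  by (simp add: dominating_measure_def sets.space_closed)

lemma space_dominating_measure [simp]: "space (dominating_measure M \<mu>) = space M"
  by (simp add: dominating_measure_def sets.space_closed)

lemma emeasure_dominating_measure:
  assumes "E \<in> sets M"
  shows "emeasure (dominating_measure M \<mu>) E =
    emeasure (upper_variation M (\<lambda>A. Re (\<mu> A))) E + emeasure (upper_variation M (\<lambda>A. - Re (\<mu> A))) E
       + (emeasure (upper_variation M (\<lambda>A. Im (\<mu> A))) E + emeasure (upper_variation M (\<lambda>A. - Im (\<mu> A))) E)"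
  unfolding dominating_measure_def
proof (rule emeasure_measure_of_sigma)
  let ?f = "\<lambda>A. emeasure (upper_variation M (\<lambda>A. Re (\<mu> A))) A + emeasure (upper_variation M (\<lambda>A. - Re (\<mu> A))) A
       + (emeasure (upper_variation M (\<lambda>A. Im (\<mu> A))) A + emeasure (upper_variation M (\<lambda>A. - Im (\<mu> A))) A)"
  show "sigma_algebra (space M) (sets M)" ..
  show "positive (sets M) ?f" by (simp add: positive_def)
  show "countably_additive (sets M) ?f"
    unfolding countably_additive_def
    by (intro allI impI) (simp add: suminf_add[symmetric] suminf_emeasure)
qed (fact assms)

context
  fixes M :: "'a measure" and \<mu> :: "'a set \<Rightarrow> complex"
  assumes \<mu>: "complex_measure M \<mu>"
begin

private abbreviation "\<rho> \<equiv> dominating_measure M \<mu>"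
private abbreviation "rp \<equiv> upper_variation M (\<lambda>A. Re (\<mu> A))"
private abbreviation "rn \<equiv> upper_variation M (\<lambda>A. - Re (\<mu> A))"
private abbreviation "ip \<equiv> upper_variation M (\<lambda>A. Im (\<mu> A))"
private abbreviation "im \<equiv> upper_variation M (\<lambda>A. - Im (\<mu> A))"

private lemmas sRe = signed_measure_on_Re[OF \<mu>] signed_measure_on_uminus[OF signed_measure_on_Re[OF \<mu>]]
private lemmas sIm = signed_measure_on_Im[OF \<mu>] signed_measure_on_uminus[OF signed_measure_on_Im[OF \<mu>]]
private lemmas fin4 = sRe[THEN finite_measure_upper_variation] sIm[THEN finite_measure_upper_variation]

lemma finite_dominating_measure: "finite_measure \<rho>"
  using sRe[THEN finite_upper_variation] sIm[THEN finite_upper_variation]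
  by (intro finite_measureI) (simp add: emeasure_dominating_measure less_top[symmetric])

lemma upper_variation_le_dominating: "rp \<le> \<rho>" "rn \<le> \<rho>" "ip \<le> \<rho>" "im \<le> \<rho>"
proof -
  have *: "N \<le> \<rho>" if "sets N = sets M" "\<And>A. A \<in> sets M \<Longrightarrow> emeasure N A \<le> emeasure \<rho> A" for N
    using that by (subst le_measure) (auto simp: le_fun_def emeasure_notin_sets)
  show "rp \<le> \<rho>" "rn \<le> \<rho>" "ip \<le> \<rho>" "im \<le> \<rho>"
    by (intro *; simp add: emeasure_dominating_measure add_increasing add_increasing2)+
qed

lemma dominating_measure_null:
  assumes "A \<in> sets M" "\<And>B. B \<in> sets M \<Longrightarrow> B \<subseteq> A \<Longrightarrow> \<mu> B = 0"
  shows "emeasure \<rho> A = 0"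
  using assms sRe[THEN upper_variation_null, of A] sIm[THEN upper_variation_null, of A]
  by (simp add: emeasure_dominating_measure)

lemma complex_measure_eq:
  assumes "A \<in> sets M"
  shows "\<mu> A = of_real (measure rp A - measure rn A) + \<i> * of_real (measure ip A - measure im A)"
  using jordan_decomposition[OF sRe(1) assms] jordan_decomposition[OF sIm(1) assms]
  by (simp add: complex_eq_iff)

lemma norm_complex_measure_le:
  assumes A: "A \<in> sets M"
  shows "norm (\<mu> A) \<le> measure \<rho> A"
proof -
  interpret rp: finite_measure rp by (rule fin4)
  interpret rn: finite_measure rn by (rule fin4)
  interpret ip: finite_measure ip by (rule fin4)
  interpret i_n: finite_measure im by (rule fin4)
  have "measure \<rho> A = measure rp A + measure rn A + (measure ip A + measure im A)"
    by (simp add: measure_def[of \<rho>] emeasure_dominating_measure[OF A] rp.emeasure_eq_measure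
        rn.emeasure_eq_measure ip.emeasure_eq_measure i_n.emeasure_eq_measure ennreal_plus[symmetric] del: ennreal_plus)
  moreover have "norm (\<mu> A) \<le> \<bar>Re (\<mu> A)\<bar> + \<bar>Im (\<mu> A)\<bar>" by (rule cmod_le)
  ultimately show ?thesis
    using jordan_decomposition[OF sRe(1) A] jordan_decomposition[OF sIm(1) A]
      measure_nonneg[of rp A] measure_nonneg[of rn A] measure_nonneg[of ip A] measure_nonneg[of im A]
    by linarith
qed

lemma integrable_upper_variation:
  fixes f :: "'a \<Rightarrow> complex"
  assumes "integrable \<rho> f"
  shows "integrable rp f" "integrable rn f" "integrable ip f" "integrable im f"
proof -
  have *: "integrable N f" if "sets N = sets M" "N \<le> \<rho>" for N
  proof (rule integrableI_bounded)
    have [measurable]: "f \<in> borel_measurable M"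
      using borel_measurable_integrable[OF assms] measurable_cong_sets[OF sets_dominating_measure refl] by blast
    show "f \<in> borel_measurable N"
      by (subst measurable_cong_sets[OF that(1) refl]) measurable
    have "(\<integral>\<^sup>+x. norm (f x) \<partial>N) \<le> (\<integral>\<^sup>+x. norm (f x) \<partial>\<rho>)"
      using that by (intro nn_integral_mono_measure) simp_all
    then show "(\<integral>\<^sup>+x. norm (f x) \<partial>N) < \<infinity>"
      using assms by (auto simp: integrable_iff_bounded)
  qed
  show "integrable rp f" "integrable rn f" "integrable ip f" "integrable im f"
    by (intro * upper_variation_le_dominating; simp)+
qed

lemma cmeasure_integral_add:
  assumes "integrable \<rho> f" "integrable \<rho> g"
  shows "cmeasure_integral M \<mu> (\<lambda>x. f x + g x) = cmeasure_integral M \<mu> f + cmeasure_integral M \<mu> g"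
  unfolding cmeasure_integral_def signed_integral_def
  using integrable_upper_variation[OF assms(1)] integrable_upper_variation[OF assms(2)]
  by (simp add: algebra_simps)

lemma cmeasure_integral_cmult:
  assumes "integrable \<rho> f"
  shows "cmeasure_integral M \<mu> (\<lambda>x. c * f x) = c * cmeasure_integral M \<mu> f"
  unfolding cmeasure_integral_def signed_integral_def
  using integrable_upper_variation[OF assms(1)]
  by (simp add: algebra_simps)

lemma cmeasure_integral_diff:
  assumes "integrable \<rho> f" "integrable \<rho> g"
  shows "cmeasure_integral M \<mu> (\<lambda>x. f x - g x) = cmeasure_integral M \<mu> f - cmeasure_integral M \<mu> g"
  unfolding cmeasure_integral_def signed_integral_def
  using integrable_upper_variation[OF assms(1)] integrable_upper_variation[OF assms(2)]
  by (simp add: algebra_simps)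

lemma cmeasure_integral_zero [simp]: "cmeasure_integral M \<mu> (\<lambda>x. 0) = 0"
  by (simp add: cmeasure_integral_def signed_integral_def)

lemma cmeasure_integral_sum:
  assumes "\<And>i. i \<in> I \<Longrightarrow> integrable \<rho> (f i)"
  shows "cmeasure_integral M \<mu> (\<lambda>x. \<Sum>i\<in>I. f i x) = (\<Sum>i\<in>I. cmeasure_integral M \<mu> (f i))"
  using assms by (induct I rule: infinite_finite_induct) (simp_all add: cmeasure_integral_add)

lemma cmeasure_integral_indicator:
  assumes "A \<in> sets M"
  shows "cmeasure_integral M \<mu> (indicator A) = \<mu> A"
proof -
  have "(\<integral>x. indicator A x \<partial>N) = complex_of_real (measure N A)" if "space N = space M" for N
  proof -
    have "(\<integral>x. indicator A x \<partial>N) = (\<integral>x. complex_of_real (indicator A x) \<partial>N)"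
      by (simp add: of_real_indicator)
    also have "\<dots> = complex_of_real (measure N A)"
      using sets.sets_into_space[OF assms] that by (simp add: integral_complex_of_real Int_absorb2)
    finally show ?thesis .
  qed
  then show ?thesis
    unfolding cmeasure_integral_def signed_integral_def complex_measure_eq[OF assms] by simp
qed

text \<open>The factor 4 counts the four Jordan parts, each of which is dominated by
  \<open>\<rho>\<close>.\<close>

lemma norm_cmeasure_integral_le:
  assumes "integrable \<rho> f"
  shows "norm (cmeasure_integral M \<mu> f) \<le> 4 * (\<integral>x. norm (f x) \<partial>\<rho>)"
proof -
  have fin: "(\<integral>\<^sup>+x. norm (f x) \<partial>\<rho>) < \<infinity>" using assms by (auto simp: integrable_iff_bounded)
  have *: "norm (\<integral>x. f x \<partial>N) \<le> (\<integral>x. norm (f x) \<partial>\<rho>)" if "sets N = sets M" "N \<le> \<rho>" "integrable N f" for N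
  proof -
    have "(\<integral>\<^sup>+x. norm (f x) \<partial>N) \<le> (\<integral>\<^sup>+x. norm (f x) \<partial>\<rho>)"
      using that by (intro nn_integral_mono_measure) simp_all
    then have "ennreal (\<integral>x. norm (f x) \<partial>N) \<le> ennreal (\<integral>x. norm (f x) \<partial>\<rho>)"
      using assms that by (simp add: nn_integral_eq_integral integrable_norm)
    then have "(\<integral>x. norm (f x) \<partial>N) \<le> (\<integral>x. norm (f x) \<partial>\<rho>)"
      by (simp add: integral_nonneg_AE)
    then show ?thesis using integral_norm_bound[of N f] by linarith
  qed
  note i = integrable_upper_variation[OF assms]
  note le = upper_variation_le_dominating
  note b = *[OF sets_upper_variation le(1) i(1)] *[OF sets_upper_variation le(2) i(2)]
    *[OF sets_upper_variation le(3) i(3)] *[OF sets_upper_variation le(4) i(4)]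
  have "norm (cmeasure_integral M \<mu> f) \<le> norm (signed_integral M (\<lambda>A. Re (\<mu> A)) f) + norm (signed_integral M (\<lambda>A. Im (\<mu> A)) f)"
    unfolding cmeasure_integral_def by (rule order_trans[OF norm_triangle_ineq]) (simp add: norm_mult)
  also have "\<dots> \<le> (norm (\<integral>x. f x \<partial>rp) + norm (\<integral>x. f x \<partial>rn)) + (norm (\<integral>x. f x \<partial>ip) + norm (\<integral>x. f x \<partial>im))"
    unfolding signed_integral_def by (intro add_mono norm_triangle_ineq4)
  finally show ?thesis using b by linarith
qed

end

lemma measure_upper_variation_nonneg:
  assumes fin: "finite_measure N" and s: "sets N = sets M"
  shows "upper_variation M (measure N) = N" "upper_variation M (\<lambda>A. - measure N A) = null_measure M"
proof -
  interpret finite_measure N by fact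
  have sm: "signed_measure_on M (measure N)"
    unfolding signed_measure_on_def using s finite_measure_UNION by blast
  have eq: "(SUP A \<in> {A \<in> sets M. A \<subseteq> E}. ennreal (measure N A)) = emeasure N E" if "E \<in> sets M" for E
    using that s by (intro antisym SUP_least SUP_upper2[of E]) (auto simp: emeasure_eq_measure finite_measure_mono)
  show "upper_variation M (measure N) = N"
    by (rule measure_eqI) (auto simp: s emeasure_upper_variation'[OF sm] eq)
  show "upper_variation M (\<lambda>A. - measure N A) = null_measure M"
    by (rule measure_eqI) (auto intro!: upper_variation_null[OF signed_measure_on_uminus[OF sm]])
qed

text \<open>Reduces Fourier transforms of positive measures, the only ones used for non-detection,
  to ordinary integrals.\<close>

lemma complex_measure_of_measure:
  assumes fin: "finite_measure N" and s: "sets N = sets M"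
  shows "complex_measure M (\<lambda>A. of_real (measure N A))"
    and "cmeasure_integral M (\<lambda>A. of_real (measure N A)) f = (\<integral>x. f x \<partial>N)"
proof -
  interpret finite_measure N by fact
  show "complex_measure M (\<lambda>A. of_real (measure N A))"
    unfolding complex_measure_def using s finite_measure_UNION sums_of_real by blast
  have 0: "upper_variation M (\<lambda>A. 0) = null_measure M"
    by (rule measure_eqI) (auto intro!: upper_variation_null simp: signed_measure_on_def)
  show "cmeasure_integral M (\<lambda>A. of_real (measure N A)) f = (\<integral>x. f x \<partial>N)"
    unfolding cmeasure_integral_def signed_integral_def
    using measure_upper_variation_nonneg[OF assms] by (simp add: 0)
qed

section \<open>Trigonometric approximation of arcs\<close>

definition trig_poly :: "int set \<Rightarrow> (int \<Rightarrow> complex) \<Rightarrow> circle \<Rightarrow> complex"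
  where "trig_poly F a x = (\<Sum>n\<in>F. a n * fourier_char n x)"

lemma measurable_trig_poly [measurable]: "trig_poly F a \<in> borel_measurable borel"
  unfolding trig_poly_def[abs_def] by measurable

lemma trig_poly_extend:
  assumes "finite G" "F \<subseteq> G" "\<And>n. n \<in> G - F \<Longrightarrow> a n = 0"
  shows "trig_poly G a x = trig_poly F a x"
  unfolding trig_poly_def using assms by (intro sum.mono_neutral_right) auto

lemma trig_poly_add:
  assumes "finite F" "finite G"
  shows "\<exists>c. \<forall>x. trig_poly F a x + trig_poly G b x = trig_poly (F \<union> G) c x"
proof (intro exI allI)
  fix x
  let ?c = "\<lambda>n. (if n \<in> F then a n else 0) + (if n \<in> G then b n else 0)"
  have "trig_poly F a x = trig_poly (F \<union> G) (\<lambda>n. if n \<in> F then a n else 0) x"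
    unfolding trig_poly_def using assms by (intro sum.mono_neutral_cong_left) auto
  moreover have "trig_poly G b x = trig_poly (F \<union> G) (\<lambda>n. if n \<in> G then b n else 0) x"
    unfolding trig_poly_def using assms by (intro sum.mono_neutral_cong_left) auto
  ultimately show "trig_poly F a x + trig_poly G b x = trig_poly (F \<union> G) ?c x"
    by (simp add: trig_poly_def sum.distrib[symmetric] distrib_right)
qed

text \<open>Closure under products, for the function ring of the Stone-Weierstrass theorem.
  Multiplication by one character translates the frequencies, and the general case adds up such
  translates.\<close>

lemma trig_poly_mult:
  assumes "finite F" "finite G"
  shows "\<exists>H c. finite H \<and> (\<forall>x. trig_poly F a x * trig_poly G b x = trig_poly H c x)"
  using assms(1)
proof (induct F)
  case empty
  show ?case by (intro exI[of _ "{}"]) (simp add: trig_poly_def)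
next
  case (insert n F)
  then obtain H c where H: "finite H" "\<And>x. trig_poly F a x * trig_poly G b x = trig_poly H c x" by blast
  let ?G = "(\<lambda>m. n + m) ` G"
  have "a n * fourier_char n x * trig_poly G b x = trig_poly ?G (\<lambda>m. a n * b (m - n)) x" for x
    unfolding trig_poly_def
    by (subst sum.reindex) (auto simp: inj_on_def sum_distrib_left fourier_char_add mult_ac)
  moreover obtain d where "\<And>x. trig_poly H c x + trig_poly ?G (\<lambda>m. a n * b (m - n)) x = trig_poly (H \<union> ?G) d x"
    using trig_poly_add[OF H(1), of ?G] assms(2) by blast
  moreover have "trig_poly (insert n F) a x = trig_poly F a x + a n * fourier_char n x" for x
    using insert by (simp add: trig_poly_def)
  ultimately have "trig_poly (insert n F) a x * trig_poly G b x = trig_poly (H \<union> ?G) d x" for x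
    using H(2)[of x] by (simp add: distrib_right)
  then show ?case using H(1) assms(2) by (intro exI[of _ "H \<union> ?G"]) auto
qed

text \<open>The coefficients stay complex while the values are real: the real Stone-Weierstrass
  theorem needs a ring of real functions, but the result is to be tested on Fourier
  coefficients.\<close>

definition real_trig_polys :: "(circle \<Rightarrow> real) set"
  where "real_trig_polys = {f. \<exists>F a. finite F \<and> (\<forall>x. complex_of_real (f x) = trig_poly F a x)}"

lemma fourier_char_1_inj: "fourier_char 1 x = fourier_char 1 y \<Longrightarrow> x = y"
proof -
  assume "fourier_char 1 x = fourier_char 1 y"
  then obtain n :: int where "\<i> * of_real (- 2 * pi * of_int 1 * circle_coord x)
      = \<i> * of_real (- 2 * pi * of_int 1 * circle_coord y) + (of_int (2 * n) * pi) * \<i>"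
    unfolding fourier_char_coord exp_eq by blast
  then have "Im (\<i> * of_real (- 2 * pi * of_int 1 * circle_coord x))
      = Im (\<i> * of_real (- 2 * pi * of_int 1 * circle_coord y) + (of_int (2 * n) * pi) * \<i>)"
    by (rule arg_cong)
  then have "pi * (circle_coord x - circle_coord y + of_int n) = 0"
    by (simp add: algebra_simps)
  then have "circle_coord x - circle_coord y + of_int n = 0"
    using pi_gt_zero by (simp only: mult_eq_0_iff) simp
  then have "circle_coord x - circle_coord y = of_int (- n)" by simp
  then have "to_circle (circle_coord x) = to_circle (circle_coord y)"
    unfolding to_circle_eq_iff by (metis Ints_of_int)
  then show ?thesis by simp
qed

lemma real_trig_polysI:
  assumes "finite F" "\<And>x. complex_of_real (f x) = trig_poly F a x"
  shows "f \<in> real_trig_polys"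
  unfolding real_trig_polys_def using assms by blast

lemma real_trig_polysE:
  assumes "f \<in> real_trig_polys"
  obtains F a where "finite F" "\<forall>x. complex_of_real (f x) = trig_poly F a x"
  using assms unfolding real_trig_polys_def by blast

interpretation trig: function_ring_on real_trig_polys "UNIV :: circle set"
proof
  show "compact (UNIV :: circle set)" by (rule compact_UNIV_circle)
next
  fix f :: "circle \<Rightarrow> real" assume "f \<in> real_trig_polys"
  then obtain F a where "finite F" and f: "\<forall>x. complex_of_real (f x) = trig_poly F a x"
    by (rule real_trig_polysE)
  have "f x = Re (trig_poly F a x)" for x using f by (metis Re_complex_of_real)
  moreover have "continuous_on UNIV (\<lambda>x. Re (trig_poly F a x))"
    unfolding trig_poly_def by (intro continuous_intros continuous_on_fourier_char)
  ultimately show "continuous_on UNIV f"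
    by (simp cong: continuous_on_cong)
next
  fix f g assume "f \<in> real_trig_polys" "g \<in> real_trig_polys"
  note fg = this
  obtain F a where f: "finite F" "\<forall>x. complex_of_real (f x) = trig_poly F a x"
    using fg(1) by (rule real_trig_polysE)
  obtain G b where g: "finite G" "\<forall>x. complex_of_real (g x) = trig_poly G b x"
    using fg(2) by (rule real_trig_polysE)
  obtain c where c: "\<forall>x. trig_poly F a x + trig_poly G b x = trig_poly (F \<union> G) c x"
    using trig_poly_add[OF f(1) g(1), of a b] by (rule exE)
  show "(\<lambda>x. f x + g x) \<in> real_trig_polys"
    by (rule real_trig_polysI[of "F \<union> G" _ c]) (simp_all add: f g c)
  obtain H c where H: "finite H" "\<forall>x. trig_poly F a x * trig_poly G b x = trig_poly H c x"
    using trig_poly_mult[OF f(1) g(1), of a b] by (elim exE conjE)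
  show "(\<lambda>x. f x * g x) \<in> real_trig_polys"
    by (rule real_trig_polysI[of H _ c]) (simp_all add: f g H)
next
  fix c :: real
  show "(\<lambda>_. c) \<in> real_trig_polys"
    by (rule real_trig_polysI[of "{0}" _ "\<lambda>_. of_real c"]) (simp_all add: trig_poly_def)
next
  fix x y :: circle assume "x \<noteq> y"
  then have ne: "fourier_char 1 x \<noteq> fourier_char 1 y" using fourier_char_1_inj by blast
  have conj: "fourier_char (- 1) z = cnj (fourier_char 1 z)" for z by (simp add: cnj_fourier_char)
  have two: "trig_poly {1, -1} a z = a 1 * fourier_char 1 z + a (- 1) * cnj (fourier_char 1 z)" for a z
    by (simp add: trig_poly_def conj)
  have re: "(\<lambda>z. Re (fourier_char 1 z)) \<in> real_trig_polys"
    by (rule real_trig_polysI[of "{1, -1}" _ "\<lambda>_. 1/2"]) (simp_all add: two complex_eq_iff)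
  have im: "(\<lambda>z. Im (fourier_char 1 z)) \<in> real_trig_polys"
    by (rule real_trig_polysI[of "{1, -1}" _ "\<lambda>n. - \<i> * of_int n / 2"]) (simp_all add: two complex_eq_iff)
  show "\<exists>f\<in>real_trig_polys. f x \<noteq> f y"
  proof (cases "Re (fourier_char 1 x) = Re (fourier_char 1 y)")
    case True
    then have "Im (fourier_char 1 x) \<noteq> Im (fourier_char 1 y)"
      using ne by (simp add: complex_eq_iff)
    then show ?thesis by (rule bexI[OF _ im])
  next
    case False
    then show ?thesis by (rule bexI[OF _ re])
  qed
qed

lemma trig_poly_approx:
  fixes g :: "circle \<Rightarrow> real"
  assumes "continuous_on UNIV g" "e > 0"
  shows "\<exists>F a. finite F \<and> (\<forall>n. n \<notin> F \<longrightarrow> a n = 0) \<and> (\<forall>x. norm (trig_poly F a x - of_real (g x)) < e)"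
proof -
  obtain f where f: "f \<in> real_trig_polys" "\<And>x. \<bar>g x - f x\<bar> < e"
    using trig.Stone_Weierstrass_basic[OF assms] by blast
  obtain F a where a: "finite F" "\<forall>x. complex_of_real (f x) = trig_poly F a x"
    using f(1) by (rule real_trig_polysE)
  \<comment> \<open>Coefficients are cut to zero off \<open>F\<close>, so that polynomials with
    different frequency sets can later be subtracted on the union of these sets.\<close>
  define b where "b = (\<lambda>n. if n \<in> F then a n else 0)"
  have b: "trig_poly F b x = trig_poly F a x" for x
    by (simp add: trig_poly_def b_def)
  have "norm (trig_poly F b x - of_real (g x)) < e" for x
    using f(2)[of x] unfolding b a(2)[rule_format, symmetric] of_real_diff[symmetric] norm_of_real by linarith
  then show ?thesis using a(1) by (intro exI[of _ F] exI[of _ b]) (simp add: b_def)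
qed

lemma parseval_trig_poly:
  assumes "finite F"
  shows "(\<integral>x. (norm (trig_poly F a x))\<^sup>2 \<partial>circle_haar) = (\<Sum>n\<in>F. (norm (a n))\<^sup>2)"
proof -
  have int: "integrable circle_haar (fourier_char n)" for n
    by (rule circle_haar.integrable_const_bound[of _ 1]) auto
  have "complex_of_real ((norm (trig_poly F a x))\<^sup>2) = (\<Sum>n\<in>F. \<Sum>m\<in>F. a n * cnj (a m) * fourier_char (n - m) x)" for x
    unfolding complex_norm_square trig_poly_def cnj_sum sum_product
    using fourier_char_add[of _ "- _" x] by (simp add: cnj_fourier_char mult_ac)
  then have "complex_of_real (\<integral>x. (norm (trig_poly F a x))\<^sup>2 \<partial>circle_haar)
      = (\<integral>x. (\<Sum>n\<in>F. \<Sum>m\<in>F. a n * cnj (a m) * fourier_char (n - m) x) \<partial>circle_haar)"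
    by (simp only: integral_complex_of_real[symmetric])
  also have "\<dots> = (\<Sum>n\<in>F. \<Sum>m\<in>F. a n * cnj (a m) * (if n - m = 0 then 1 else 0))"
    by (simp add: int integral_fourier_char)
  also have "\<dots> = (\<Sum>n\<in>F. \<Sum>m\<in>F. if n = m then a n * cnj (a m) else 0)"
    by (intro sum.cong) auto
  also have "\<dots> = complex_of_real (\<Sum>n\<in>F. (norm (a n))\<^sup>2)"
    using assms by (simp add: sum.delta complex_norm_square del: of_real_power)
  finally show ?thesis by (simp only: of_real_eq_iff)
qed

text \<open>Continuous majorants that decrease to the indicator of a closed set. The empty set is
  separate because \<open>infdist\<close> to it is 0 by convention, which would give the constant
  1.\<close>

definition closed_ramp :: "circle set \<Rightarrow> nat \<Rightarrow> circle \<Rightarrow> real"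
  where "closed_ramp F m x = (if F = {} then 0 else max 0 (1 - real m * infdist x F))"

lemma continuous_on_closed_ramp: "continuous_on S (closed_ramp F m)"
  unfolding closed_ramp_def[abs_def]
  by (cases "F = {}") (auto intro!: continuous_intros)

lemma closed_ramp_bounds: "0 \<le> closed_ramp F m x" "closed_ramp F m x \<le> 1"
  by (auto simp: closed_ramp_def infdist_nonneg)

lemma closed_ramp_tendsto:
  assumes "closed F"
  shows "(\<lambda>m. closed_ramp F m x) \<longlonglongrightarrow> indicator F x"
proof (cases "x \<in> F")
  case True
  then have "closed_ramp F m x = 1" for m by (auto simp: closed_ramp_def)
  with True show ?thesis by simp
next
  case False
  show ?thesis
  proof (cases "F = {}")
    case True then show ?thesis by (simp add: closed_ramp_def)
  next
    case ne: False
    have d: "infdist x F > 0"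
      using in_closed_iff_infdist_zero[OF assms ne, of x] False infdist_nonneg[of x F] by linarith
    obtain m0 :: nat where m0: "1 / infdist x F < real m0" using reals_Archimedean2 by blast
    have "closed_ramp F m x = 0" if "m \<ge> m0" for m
    proof -
      have "1 / infdist x F \<le> real m" using m0 that by linarith
      then have "1 \<le> real m * infdist x F" using d by (simp add: field_simps)
      then show ?thesis using ne by (simp add: closed_ramp_def)
    qed
    then have "(\<lambda>m. closed_ramp F m x) \<longlonglongrightarrow> 0"
      by (intro tendsto_eventually) (auto simp: eventually_sequentially)
    then show ?thesis using False by simp
  qed
qed

text \<open>Two modes of convergence are wanted at once: bounded convergence at every point passes
  to all complex measures, singular ones included, while the prescribed mean square rate
  \<open>\<delta>\<close> will control the noise. The rate comes from selecting indices of one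
  pointwise convergent sequence.\<close>

lemma arc_trig_approximation:
  fixes \<delta> :: "nat \<Rightarrow> real"
  assumes k: "k \<ge> 1" and \<delta>: "\<And>l. \<delta> l > 0"
  obtains F a where
    "\<And>l :: nat. finite (F l)" "\<And>l n. n \<notin> F l \<Longrightarrow> a l n = 0"
    "\<And>l x. norm (trig_poly (F l) (a l) x) \<le> 2"
    "\<And>x. (\<lambda>l. trig_poly (F l) (a l) x) \<longlonglongrightarrow> indicator (dyadic_arc k j) x"
    "\<And>l. (\<integral>x. (norm (trig_poly (F l) (a l) x - indicator (dyadic_arc k j) x))\<^sup>2 \<partial>circle_haar) \<le> \<delta> l"
proof -
  let ?I = "dyadic_arc k j"
  obtain A B where AB: "closed A" "closed B" "B \<subseteq> A" "?I = A - B"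
    using dyadic_arc_diff_closed[OF k] by blast
  define g where "g m x = closed_ramp A m x - closed_ramp B m x" for m x
  have g_cont: "continuous_on UNIV (g m)" for m
    unfolding g_def[abs_def] by (intro continuous_intros continuous_on_closed_ramp)
  have g_bound: "\<bar>g m x\<bar> \<le> 1" for m x
    unfolding g_def using closed_ramp_bounds[of A m x] closed_ramp_bounds[of B m x] by linarith
  have g_lim: "(\<lambda>m. g m x) \<longlonglongrightarrow> indicator ?I x" for x
  proof -
    have "indicator ?I x = indicator A x - (indicator B x :: real)"
      using AB by (auto simp: indicator_def)
    then show ?thesis unfolding g_def
      using tendsto_diff[OF closed_ramp_tendsto[OF AB(1)] closed_ramp_tendsto[OF AB(2)]] by simp
  qed
  have "\<forall>m. \<exists>F a. finite F \<and> (\<forall>n. n \<notin> F \<longrightarrow> a n = 0) \<and> (\<forall>x. norm (trig_poly F a x - of_real (g m x)) < 1 / real (Suc m))"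
    by (intro allI trig_poly_approx g_cont) simp
  then obtain F a where Fa: "\<And>m. finite (F m)" "\<And>m n. n \<notin> F m \<Longrightarrow> a m n = 0"
    "\<And>m x. norm (trig_poly (F m) (a m) x - of_real (g m x)) < 1 / real (Suc m)"
    by metis
  define Q where "Q m x = trig_poly (F m) (a m) x" for m x
  have Q_bound: "norm (Q m x) \<le> 2" for m x
  proof -
    have "norm (Q m x) \<le> norm (Q m x - of_real (g m x)) + norm (complex_of_real (g m x))"
      by (metis diff_add_cancel norm_triangle_ineq)
    moreover have "1 / real (Suc m) \<le> 1" by simp
    ultimately show ?thesis using Fa(3)[of m x] g_bound[of m x] unfolding Q_def norm_of_real by linarith
  qed
  have Q_lim: "(\<lambda>m. Q m x) \<longlonglongrightarrow> indicator ?I x" for x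
  proof -
    have "(\<lambda>m. Q m x - of_real (g m x)) \<longlonglongrightarrow> 0"
      using Fa(3) by (intro tendsto_norm_zero_cancel[OF tendsto_sandwich[OF _ _ tendsto_const LIMSEQ_Suc[OF lim_1_over_n]]])
        (auto simp: Q_def intro!: always_eventually less_imp_le)
    moreover have "(\<lambda>m. complex_of_real (g m x)) \<longlonglongrightarrow> of_real (indicator ?I x)"
      by (intro tendsto_of_real g_lim)
    ultimately have "(\<lambda>m. (Q m x - of_real (g m x)) + of_real (g m x)) \<longlonglongrightarrow> 0 + of_real (indicator ?I x)"
      by (rule tendsto_add)
    then show ?thesis by (simp add: of_real_indicator)
  qed
  have [measurable]: "Q m \<in> borel_measurable borel" for m unfolding Q_def[abs_def] by measurable
  have "(\<lambda>m. \<integral>x. (norm (Q m x - indicator ?I x))\<^sup>2 \<partial>circle_haar) \<longlonglongrightarrow> (\<integral>x. 0 \<partial>circle_haar)"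
  proof (rule integral_dominated_convergence)
    show "AE x in circle_haar. (\<lambda>m. (norm (Q m x - indicator ?I x))\<^sup>2) \<longlonglongrightarrow> 0"
    proof (rule AE_I2)
      fix x
      have "(\<lambda>m. (norm (Q m x - indicator ?I x))\<^sup>2) \<longlonglongrightarrow> (norm (indicator ?I x - indicator ?I x :: complex))\<^sup>2"
        by (intro tendsto_intros Q_lim)
      then show "(\<lambda>m. (norm (Q m x - indicator ?I x))\<^sup>2) \<longlonglongrightarrow> 0" by simp
    qed
    show "AE x in circle_haar. norm ((norm (Q m x - indicator ?I x))\<^sup>2) \<le> 3\<^sup>2" for m
    proof (rule AE_I2)
      fix x
      have "norm (Q m x - indicator ?I x) \<le> norm (Q m x) + norm (indicator ?I x :: complex)"
        by (rule norm_triangle_ineq4)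
      also have "\<dots> \<le> 3" using Q_bound[of m x] by (simp add: indicator_def)
      finally have "(norm (Q m x - indicator ?I x))\<^sup>2 \<le> 3\<^sup>2" by (intro power_mono) auto
      then show "norm ((norm (Q m x - indicator ?I x))\<^sup>2) \<le> 3\<^sup>2" by simp
    qed
  qed measurable
  then have "(\<lambda>m. \<integral>x. (norm (Q m x - indicator ?I x))\<^sup>2 \<partial>circle_haar) \<longlonglongrightarrow> 0" by simp
  then have ev: "eventually (\<lambda>m. (\<integral>x. (norm (Q m x - indicator ?I x))\<^sup>2 \<partial>circle_haar) < \<delta> l) sequentially" for l
    using \<delta> by (rule order_tendstoD(2))
  \<comment> \<open>The condition \<open>l \<le> m\<close> makes the selected indices tend to
    infinity, which preserves the pointwise limit.\<close>
  have "\<forall>l. \<exists>m. l \<le> m \<and> (\<integral>x. (norm (Q m x - indicator ?I x))\<^sup>2 \<partial>circle_haar) < \<delta> l"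
    using eventually_happens[OF eventually_conj[OF eventually_ge_at_top ev]] by simp
  then obtain r where r: "\<And>l. r l \<ge> l" "\<And>l. (\<integral>x. (norm (Q (r l) x - indicator ?I x))\<^sup>2 \<partial>circle_haar) < \<delta> l"
    by metis
  have "filterlim r at_top sequentially"
    using r(1) by (intro filterlim_at_top_mono[OF filterlim_ident]) auto
  then have "(\<lambda>l. Q (r l) x) \<longlonglongrightarrow> indicator ?I x" for x
    by (rule filterlim_compose[OF Q_lim])
  note lim = this
  show ?thesis
  proof (rule that[of "\<lambda>l. F (r l)" "\<lambda>l. a (r l)"])
    show "finite (F (r l))" for l by (rule Fa)
    show "n \<notin> F (r l) \<Longrightarrow> a (r l) n = 0" for n l by (rule Fa)
    show "norm (trig_poly (F (r l)) (a (r l)) x) \<le> 2" for l x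
      using Q_bound unfolding Q_def .
    show "(\<lambda>l. trig_poly (F (r l)) (a (r l)) x) \<longlonglongrightarrow> indicator ?I x" for x
      using lim unfolding Q_def .
    show "(\<integral>x. (norm (trig_poly (F (r l)) (a (r l)) x - indicator ?I x))\<^sup>2 \<partial>circle_haar) \<le> \<delta> l" for l
      using less_imp_le[OF r(2)] unfolding Q_def .
  qed
qed

section \<open>Gaussian noise\<close>

locale complex_gaussian =
  fixes P :: "'w measure" and \<xi> :: "int \<Rightarrow> 'w \<Rightarrow> complex"
  assumes noise: "complex_gaussian_noise P \<xi>"
begin

sublocale prob_space P
  using noise by (simp add: complex_gaussian_noise_def)

lemma indep_noise: "indep_vars (\<lambda>_. borel) \<xi> UNIV"
  using noise by (simp add: complex_gaussian_noise_def)

lemma measurable_noise [measurable]: "\<xi> n \<in> borel_measurable P"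
  using indep_noise by (simp add: indep_vars_def)

lemma nn_integral_noise:
  assumes [measurable]: "h \<in> borel_measurable borel"
  shows "(\<integral>\<^sup>+\<omega>. h (\<xi> n \<omega>) \<partial>P) = (\<integral>\<^sup>+u. \<integral>\<^sup>+v. h (Complex u v) * ennreal (std_normal_density u * std_normal_density v) \<partial>lborel \<partial>lborel)"
proof -
  have C[measurable]: "(\<lambda>z. Complex (fst z) (snd z)) \<in> borel_measurable (lborel \<Otimes>\<^sub>M lborel)"
    unfolding Complex_eq by measurable
  have d: "distributed P (lborel \<Otimes>\<^sub>M lborel) (\<lambda>\<omega>. (Re (\<xi> n \<omega>), Im (\<xi> n \<omega>)))
      (\<lambda>(u, v). ennreal (std_normal_density u) * ennreal (std_normal_density v))"
  proof (rule distributed_joint_indep)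
    show "sigma_finite_measure (lborel :: real measure)" "sigma_finite_measure (lborel :: real measure)" by standard+
    show "distributed P lborel (\<lambda>\<omega>. Re (\<xi> n \<omega>)) (\<lambda>x. ennreal (std_normal_density x))"
      "distributed P lborel (\<lambda>\<omega>. Im (\<xi> n \<omega>)) (\<lambda>x. ennreal (std_normal_density x))"
      using noise by (simp_all add: complex_gaussian_noise_def)
    have "indep_var borel (\<lambda>\<omega>. Re (\<xi> n \<omega>)) borel (\<lambda>\<omega>. Im (\<xi> n \<omega>))"
      using noise by (simp add: complex_gaussian_noise_def)
    then show "indep_var lborel (\<lambda>\<omega>. Re (\<xi> n \<omega>)) lborel (\<lambda>\<omega>. Im (\<xi> n \<omega>))"
      unfolding indep_var_eq by simp
  qed
  have "(\<integral>\<^sup>+z. (case z of (u, v) \<Rightarrow> ennreal (std_normal_density u) * ennreal (std_normal_density v)) * h (Complex (fst z) (snd z)) \<partial>(lborel \<Otimes>\<^sub>M lborel))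
      = (\<integral>\<^sup>+\<omega>. h (Complex (fst (Re (\<xi> n \<omega>), Im (\<xi> n \<omega>))) (snd (Re (\<xi> n \<omega>), Im (\<xi> n \<omega>)))) \<partial>P)"
    by (rule distributed_nn_integral[OF d]) measurable
  also have "\<dots> = (\<integral>\<^sup>+\<omega>. h (\<xi> n \<omega>) \<partial>P)" by (simp add: complex_surj)
  finally have "(\<integral>\<^sup>+\<omega>. h (\<xi> n \<omega>) \<partial>P) = (\<integral>\<^sup>+z. (case z of (u, v) \<Rightarrow> ennreal (std_normal_density u) * ennreal (std_normal_density v)) * h (Complex (fst z) (snd z)) \<partial>(lborel \<Otimes>\<^sub>M lborel))"
    by simp
  also have "\<dots> = (\<integral>\<^sup>+u. \<integral>\<^sup>+v. (ennreal (std_normal_density u) * ennreal (std_normal_density v)) * h (Complex u v) \<partial>lborel \<partial>lborel)"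
    by (subst lborel.nn_integral_fst[symmetric]) auto
  finally show ?thesis by (simp add: ennreal_mult' mult_ac)
qed

lemma std_normal_density_shift:
  "std_normal_density (v - b) = std_normal_density v * exp (v * b - b\<^sup>2 / 2)"
  by (simp add: normal_density_def exp_add[symmetric] power2_eq_square field_simps)

text \<open>The Cameron-Martin formula at one frequency: translate the two real integrals and
  compare the normal densities. Exponential moments and likelihood ratios both come from it.\<close>

lemma nn_integral_noise_shift:
  assumes [measurable]: "h \<in> borel_measurable borel"
  shows "(\<integral>\<^sup>+\<omega>. h (x + \<xi> n \<omega>) \<partial>P)
    = (\<integral>\<^sup>+\<omega>. h (\<xi> n \<omega>) * ennreal (exp (Re (\<xi> n \<omega> * cnj x) - (norm x)\<^sup>2 / 2)) \<partial>P)"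
proof -
  let ?\<phi> = std_normal_density
  have C[measurable]: "(\<lambda>z. Complex (fst z) (snd z)) \<in> borel_measurable (lborel \<Otimes>\<^sub>M lborel)"
    "(\<lambda>u. Complex u v) \<in> borel_measurable borel" "(\<lambda>u. Complex v u) \<in> borel_measurable borel" for v
    unfolding Complex_eq by measurable
  define a b where "a = Re x" and "b = Im x"
  have x: "x = Complex a b" by (simp add: a_def b_def complex_surj)
  have transl: "(\<integral>\<^sup>+v. f (v + c) \<partial>lborel) = (\<integral>\<^sup>+v. f v \<partial>lborel)" if "f \<in> borel_measurable borel" for f :: "real \<Rightarrow> ennreal" and c
    using nn_integral_real_affine[OF that, of 1 c] by (simp add: add.commute)
  have "(\<integral>\<^sup>+\<omega>. h (x + \<xi> n \<omega>) \<partial>P) = (\<integral>\<^sup>+u. \<integral>\<^sup>+v. h (x + Complex u v) * ennreal (?\<phi> u * ?\<phi> v) \<partial>lborel \<partial>lborel)"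
    by (rule nn_integral_noise) measurable
  also have "\<dots> = (\<integral>\<^sup>+u. \<integral>\<^sup>+v. h (Complex (u + a) (v + b)) * ennreal (?\<phi> (u + a - a) * ?\<phi> (v + b - b)) \<partial>lborel \<partial>lborel)"
  proof -
    have "x + Complex u v = Complex (u + a) (v + b)" for u v
      by (simp add: x complex_eq_iff)
    then show ?thesis by simp
  qed
  also have "\<dots> = (\<integral>\<^sup>+u. \<integral>\<^sup>+v. h (Complex (u + a) v) * ennreal (?\<phi> (u + a - a) * ?\<phi> (v - b)) \<partial>lborel \<partial>lborel)"
    by (intro nn_integral_cong transl) measurable
  also have "\<dots> = (\<integral>\<^sup>+u. \<integral>\<^sup>+v. h (Complex u v) * ennreal (?\<phi> (u - a) * ?\<phi> (v - b)) \<partial>lborel \<partial>lborel)"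
    by (rule transl[of "\<lambda>u. \<integral>\<^sup>+v. h (Complex u v) * ennreal (?\<phi> (u - a) * ?\<phi> (v - b)) \<partial>lborel"]) measurable
  also have "\<dots> = (\<integral>\<^sup>+u. \<integral>\<^sup>+v. (h (Complex u v) * ennreal (exp (Re (Complex u v * cnj x) - (norm x)\<^sup>2 / 2))) * ennreal (?\<phi> u * ?\<phi> v) \<partial>lborel \<partial>lborel)"
  proof (intro nn_integral_cong)
    fix u v
    have "?\<phi> (u - a) * ?\<phi> (v - b) = exp (Re (Complex u v * cnj x) - (norm x)\<^sup>2 / 2) * (?\<phi> u * ?\<phi> v)"
      unfolding std_normal_density_shift by (simp add: x cmod_power2 exp_add[symmetric] exp_diff add_divide_distrib mult_ac)
    then show "h (Complex u v) * ennreal (?\<phi> (u - a) * ?\<phi> (v - b))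
      = (h (Complex u v) * ennreal (exp (Re (Complex u v * cnj x) - (norm x)\<^sup>2 / 2))) * ennreal (?\<phi> u * ?\<phi> v)"
      by (simp add: ennreal_mult' mult_ac)
  qed
  also have "\<dots> = (\<integral>\<^sup>+\<omega>. h (\<xi> n \<omega>) * ennreal (exp (Re (\<xi> n \<omega> * cnj x) - (norm x)\<^sup>2 / 2)) \<partial>P)"
    by (rule nn_integral_noise[symmetric]) measurable
  finally show ?thesis .
qed

lemma nn_integral_noise_prod:
  assumes "finite F" and [measurable]: "\<And>n. n \<in> F \<Longrightarrow> h n \<in> borel_measurable borel"
  shows "(\<integral>\<^sup>+\<omega>. (\<Prod>n\<in>F. h n (\<xi> n \<omega>)) \<partial>P) = (\<Prod>n\<in>F. \<integral>\<^sup>+\<omega>. h n (\<xi> n \<omega>) \<partial>P)"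
  using assms indep_vars_compose2[OF indep_vars_subset[OF indep_noise subset_UNIV], of F h "\<lambda>_. borel"]
  by (intro indep_vars_nn_integral) auto

text \<open>For one frequency this is the Cameron-Martin formula with \<open>h = 1\<close>: the
  density of the shifted law has total mass 1. Independence then multiplies the factors.\<close>

lemma noise_exp_moment:
  assumes "finite F"
  shows "(\<integral>\<^sup>+\<omega>. ennreal (exp (Re (\<Sum>n\<in>F. a n * \<xi> n \<omega>))) \<partial>P) = ennreal (exp ((\<Sum>n\<in>F. (norm (a n))\<^sup>2) / 2))"
proof -
  have single: "(\<integral>\<^sup>+\<omega>. ennreal (exp (Re (b * \<xi> n \<omega>))) \<partial>P) = ennreal (exp ((norm b)\<^sup>2 / 2))" for b n
  proof -
    have "1 = (\<integral>\<^sup>+\<omega>. ennreal (exp (Re (\<xi> n \<omega> * b) - (norm b)\<^sup>2 / 2)) \<partial>P)"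
      using nn_integral_noise_shift[of "\<lambda>_. 1" "cnj b" n] by (simp add: emeasure_space_1)
    also have "\<dots> = (\<integral>\<^sup>+\<omega>. ennreal (exp (- ((norm b)\<^sup>2 / 2))) * ennreal (exp (Re (b * \<xi> n \<omega>))) \<partial>P)"
      by (simp add: ennreal_mult'[symmetric] exp_add[symmetric] mult.commute)
    also have "\<dots> = ennreal (exp (- ((norm b)\<^sup>2 / 2))) * (\<integral>\<^sup>+\<omega>. ennreal (exp (Re (b * \<xi> n \<omega>))) \<partial>P)"
      by (rule nn_integral_cmult) measurable
    finally have "ennreal (exp ((norm b)\<^sup>2 / 2)) * 1
        = (ennreal (exp ((norm b)\<^sup>2 / 2)) * ennreal (exp (- ((norm b)\<^sup>2 / 2)))) * (\<integral>\<^sup>+\<omega>. ennreal (exp (Re (b * \<xi> n \<omega>))) \<partial>P)"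
      by (simp only: mult.assoc)
    then show ?thesis
      by (simp add: ennreal_mult'[symmetric] exp_add[symmetric])
  qed
  have "(\<integral>\<^sup>+\<omega>. ennreal (exp (Re (\<Sum>n\<in>F. a n * \<xi> n \<omega>))) \<partial>P) = (\<integral>\<^sup>+\<omega>. (\<Prod>n\<in>F. ennreal (exp (Re (a n * \<xi> n \<omega>)))) \<partial>P)"
    by (simp add: Re_sum exp_sum[OF assms] prod_ennreal del: times_complex.sel)
  also have "\<dots> = (\<Prod>n\<in>F. \<integral>\<^sup>+\<omega>. ennreal (exp (Re (a n * \<xi> n \<omega>))) \<partial>P)"
    by (rule nn_integral_noise_prod[OF assms]) measurable
  also have "\<dots> = ennreal (exp ((\<Sum>n\<in>F. (norm (a n))\<^sup>2) / 2))"
    by (simp add: single prod_ennreal exp_sum[OF assms, symmetric] sum_divide_distrib del: times_complex.sel)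
  finally show ?thesis .
qed

end

section \<open>Heavy arcs of low-dimensional measures\<close>

text \<open>The reduction modulo \<open>2 ^ k\<close> is there for points on opposite sides of the
  origin, where the coordinate jumps by almost a full turn; \<open>z\<close> in the proof is this
  turn.\<close>

lemma dyadic_index_near:
  assumes "dist y x \<le> 1 / 2 ^ k"
  shows "dyadic_index k y \<in> (\<lambda>e. nat ((int (dyadic_index k x) + e) mod 2 ^ k)) ` {-1, 0, 1}"
proof -
  define z where "z = round (circle_coord y - circle_coord x)"
  define a b where "a = 2 ^ k * circle_coord y" and "b = 2 ^ k * circle_coord x + of_int (z * 2 ^ k)"
  have "dist y x = dist (to_circle (circle_coord y)) (to_circle (circle_coord x))" by simp
  then have "dist y x = \<bar>circle_coord y - circle_coord x - of_int z\<bar>"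
    unfolding dist_circle.abs_eq dist_to_int_def z_def .
  then have "2 ^ k * \<bar>circle_coord y - circle_coord x - of_int z\<bar> \<le> 2 ^ k * (1 / 2 ^ k)"
    using assms by (intro mult_left_mono) simp_all
  then have "\<bar>2 ^ k * (circle_coord y - circle_coord x - of_int z)\<bar> \<le> 1"
    by (simp add: abs_mult)
  then have "\<bar>a - b\<bar> \<le> 1" by (simp add: a_def b_def algebra_simps)
  then have "\<lfloor>a\<rfloor> - \<lfloor>b\<rfloor> \<in> {-1, 0, 1}" by (simp, linarith)
  moreover have "\<lfloor>b\<rfloor> = \<lfloor>2 ^ k * circle_coord x\<rfloor> + z * 2 ^ k"
    unfolding b_def by (rule floor_add_int[symmetric])
  moreover define e where "e = \<lfloor>a\<rfloor> - \<lfloor>b\<rfloor>"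
  ultimately have e: "e \<in> {-1, 0, 1}" "\<lfloor>a\<rfloor> = \<lfloor>2 ^ k * circle_coord x\<rfloor> + z * 2 ^ k + e"
    by simp_all
  have nn: "int (dyadic_index k w) = \<lfloor>2 ^ k * circle_coord w\<rfloor>" for w
    unfolding dyadic_index_def using circle_coord_bounds(1)[of w] by simp
  have "int (dyadic_index k y) < int (2 ^ k)"
    using dyadic_index_less[of k y] by (simp only: of_nat_less_iff)
  then have "int (dyadic_index k y) = int (dyadic_index k y) mod 2 ^ k" by simp
  moreover have "int (dyadic_index k y) = int (dyadic_index k x) + e + z * 2 ^ k"
    using e(2) unfolding nn a_def by simp
  ultimately have "int (dyadic_index k y) = (int (dyadic_index k x) + e + z * 2 ^ k) mod 2 ^ k" by simp
  then have "dyadic_index k y = nat ((int (dyadic_index k x) + e) mod 2 ^ k)" by simp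
  then show ?thesis using e(1) by (rule image_eqI)
qed

text \<open>The \<open>\<epsilon>\<close> term only matters when \<open>d = 0\<close>.\<close>

lemma dyadic_scale:
  fixes d s \<epsilon> :: real
  assumes "0 \<le> d" "d \<le> 1 / 2 ^ m" "s > 0" "\<epsilon> > 0"
  obtains k where "k \<ge> m" "d \<le> 1 / 2 ^ k" "(1 / 2 ^ k) powr s \<le> 2 powr s * d powr s + \<epsilon>"
proof (cases "d = 0")
  case True
  have "((\<lambda>k. (1 / 2 ^ k :: real) powr s) \<longlongrightarrow> 0) sequentially"
  proof (rule tendsto_zero_powrI)
    show "(\<lambda>k. 1 / 2 ^ k :: real) \<longlonglongrightarrow> 0"
      using LIMSEQ_inverse_realpow_zero[of 2] by (simp add: inverse_eq_divide)
  qed (use assms(3) in auto)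
  then have "eventually (\<lambda>k. (1 / 2 ^ k :: real) powr s < \<epsilon>) sequentially"
    using assms(4) by (rule order_tendstoD(2))
  from eventually_happens[OF eventually_conj[OF eventually_ge_at_top[of m] this]]
  obtain k where "k \<ge> m" "(1 / 2 ^ k :: real) powr s < \<epsilon>" by auto
  then show ?thesis using that[of k] True by simp
next
  case False
  then have d: "d > 0" using assms(1) by simp
  obtain K where "1 / 2 ^ K < d"
    using reals_power_lt_ex[of d 2] d by (auto simp: power_one_over inverse_eq_divide)
  then have ex: "\<exists>k. 1 / 2 ^ Suc k < d"
    using d by (intro exI[of _ K]) (simp add: field_simps)
  \<comment> \<open>The first \<open>k\<close> at which half the mesh drops below \<open>d\<close>:
    then the mesh itself is at least \<open>d\<close> and less than \<open>2 * d\<close>, which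
    explains the factor \<open>2 powr s\<close>.\<close>
  define k where "k = (LEAST k. 1 / 2 ^ Suc k < d)"
  have k1: "1 / 2 ^ Suc k < d" unfolding k_def by (rule LeastI_ex[OF ex])
  have "m \<le> k"
  proof (rule ccontr)
    assume "\<not> m \<le> k"
    then have "(2::real) ^ Suc k \<le> 2 ^ m" by (intro power_increasing) auto
    then have "1 / 2 ^ m \<le> 1 / (2::real) ^ Suc k" by (intro divide_left_mono) auto
    then show False using k1 assms(2) by linarith
  qed
  moreover have "d \<le> 1 / 2 ^ k"
  proof (cases "k = m")
    case True then show ?thesis using assms(2) by simp
  next
    case False
    with \<open>m \<le> k\<close> obtain k' where k': "k = Suc k'" by (cases k) auto
    then have "\<not> 1 / 2 ^ Suc k' < d" using not_less_Least[of k' "\<lambda>k. 1 / 2 ^ Suc k < d"] unfolding k_def[symmetric] by simp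
    then show ?thesis using k' by simp
  qed
  moreover have "(1 / 2 ^ k) powr s \<le> (2 * d) powr s"
    using k1 assms(3) by (intro powr_mono2) (auto simp: field_simps)
  then have "(1 / 2 ^ k) powr s \<le> 2 powr s * d powr s + \<epsilon>"
    using d assms(4) by (simp add: powr_mult)
  ultimately show ?thesis by (rule that)
qed

text \<open>A set of diameter at most \<open>1 / 2 ^ k\<close> lies in the arc of any of its points
  and the two neighbours of that arc, so a Hausdorff cover becomes a dyadic one with three arcs per
  set and gauges enlarged by a constant.\<close>

lemma hausdorff_dim_dyadic_cover:
  fixes E :: "circle set"
  assumes dim: "hausdorff_dim E \<le> ennreal \<alpha>" and \<alpha>: "0 \<le> \<alpha>" "\<alpha> < s" and \<epsilon>: "\<epsilon> > 0"
  obtains \<kappa> J where "\<And>i :: nat. \<kappa> i \<ge> m" "\<And>i. finite (J i)" "\<And>i. card (J i) \<le> 3"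
    "E \<subseteq> (\<Union>i. \<Union>j\<in>J i. dyadic_arc (\<kappa> i) j)" "(\<Sum>i. ennreal ((1 / 2 ^ \<kappa> i) powr s)) \<le> ennreal \<epsilon>"
proof -
  have s: "s > 0" using \<alpha> by simp
  have "ennreal \<alpha> < ennreal s" using \<alpha> s by (intro ennreal_lessI)
  with dim have "hausdorff_dim E < ennreal s" by (rule le_less_trans)
  then obtain t where "t \<in> {s. 0 \<le> s \<and> hausdorff_outer_measure s E = 0}" "ennreal t < ennreal s"
    unfolding hausdorff_dim_def INF_less_iff by (elim bexE)
  then have t: "0 \<le> t" "hausdorff_outer_measure t E = 0" "ennreal t < ennreal s" by simp_all
  have ts: "t < s" using t(3) by (meson ennreal_leI not_le)
  \<comment> \<open>The share \<open>2 powr s * \<epsilon>'\<close> pays for rounding diameters up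
    to dyadic lengths, and one more \<open>\<epsilon>'\<close> for the additive errors
    \<open>e i\<close> of \<open>dyadic_scale\<close>, which sum to it.\<close>
  define \<epsilon>' where "\<epsilon>' = \<epsilon> / (2 powr s + 1)"
  have \<epsilon>': "\<epsilon>' > 0" unfolding \<epsilon>'_def using \<epsilon> by (intro divide_pos_pos) (auto simp: add_pos_pos)
  have "hausdorff_premeasure t (1 / 2 ^ m) E \<le> hausdorff_outer_measure t E"
    unfolding hausdorff_outer_measure_def by (rule SUP_upper) simp
  then have "hausdorff_premeasure t (1 / 2 ^ m) E < ennreal \<epsilon>'"
    using t(2) \<epsilon>' by simp
  then obtain U where "U \<in> {U :: nat \<Rightarrow> circle set. E \<subseteq> (\<Union>i. U i) \<and> (\<forall>i. bounded (U i) \<and> diameter (U i) \<le> 1 / 2 ^ m)}"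
    and U4: "(\<Sum>i. hausdorff_gauge t (U i)) < ennreal \<epsilon>'"
    unfolding hausdorff_premeasure_def INF_less_iff by (elim bexE)
  then have U: "E \<subseteq> (\<Union>i. U i)" "\<And>i. bounded (U i)" "\<And>i. diameter (U i) \<le> 1 / 2 ^ m"
    "(\<Sum>i. hausdorff_gauge t (U i)) < ennreal \<epsilon>'" by simp_all
  have d0: "0 \<le> diameter (U i)" for i using U(2) by (rule diameter_ge_0)
  define e where "e i = \<epsilon>' * (1 / 2) ^ Suc i" for i :: nat
  have "\<forall>i. \<exists>k. k \<ge> m \<and> diameter (U i) \<le> 1 / 2 ^ k \<and> (1 / 2 ^ k) powr s \<le> 2 powr s * diameter (U i) powr s + e i"
  proof
    fix i
    have "e i > 0" using \<epsilon>' by (simp add: e_def)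
    from dyadic_scale[OF d0 U(3) s this, of i]
    show "\<exists>k. k \<ge> m \<and> diameter (U i) \<le> 1 / 2 ^ k \<and> (1 / 2 ^ k) powr s \<le> 2 powr s * diameter (U i) powr s + e i"
      by blast
  qed
  from choice[OF this] obtain \<kappa> where \<kappa>': "\<forall>i. \<kappa> i \<ge> m \<and> diameter (U i) \<le> 1 / 2 ^ \<kappa> i \<and>
      (1 / 2 ^ \<kappa> i) powr s \<le> 2 powr s * diameter (U i) powr s + e i" by (rule exE)
  note \<kappa> = \<kappa>'[rule_format, THEN conjunct1] \<kappa>'[rule_format, THEN conjunct2, THEN conjunct1]
    \<kappa>'[rule_format, THEN conjunct2, THEN conjunct2]
  define J where "J i = (if U i = {} then {} else
    (\<lambda>e. nat ((int (dyadic_index (\<kappa> i) (SOME x. x \<in> U i)) + e) mod 2 ^ \<kappa> i)) ` {-1, 0, 1::int})" for i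
  have Jfin: "finite (J i)" for i
  proof (cases "U i = {}")
    case False
    show ?thesis unfolding J_def if_not_P[OF False] by (intro finite_imageI) simp
  qed (simp add: J_def)
  have Jcard: "card (J i) \<le> 3" for i
  proof (cases "U i = {}")
    case False
    have "card (J i) \<le> card {-1, 0, 1::int}"
      unfolding J_def if_not_P[OF False] by (rule card_image_le) simp
    then show ?thesis by simp
  qed (simp add: J_def)
  have Ucov: "U i \<subseteq> (\<Union>j\<in>J i. dyadic_arc (\<kappa> i) j)" for i
  proof
    fix y assume y: "y \<in> U i"
    then have x: "(SOME x. x \<in> U i) \<in> U i" by (rule someI)
    have "dist y (SOME x. x \<in> U i) \<le> 1 / 2 ^ \<kappa> i"
      using diameter_bounded_bound[OF U(2) y x] \<kappa>(2)[of i] by linarith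
    note near = dyadic_index_near[OF this]
    have "dyadic_index (\<kappa> i) y \<in> J i"
    proof -
      have "U i \<noteq> {}" using y by blast
      then show ?thesis using near unfolding J_def by (simp only: if_False)
    qed
    then show "y \<in> (\<Union>j\<in>J i. dyadic_arc (\<kappa> i) j)" by (auto simp: dyadic_arc_def)
  qed
  have gauge: "ennreal ((1 / 2 ^ \<kappa> i) powr s) \<le> ennreal (2 powr s) * hausdorff_gauge t (U i) + ennreal (e i)" for i
  proof -
    have "diameter (U i) \<le> 1" using U(3)[of i] by (rule order_trans) simp
    \<comment> \<open>The cover is economical for some \<open>t < s\<close>; since diameters are at
      most 1, the larger exponent \<open>s\<close> gives smaller values. At \<open>t = 0\<close> the
      gauge of a nonempty set is 1.\<close>
    have "ennreal (diameter (U i) powr s) \<le> hausdorff_gauge t (U i)"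
    proof (cases "U i = {}")
      case True
      then show ?thesis by (simp add: diameter_def)
    next
      case ne: False
      show ?thesis
      proof (cases "t = 0")
        case True
        have "diameter (U i) powr s \<le> 1" using d0[of i] \<open>diameter (U i) \<le> 1\<close> s by (intro powr_le1) auto
        then have "ennreal (diameter (U i) powr s) \<le> ennreal 1" by (rule ennreal_leI)
        then show ?thesis using True ne by (simp add: hausdorff_gauge_def)
      next
        case False
        have "diameter (U i) powr s \<le> diameter (U i) powr t"
          using d0[of i] \<open>diameter (U i) \<le> 1\<close> ts by (intro powr_mono') auto
        then show ?thesis using False ne by (simp add: hausdorff_gauge_def ennreal_leI)
      qed
    qed
    then have le: "ennreal (2 powr s) * ennreal (diameter (U i) powr s) + ennreal (e i) \<le> ennreal (2 powr s) * hausdorff_gauge t (U i) + ennreal (e i)"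
      by (intro add_right_mono mult_left_mono) auto
    have "ennreal ((1 / 2 ^ \<kappa> i) powr s) \<le> ennreal (2 powr s * diameter (U i) powr s + e i)"
      using \<kappa>(3) by (rule ennreal_leI)
    also have "\<dots> = ennreal (2 powr s) * ennreal (diameter (U i) powr s) + ennreal (e i)"
      using \<epsilon>' by (simp add: e_def ennreal_mult')
    also note le
    finally show ?thesis .
  qed
  have "(\<Sum>i. ennreal ((1 / 2 ^ \<kappa> i) powr s)) \<le> (\<Sum>i. ennreal (2 powr s) * hausdorff_gauge t (U i) + ennreal (e i))"
    by (intro suminf_le gauge) auto
  also have "\<dots> = ennreal (2 powr s) * (\<Sum>i. hausdorff_gauge t (U i)) + (\<Sum>i. ennreal (e i))"
    by (simp add: suminf_add[symmetric])
  also have "(\<Sum>i. ennreal (e i)) = ennreal \<epsilon>'"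
  proof -
    have "e sums (\<epsilon>' * 1)" unfolding e_def by (rule sums_mult[OF power_half_series])
    then have es: "e sums \<epsilon>'" by simp
    have "0 \<le> e i" for i using \<epsilon>' by (simp add: e_def)
    from suminf_ennreal2[OF this sums_summable[OF es]] show ?thesis
      unfolding sums_unique[OF es, symmetric] .
  qed
  also have "ennreal (2 powr s) * (\<Sum>i. hausdorff_gauge t (U i)) + ennreal \<epsilon>' \<le> ennreal (2 powr s) * ennreal \<epsilon>' + ennreal \<epsilon>'"
    using U(4) by (intro add_right_mono mult_left_mono) auto
  also have "\<dots> = ennreal (2 powr s * \<epsilon>' + \<epsilon>')" using \<epsilon>' by (simp add: ennreal_mult' ennreal_plus)
  also have "2 powr s * \<epsilon>' + \<epsilon>' = \<epsilon>"
  proof -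
    have "2 powr s + 1 \<noteq> 0" using powr_gt_zero[of 2 s] by linarith
    moreover have "2 powr s * \<epsilon>' + \<epsilon>' = (2 powr s + 1) * \<epsilon>'" by (simp add: distrib_right)
    ultimately show ?thesis
      unfolding \<epsilon>'_def by (simp only: times_divide_eq_right nonzero_mult_div_cancel_left not_False_eq_True)
  qed
  finally have sum: "(\<Sum>i. ennreal ((1 / 2 ^ \<kappa> i) powr s)) \<le> ennreal \<epsilon>" .
  have cov: "E \<subseteq> (\<Union>i. \<Union>j\<in>J i. dyadic_arc (\<kappa> i) j)"
    by (rule order_trans[OF U(1) UN_mono[OF order_refl Ucov]])
  show ?thesis by (rule that[of \<kappa> J, OF \<kappa>(1) Jfin Jcard cov sum])
qed

text \<open>Of nested selected arcs only the largest counts; \<open>j div 2 ^ (k - i)\<close> is the index of the arc of level \<open>i\<close>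
  that contains the arc \<open>j\<close> of level \<open>k\<close>.\<close>

definition first_selected :: "(nat \<Rightarrow> nat \<Rightarrow> bool) \<Rightarrow> nat \<Rightarrow> nat \<Rightarrow> bool"
  where "first_selected S k j \<longleftrightarrow> S k j \<and> (\<forall>i<k. \<not> S i (j div 2 ^ (k - i)))"

lemma first_selected_index:
  "first_selected S k (dyadic_index k x) \<longleftrightarrow> S k (dyadic_index k x) \<and> (\<forall>i<k. \<not> S i (dyadic_index i x))"
proof -
  have "dyadic_index k x div 2 ^ (k - i) = dyadic_index i x" if "i < k" for i
    using dyadic_index_div[of i x "k - i"] that by simp
  then show ?thesis unfolding first_selected_def by auto
qed

definition first_level :: "(nat \<Rightarrow> nat \<Rightarrow> bool) \<Rightarrow> nat \<Rightarrow> circle set"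
  where "first_level S k = {x. first_selected S k (dyadic_index k x)}"

lemma first_level_sets [measurable, simp]: "first_level S k \<in> sets borel"
  unfolding first_level_def by measurable

lemma disjoint_first_level: "disjoint_family (first_level S)"
proof -
  have "first_level S i \<inter> first_level S k = {}" if "i < k" for i k
    using that by (auto simp: first_level_def first_selected_index)
  then show ?thesis unfolding disjoint_family_on_def by (metis Int_commute linorder_neqE_nat)
qed

lemma UN_first_level: "(\<Union>k. first_level S k) = {x. \<exists>k. S k (dyadic_index k x)}"
proof (intro set_eqI iffI)
  fix x assume "x \<in> {x. \<exists>k. S k (dyadic_index k x)}"
  then have ex: "\<exists>k. S k (dyadic_index k x)" by simp
  have "x \<in> first_level S (LEAST k. S k (dyadic_index k x))"
    unfolding first_level_def first_selected_index using LeastI_ex[OF ex] not_less_Least by auto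
  then show "x \<in> (\<Union>k. first_level S k)" by blast
qed (auto simp: first_level_def first_selected_def)

lemma first_level_eq: "first_level S k = (\<Union>j\<in>{j. j < 2 ^ k \<and> first_selected S k j}. dyadic_arc k j)"
  using dyadic_index_less by (auto simp: first_level_def dyadic_arc_def)

lemma complex_measure_finite_UN:
  assumes \<mu>: "complex_measure M \<mu>" and "finite I" "\<And>i. i \<in> I \<Longrightarrow> A i \<in> sets M" "disjoint_family_on A I"
  shows "\<mu> (\<Union>i\<in>I. A i) = (\<Sum>i\<in>I. \<mu> (A i))"
proof -
  interpret finite_measure "dominating_measure M \<mu>" by (rule finite_dominating_measure[OF \<mu>])
  have int: "integrable (dominating_measure M \<mu>) (indicator B :: _ \<Rightarrow> complex)" if "B \<in> sets M" for B
    using that by (intro integrable_const_bound[of _ 1]) (auto simp: indicator_def)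
  have "indicator (\<Union>i\<in>I. A i) x = (\<Sum>i\<in>I. indicator (A i) x :: complex)" for x
    by (rule indicator_UN_disjoint[OF assms(2,4)])
  then have "cmeasure_integral M \<mu> (indicator (\<Union>i\<in>I. A i)) = cmeasure_integral M \<mu> (\<lambda>x. \<Sum>i\<in>I. indicator (A i) x)"
    by presburger
  also have "\<dots> = (\<Sum>i\<in>I. cmeasure_integral M \<mu> (indicator (A i)))"
    using assms by (intro cmeasure_integral_sum int) auto
  finally show ?thesis
    using assms by (simp add: cmeasure_integral_indicator[OF \<mu>] sets.finite_UN)
qed

lemma disjoint_dyadic_arc: "disjoint_family_on (dyadic_arc k) I"
  by (auto simp: disjoint_family_on_def dyadic_arc_def)

lemma complex_measure_first_level:
  assumes "complex_measure borel \<mu>"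
  shows "\<mu> (first_level S k) = (\<Sum>j | j < 2 ^ k \<and> first_selected S k j. \<mu> (dyadic_arc k j))"
  unfolding first_level_eq by (rule complex_measure_finite_UN[OF assms]) (auto intro: disjoint_dyadic_arc)

text \<open>The union of the selected arcs is the disjoint union of the maximal ones, so the values
  of \<open>\<mu>\<close> on these add up. The factor 6 is 3 arcs per cover index times the 2 in the
  hypothesis \<open>small\<close>.\<close>

lemma norm_measure_cover_le:
  assumes \<mu>: "complex_measure borel \<mu>"
    and fin: "\<And>i :: nat. finite (J i)" and card: "\<And>i. card (J i) \<le> 3"
    and S: "\<And>k j. S k j \<Longrightarrow> \<exists>i. \<kappa> i = k \<and> j \<in> J i"
    and small: "\<And>k j. S k j \<Longrightarrow> norm (\<mu> (dyadic_arc k j)) \<le> 2 * (1 / 2 ^ k) powr s"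
    and sum: "(\<Sum>i. ennreal ((1 / 2 ^ \<kappa> i) powr s)) \<le> ennreal \<epsilon>" and \<epsilon>: "0 \<le> \<epsilon>"
  shows "norm (\<mu> {x. \<exists>k. S k (dyadic_index k x)}) \<le> 6 * \<epsilon>"
proof -
  define w where "w k = (1 / 2 ^ k :: real) powr s" for k :: nat
  have w0: "0 \<le> w k" for k by (simp add: w_def)
  have level: "ennreal (norm (\<mu> (first_level S k))) \<le> (\<Sum>i. if \<kappa> i = k then 6 * ennreal (w k) else 0)" for k
  proof -
    let ?D = "{j. j < 2 ^ k \<and> first_selected S k j}"
    have finD: "finite ?D" by simp
    have "norm (\<mu> (first_level S k)) \<le> (\<Sum>j\<in>?D. norm (\<mu> (dyadic_arc k j)))"
      unfolding complex_measure_first_level[OF \<mu>] by (rule norm_sum)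
    also have "\<dots> \<le> (\<Sum>j\<in>?D. 2 * w k)"
      unfolding w_def by (intro sum_mono small) (auto simp: first_selected_def)
    finally have "ennreal (norm (\<mu> (first_level S k))) \<le> ennreal (\<Sum>j\<in>?D. 2 * w k)" by (rule ennreal_leI)
    also have "\<dots> = (\<Sum>j\<in>?D. 2 * ennreal (w k))" by (simp add: sum_ennreal[symmetric] w0 ennreal_mult' ennreal_of_nat_eq_real_of_nat)
    \<comment> \<open>Every selected arc is charged to all cover indices that produce it, of which
      there is at least one.\<close>
    also have "\<dots> \<le> (\<Sum>j\<in>?D. \<Sum>i. if \<kappa> i = k \<and> j \<in> J i then 2 * ennreal (w k) else 0)"
    proof (rule sum_mono)
      fix j assume "j \<in> ?D"
      then have "S k j" by (simp add: first_selected_def)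
      then obtain i where i: "\<kappa> i = k" "j \<in> J i" using S by blast
      have "(\<Sum>i\<in>{i}. if \<kappa> i = k \<and> j \<in> J i then 2 * ennreal (w k) else 0) \<le> (\<Sum>i. if \<kappa> i = k \<and> j \<in> J i then 2 * ennreal (w k) else 0)"
        by (rule sum_le_suminf) auto
      then show "2 * ennreal (w k) \<le> (\<Sum>i. if \<kappa> i = k \<and> j \<in> J i then 2 * ennreal (w k) else 0)"
        using i by simp
    qed
    also have "\<dots> = (\<Sum>i. \<Sum>j\<in>?D. if \<kappa> i = k \<and> j \<in> J i then 2 * ennreal (w k) else 0)"
      by (rule suminf_sum[symmetric]) simp
    also have "\<dots> \<le> (\<Sum>i. if \<kappa> i = k then 6 * ennreal (w k) else 0)"
    proof (rule suminf_le)
      fix i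
      show "(\<Sum>j\<in>?D. if \<kappa> i = k \<and> j \<in> J i then 2 * ennreal (w k) else 0) \<le> (if \<kappa> i = k then 6 * ennreal (w k) else 0)"
      proof (cases "\<kappa> i = k")
        case True
        have "(\<Sum>j\<in>?D. if \<kappa> i = k \<and> j \<in> J i then 2 * ennreal (w k) else 0) = (\<Sum>j\<in>?D \<inter> J i. 2 * ennreal (w k))"
          using True by (simp add: sum.inter_restrict[OF finD, symmetric])
        also have "\<dots> = of_nat (card (?D \<inter> J i)) * (2 * ennreal (w k))" by simp
        also have "\<dots> \<le> of_nat 3 * (2 * ennreal (w k))"
          using card_mono[OF fin[of i], of "?D \<inter> J i"] card[of i]
          by (intro mult_right_mono of_nat_mono) auto
        finally show ?thesis using True by (simp add: mult.assoc[symmetric])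
      qed simp
    qed auto
    finally show ?thesis .
  qed
  have sums: "(\<lambda>k. \<mu> (first_level S k)) sums \<mu> {x. \<exists>k. S k (dyadic_index k x)}"
    unfolding UN_first_level[symmetric]
    by (rule \<mu>[unfolded complex_measure_def, rule_format]) (auto intro: disjoint_first_level)
  have "(\<Sum>k. ennreal (norm (\<mu> (first_level S k)))) \<le> (\<Sum>k. \<Sum>i. if \<kappa> i = k then 6 * ennreal (w k) else 0)"
    by (intro suminf_le level) auto
  \<comment> \<open>Several cover indices may have the same level, so the double sum is exchanged
    rather than reindexed.\<close>
  also have "\<dots> = (\<Sum>i. \<Sum>k. if \<kappa> i = k then 6 * ennreal (w k) else 0)"
    unfolding nn_integral_count_space_nat[symmetric]
    by (intro pair_sigma_finite.Fubini' pair_sigma_finite.intro sigma_finite_measure_count_space)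
      (auto simp: pair_measure_countable)
  also have "\<dots> = (\<Sum>i. 6 * ennreal (w (\<kappa> i)))"
  proof (rule suminf_cong)
    fix i
    have "(\<Sum>k. if \<kappa> i = k then 6 * ennreal (w k) else 0) = (\<Sum>k\<in>{\<kappa> i}. if \<kappa> i = k then 6 * ennreal (w k) else 0)"
      by (rule suminf_finite) auto
    then show "(\<Sum>k. if \<kappa> i = k then 6 * ennreal (w k) else 0) = 6 * ennreal (w (\<kappa> i))" by simp
  qed
  also have "\<dots> = 6 * (\<Sum>i. ennreal (w (\<kappa> i)))" by simp
  also have "\<dots> \<le> 6 * ennreal \<epsilon>" using sum unfolding w_def by (rule mult_left_mono) simp
  also have "\<dots> = ennreal (6 * \<epsilon>)" using \<epsilon> by (simp add: ennreal_mult')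
  finally have tot: "(\<Sum>k. ennreal (norm (\<mu> (first_level S k)))) \<le> ennreal (6 * \<epsilon>)" .
  have "norm (\<Sum>k<n. \<mu> (first_level S k)) \<le> 6 * \<epsilon>" for n
  proof -
    have "ennreal (\<Sum>k<n. norm (\<mu> (first_level S k))) = (\<Sum>k<n. ennreal (norm (\<mu> (first_level S k))))"
      by (simp add: sum_ennreal)
    also have "\<dots> \<le> (\<Sum>k. ennreal (norm (\<mu> (first_level S k))))" by (rule sum_le_suminf) auto
    also note tot
    finally have "(\<Sum>k<n. norm (\<mu> (first_level S k))) \<le> 6 * \<epsilon>" using \<epsilon> by simp
    then show ?thesis using norm_sum[of "\<lambda>k. \<mu> (first_level S k)" "{..<n}"] by linarith
  qed
  moreover have "(\<lambda>n. norm (\<Sum>k<n. \<mu> (first_level S k))) \<longlonglongrightarrow> norm (\<mu> {x. \<exists>k. S k (dyadic_index k x)})"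
    using sums unfolding sums_def by (rule tendsto_norm)
  ultimately show ?thesis by (intro LIMSEQ_le_const2) auto
qed


lemma dyadic_index_coord_near:
  assumes "dyadic_index k x = dyadic_index k y"
  shows "\<bar>circle_coord x - circle_coord y\<bar> < 1 / 2 ^ k"
  using dyadic_index_eq_iff[of k x "dyadic_index k y"] dyadic_index_eq_iff[of k y "dyadic_index k y"] assms
  by (simp add: add_divide_distrib) linarith

text \<open>Arcs are intervals of the coordinate and never cross its jump. This is why open sets of
  the line serve here, although their preimages under \<open>circle_coord\<close> need not be open
  in the circle.\<close>

lemma open_coord_eq_UN_dyadic:
  assumes "open U" "circle_coord x \<in> U"
  shows "\<exists>m. \<forall>y. dyadic_index m y = dyadic_index m x \<longrightarrow> circle_coord y \<in> U"
proof -
  obtain e where e: "e > 0" "\<And>t. dist t (circle_coord x) < e \<Longrightarrow> t \<in> U"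
    using assms unfolding open_dist by blast
  obtain m where m: "(1 / 2 :: real) ^ m < e"
    using e(1) real_arch_pow_inv[of e "1/2"] by auto
  have "circle_coord y \<in> U" if "dyadic_index m y = dyadic_index m x" for y
    using dyadic_index_coord_near[OF that] m by (intro e(2)) (simp add: dist_real_def power_one_over)
  then show ?thesis by blast
qed

text \<open>An economical cover by light arcs has union \<open>C\<close> with \<open>\<mu> C\<close>
  small. This bounds \<open>\<mu> A\<close> only if \<open>C\<close> is close to \<open>A\<close> in
  \<open>\<rho>\<close>, because cancellation may hide large variation in the part of
  \<open>C\<close> outside \<open>A\<close>. So the cover is taken so fine that its arcs stay in a
  neighbourhood \<open>V\<close> of \<open>A\<close> with \<open>V - A\<close> of small
  \<open>\<rho>\<close>-measure.\<close>

lemma small_arcs_null: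
  assumes \<mu>: "complex_measure borel \<mu>"
    and dim: "hausdorff_dim E \<le> ennreal \<alpha>" and \<alpha>: "0 \<le> \<alpha>" "\<alpha> < s"
    and A: "A \<in> sets borel" "A \<subseteq> E"
    and small: "\<And>x k. x \<in> A \<Longrightarrow> k \<ge> n \<Longrightarrow> norm (\<mu> (dyadic_arc k (dyadic_index k x))) \<le> 2 * (1 / 2 ^ k) powr s"
  shows "\<mu> A = 0"
proof (rule ccontr)
  let ?\<rho> = "dominating_measure borel \<mu>"
  interpret \<rho>: finite_measure ?\<rho> by (rule finite_dominating_measure[OF \<mu>])
  assume "\<mu> A \<noteq> 0"
  \<comment> \<open>The errors below add up to \<open>9 * \<epsilon>\<close>: 6 from the cover, 2
    from \<open>C - A \<inter> W m\<close>, 1 from \<open>A - W m\<close>.\<close>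
  define \<epsilon> where "\<epsilon> = norm (\<mu> A) / 10"
  have \<epsilon>: "\<epsilon> > 0" using \<open>\<mu> A \<noteq> 0\<close> by (simp add: \<epsilon>_def)
  \<comment> \<open>Outer regularity is applied to the image of \<open>\<rho>\<close> on the line;
    \<open>A'\<close> is the coordinate image of \<open>A\<close>.\<close>
  let ?R = "distr ?\<rho> borel circle_coord"
  interpret R: finite_measure ?R by (rule \<rho>.finite_measure_distr) simp
  define A' where "A' = {t. 0 \<le> t \<and> t < 1 \<and> to_circle t \<in> A}"
  have A'_sets: "A' \<in> sets borel" unfolding A'_def using A(1) by measurable
  have preA: "circle_coord -` A' = A" using circle_coord_bounds by (auto simp: A'_def)
  have "(INF U\<in>{U. A' \<subseteq> U \<and> open U}. emeasure ?R U) < emeasure ?R A' + ennreal \<epsilon>"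
    using outer_regular[of ?R A'] A'_sets \<epsilon> R.emeasure_finite[of "space ?R"] R.emeasure_finite[of A']
    by (simp add: ennreal_lessI R.emeasure_eq_measure ennreal_plus[symmetric] del: ennreal_plus)
  then obtain U where U: "A' \<subseteq> U" "open U" "emeasure ?R U < emeasure ?R A' + ennreal \<epsilon>"
    by (auto simp: INF_less_iff)
  define V where "V = circle_coord -` U"
  have V_sets[measurable]: "V \<in> sets borel"
    using measurable_sets[OF measurable_circle_coord, of U] U(2) by (simp add: V_def)
  have AV: "A \<subseteq> V" using U(1) preA by (auto simp: V_def)
  have "measure ?\<rho> V < measure ?\<rho> A + \<epsilon>"
  proof -
    have "emeasure ?\<rho> V < emeasure ?\<rho> A + ennreal \<epsilon>"
      using U(3) A'_sets U(2) preA by (simp add: emeasure_distr V_def)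
    then show ?thesis using \<epsilon>
      by (simp add: \<rho>.emeasure_eq_measure ennreal_plus[symmetric] ennreal_less_iff del: ennreal_plus)
  qed
  then have VA: "measure ?\<rho> (V - A) < \<epsilon>"
    using A(1) AV by (subst \<rho>.finite_measure_Diff) auto
  \<comment> \<open>The points whose whole arc of level \<open>m\<close> lies in \<open>V\<close>;
    these sets increase and exhaust \<open>A\<close>, so for large \<open>m\<close> the loss
    \<open>A - W m\<close> is negligible.\<close>
  define W where "W m = {x. \<forall>y. dyadic_index m y = dyadic_index m x \<longrightarrow> circle_coord y \<in> U}" for m
  have W_sets[measurable]: "W m \<in> sets borel" for m
  proof -
    have "W m = dyadic_index m -` {j. \<forall>y. dyadic_index m y = j \<longrightarrow> circle_coord y \<in> U} \<inter> space borel"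
      by (auto simp: W_def)
    also have "\<dots> \<in> sets borel" by (rule measurable_sets[OF measurable_dyadic_index]) simp
    finally show ?thesis .
  qed
  have W_mono: "W i \<subseteq> W j" if "i \<le> j" for i j
  proof
    fix x assume x: "x \<in> W i"
    show "x \<in> W j"
      unfolding W_def
    proof (intro CollectI allI impI)
      fix y assume "dyadic_index j y = dyadic_index j x"
      then have "dyadic_index i y = dyadic_index i x"
        using dyadic_index_div[of i _ "j - i"] that by simp
      then show "circle_coord y \<in> U" using x by (simp add: W_def)
    qed
  qed
  have "(\<Union>m. A \<inter> W m) = A"
  proof (intro equalityI subsetI)
    fix x assume x: "x \<in> A"
    then have "circle_coord x \<in> U" using AV by (auto simp: V_def)
    from open_coord_eq_UN_dyadic[OF U(2) this] obtain m where "x \<in> W m" unfolding W_def by blast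
    with x show "x \<in> (\<Union>m. A \<inter> W m)" by blast
  qed blast
  moreover have "(\<lambda>m. measure ?\<rho> (A \<inter> W m)) \<longlonglongrightarrow> measure ?\<rho> (\<Union>m. A \<inter> W m)"
    using A(1) W_mono by (intro \<rho>.finite_Lim_measure_incseq) (auto simp: incseq_def)
  ultimately have "(\<lambda>m. measure ?\<rho> (A \<inter> W m)) \<longlonglongrightarrow> measure ?\<rho> A" by simp
  then have "eventually (\<lambda>m. measure ?\<rho> A - \<epsilon> < measure ?\<rho> (A \<inter> W m)) sequentially"
    using \<epsilon> by (intro order_tendstoD(1)) auto
  from eventually_happens[OF eventually_conj[OF eventually_ge_at_top[of n] this]]
  obtain m where m: "m \<ge> n" "measure ?\<rho> A - \<epsilon> < measure ?\<rho> (A \<inter> W m)" by auto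
  have AW: "measure ?\<rho> (A - W m) < \<epsilon>"
  proof -
    have "measure ?\<rho> (A - A \<inter> W m) = measure ?\<rho> A - measure ?\<rho> (A \<inter> W m)"
      using A(1) by (intro \<rho>.finite_measure_Diff) auto
    moreover have "A - A \<inter> W m = A - W m" by auto
    ultimately show ?thesis using m(2) by simp
  qed
  obtain \<kappa> J where cov: "\<And>i :: nat. \<kappa> i \<ge> m" "\<And>i. finite (J i)" "\<And>i. card (J i) \<le> 3"
    "E \<subseteq> (\<Union>i. \<Union>j\<in>J i. dyadic_arc (\<kappa> i) j)" "(\<Sum>i. ennreal ((1 / 2 ^ \<kappa> i) powr s)) \<le> ennreal \<epsilon>"
    using hausdorff_dim_dyadic_cover[OF dim \<alpha> \<epsilon>, of m] by blast
  \<comment> \<open>Of the cover only the arcs meeting \<open>A \<inter> W m\<close> are kept: a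
    point of \<open>A\<close> in the arc makes it light, and a point of \<open>W m\<close> keeps the
    arc, whose level is at least \<open>m\<close>, inside \<open>V\<close>.\<close>
  define S where "S k j \<longleftrightarrow> (\<exists>i. \<kappa> i = k \<and> j \<in> J i) \<and> dyadic_arc k j \<inter> (A \<inter> W m) \<noteq> {}" for k j
  define C where "C = {x. \<exists>k. S k (dyadic_index k x)}"
  have "norm (\<mu> C) \<le> 6 * \<epsilon>"
    unfolding C_def
  proof (rule norm_measure_cover_le[OF \<mu> cov(2,3) _ _ cov(5)])
    show "norm (\<mu> (dyadic_arc k j)) \<le> 2 * (1 / 2 ^ k) powr s" if S: "S k j" for k j
    proof -
      obtain x where x: "x \<in> A" "dyadic_index k x = j" "k \<ge> m"
        using S cov(1) by (auto simp: S_def dyadic_arc_def)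
      show ?thesis using small[OF x(1), of k] x m(1) by simp
    qed
  qed (use \<epsilon> in \<open>auto simp: S_def\<close>)
  moreover have AC: "A \<inter> W m \<subseteq> C"
  proof
    fix x assume x: "x \<in> A \<inter> W m"
    then obtain i j where "j \<in> J i" "x \<in> dyadic_arc (\<kappa> i) j" using cov(4) A(2) by blast
    then have "S (\<kappa> i) (dyadic_index (\<kappa> i) x)" using x by (auto simp: S_def dyadic_arc_def)
    then show "x \<in> C" by (auto simp: C_def)
  qed
  moreover have CV: "C \<subseteq> V"
  proof
    fix x assume "x \<in> C"
    then obtain k i y where k: "\<kappa> i = k" "dyadic_index k y = dyadic_index k x" "y \<in> W m"
      by (auto simp: C_def S_def dyadic_arc_def)
    have "dyadic_index m y = dyadic_index m x"
      using dyadic_index_div[of m _ "k - m"] k cov(1)[of i] by simp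
    then show "x \<in> V" using k(3) by (simp add: W_def V_def)
  qed
  moreover have C_sets[measurable]: "C \<in> sets borel"
    unfolding C_def UN_first_level[symmetric] by (intro sets.countable_UN) auto
  ultimately have C: "norm (\<mu> C) \<le> 6 * \<epsilon>" "A \<inter> W m \<subseteq> C" "C \<subseteq> V" by auto
  have add: "\<mu> (X \<union> Y) = \<mu> X + \<mu> Y" if "X \<in> sets borel" "Y \<in> sets borel" "X \<inter> Y = {}" for X Y
    using signed_union[OF signed_measure_on_sums[OF signed_measure_on_Re[OF \<mu>]] that]
      signed_union[OF signed_measure_on_sums[OF signed_measure_on_Im[OF \<mu>]] that]
    by (simp add: complex_eq_iff)
  have 1: "\<mu> A = \<mu> (A \<inter> W m) + \<mu> (A - W m)"
    using add[of "A \<inter> W m" "A - W m"] A(1) by (simp add: Int_Diff_Un Int_Diff_disjoint)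
  have 2: "\<mu> C = \<mu> (A \<inter> W m) + \<mu> (C - A \<inter> W m)"
  proof -
    have "A \<inter> W m \<union> (C - A \<inter> W m) = C" using C(2) by auto
    then show ?thesis using add[of "A \<inter> W m" "C - A \<inter> W m"] A(1) by auto
  qed
  have 3: "norm (\<mu> (A - W m)) \<le> \<epsilon>"
    using norm_complex_measure_le[OF \<mu>, of "A - W m"] A(1) AW by auto
  have 4: "norm (\<mu> (C - A \<inter> W m)) \<le> 2 * \<epsilon>"
  proof -
    have "measure ?\<rho> (C - A \<inter> W m) \<le> measure ?\<rho> ((V - A) \<union> (A - W m))"
      using A(1) C(3) by (intro \<rho>.finite_measure_mono) auto
    also have "\<dots> \<le> measure ?\<rho> (V - A) + measure ?\<rho> (A - W m)"
      using A(1) by (intro measure_Un_le) auto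
    finally show ?thesis
      using norm_complex_measure_le[OF \<mu>, of "C - A \<inter> W m"] A(1) AW VA by auto
  qed
  have "\<mu> A = \<mu> C - \<mu> (C - A \<inter> W m) + \<mu> (A - W m)" using 1 2 by simp
  then have "norm (\<mu> A) \<le> norm (\<mu> C) + norm (\<mu> (C - A \<inter> W m)) + norm (\<mu> (A - W m))"
    using norm_triangle_ineq[of "\<mu> C - \<mu> (C - A \<inter> W m)" "\<mu> (A - W m)"]
      norm_triangle_ineq4[of "\<mu> C" "\<mu> (C - A \<inter> W m)"] by simp
  then have "norm (\<mu> A) \<le> 9 * \<epsilon>" using C(1) 3 4 by linarith
  moreover have "norm (\<mu> A) = 10 * \<epsilon>" by (simp add: \<epsilon>_def)
  ultimately show False using \<epsilon> by linarith
qed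

text \<open>All measurable subsets of the light part of a carrier \<open>E\<close> are null by
  \<open>small_arcs_null\<close>, and this makes the dominating measure vanish there. The factor 2
  leaves room for noise of the size of the detection threshold.\<close>

lemma AE_heavy_arcs:
  assumes \<mu>: "complex_measure borel \<mu>"
    and dim: "cmeasure_dim \<mu> \<le> ennreal \<alpha>" and \<alpha>: "0 \<le> \<alpha>" "\<alpha> < s"
  shows "AE x in dominating_measure borel \<mu>. \<exists>k\<ge>n. norm (\<mu> (dyadic_arc k (dyadic_index k x))) > 2 * (1 / 2 ^ k) powr s"
proof -
  let ?\<rho> = "dominating_measure borel \<mu>"
  obtain E where E: "E \<in> sets borel" "total_variation borel \<mu> (UNIV - E) = 0" "cmeasure_dim \<mu> = hausdorff_dim E"
    using cmeasure_dim_attained[OF \<mu>] by blast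
  define B where "B = {x. \<forall>k\<ge>n. norm (\<mu> (dyadic_arc k (dyadic_index k x))) \<le> 2 * (1 / 2 ^ k) powr s}"
  have [measurable]: "(\<lambda>x. norm (\<mu> (dyadic_arc k (dyadic_index k x)))) \<in> borel_measurable borel" for k
    by (rule measurable_compose[OF measurable_dyadic_index]) simp
  have B[measurable]: "B \<in> sets borel" unfolding B_def by measurable
  have "emeasure ?\<rho> (UNIV - E) = 0"
    using E total_variation_eq_0_iff[OF \<mu>, of "UNIV - E"] by (intro dominating_measure_null[OF \<mu>]) auto
  moreover have "emeasure ?\<rho> (B \<inter> E) = 0"
  proof (rule dominating_measure_null[OF \<mu>])
    fix A assume A: "A \<in> sets borel" "A \<subseteq> B \<inter> E"
    show "\<mu> A = 0"
      by (rule small_arcs_null[OF \<mu> dim[unfolded E(3)] \<alpha> A(1)]) (use A(2) in \<open>auto simp: B_def\<close>)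
  qed (use E in auto)
  ultimately have N: "UNIV - E \<in> null_sets ?\<rho>" "B \<inter> E \<in> null_sets ?\<rho>"
    using E(1) B by (auto intro!: null_setsI)
  have "AE x in ?\<rho>. x \<notin> UNIV - E" "AE x in ?\<rho>. x \<notin> B \<inter> E"
    by (rule AE_not_in[OF N(1)], rule AE_not_in[OF N(2)])
  then show ?thesis
    by eventually_elim (auto simp: B_def not_le)
qed

section \<open>Observing arcs through the noise\<close>

text \<open>In the rate, \<open>1 / 2 ^ k\<close> keeps the noise variance of an estimate of the
  order of the arc length, and \<open>(1 / 16) ^ l\<close> makes consecutive estimates differ by
  about \<open>(1 / 4) ^ l\<close>, which is summable.\<close>

definition approximates_arc :: "nat \<Rightarrow> nat \<Rightarrow> (nat \<Rightarrow> int set) \<Rightarrow> (nat \<Rightarrow> int \<Rightarrow> complex) \<Rightarrow> bool"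
  where "approximates_arc k j F a \<longleftrightarrow>
    (\<forall>l. finite (F l)) \<and> (\<forall>l n. n \<notin> F l \<longrightarrow> a l n = 0) \<and>
    (\<forall>l x. norm (trig_poly (F l) (a l) x) \<le> 2) \<and>
    (\<forall>x. (\<lambda>l. trig_poly (F l) (a l) x) \<longlonglongrightarrow> indicator (dyadic_arc k j) x) \<and>
    (\<forall>l. (\<integral>x. (norm (trig_poly (F l) (a l) x - indicator (dyadic_arc k j) x))\<^sup>2 \<partial>circle_haar) \<le> (1 / 2 ^ k) * (1 / 16) ^ l)"

text \<open>The approximations are fixed once and for all, independently of measure and noise, so
  that \<open>arc_estimate\<close> is linear in the observation and signal and noise can be studied
  separately.\<close>

definition arc_freqs :: "nat \<Rightarrow> nat \<Rightarrow> nat \<Rightarrow> int set"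
  where "arc_freqs k j = (SOME F. \<exists>a. approximates_arc k j F a)"

definition arc_coeffs :: "nat \<Rightarrow> nat \<Rightarrow> nat \<Rightarrow> int \<Rightarrow> complex"
  where "arc_coeffs k j = (SOME a. approximates_arc k j (arc_freqs k j) a)"

lemma approximates_arc:
  assumes "k \<ge> 1"
  shows "approximates_arc k j (arc_freqs k j) (arc_coeffs k j)"
proof -
  have pos: "(1 / 2 ^ k) * (1 / 16) ^ l > (0::real)" for l by simp
  have "\<exists>F a. approximates_arc k j F a"
  proof (rule arc_trig_approximation[OF assms, where \<delta> = "\<lambda>l. (1 / 2 ^ k) * (1 / 16) ^ l" and j = j])
    show "(1 / 2 ^ k) * (1 / 16) ^ l > (0::real)" for l by (rule pos)
  qed (unfold approximates_arc_def, blast)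
  then have "\<exists>a. approximates_arc k j (arc_freqs k j) a"
    unfolding arc_freqs_def by (rule someI_ex)
  then show ?thesis unfolding arc_coeffs_def by (rule someI_ex)
qed

definition arc_estimate :: "nat \<Rightarrow> nat \<Rightarrow> nat \<Rightarrow> (int \<Rightarrow> complex) \<Rightarrow> complex"
  where "arc_estimate k j l y = (\<Sum>n\<in>arc_freqs k j l. arc_coeffs k j l n * y n)"

text \<open>On observations this limit exists only almost surely; elsewhere \<open>lim\<close> is an
  unspecified value, which does not affect measurability.\<close>

definition arc_value :: "nat \<Rightarrow> nat \<Rightarrow> (int \<Rightarrow> complex) \<Rightarrow> complex"
  where "arc_value k j y = lim (\<lambda>l. arc_estimate k j l y)"

lemma arc_estimate_add: "arc_estimate k j l (\<lambda>n. x n + y n) = arc_estimate k j l x + arc_estimate k j l y"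
  by (simp add: arc_estimate_def distrib_left sum.distrib)

lemma measurable_arc_value [measurable]: "arc_value k j \<in> borel_measurable borel"
proof -
  have [measurable]: "(\<lambda>y :: int \<Rightarrow> complex. y n) \<in> borel_measurable borel" for n
    by (rule measurable_product_then_coordinatewise) simp
  show ?thesis unfolding arc_value_def[abs_def] arc_estimate_def by measurable
qed

lemma integrable_haar_bounded:
  fixes f :: "circle \<Rightarrow> complex"
  assumes "f \<in> borel_measurable borel" "\<And>x. norm (f x) \<le> B"
  shows "integrable circle_haar (\<lambda>x. (norm (f x))\<^sup>2)"
proof (rule circle_haar.integrable_const_bound[of _ "B\<^sup>2"])
  show "AE x in circle_haar. norm ((norm (f x))\<^sup>2) \<le> B\<^sup>2"
    using assms(2) by (intro AE_I2) (simp add: power_mono)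
qed (use assms(1) in measurable)

lemma norm_diff_square_le: "(norm (a - b))\<^sup>2 \<le> 2 * (norm a)\<^sup>2 + 2 * (norm b)\<^sup>2" for a b :: complex
proof -
  have "(norm (a - b))\<^sup>2 \<le> (norm a + norm b)\<^sup>2"
    by (intro power_mono norm_triangle_ineq4) simp
  also have "\<dots> \<le> 2 * (norm a)\<^sup>2 + 2 * (norm b)\<^sup>2"
    using sum_squares_bound[of "norm a" "norm b"] by (simp add: power2_sum)
  finally show ?thesis .
qed

context
  fixes k j :: nat
  assumes k: "k \<ge> 1"
begin

private abbreviation "P l \<equiv> trig_poly (arc_freqs k j l) (arc_coeffs k j l)"
private abbreviation "I \<equiv> dyadic_arc k j"

lemma finite_arc_freqs: "finite (arc_freqs k j l)"
  and arc_coeffs_outside: "n \<notin> arc_freqs k j l \<Longrightarrow> arc_coeffs k j l n = 0"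
  and norm_arc_trig_poly_le: "norm (P l x) \<le> 2"
  and arc_trig_poly_tendsto: "(\<lambda>l. P l x) \<longlonglongrightarrow> indicator I x"
  and arc_trig_poly_L2: "(\<integral>x. (norm (P l x - indicator I x))\<^sup>2 \<partial>circle_haar) \<le> (1 / 2 ^ k) * (1 / 16) ^ l"
  using approximates_arc[OF k, of j] unfolding approximates_arc_def by blast+

text \<open>On a transform the estimate is the integral of the approximating polynomial against
  \<open>\<mu>\<close>. Dominated convergence under \<open>\<rho>\<close> applies with the bound 3,
  which is 2 for the polynomial plus 1 for the indicator.\<close>

lemma arc_estimate_tendsto:
  assumes \<mu>: "complex_measure borel \<mu>"
  shows "(\<lambda>l. arc_estimate k j l (fourier_transform \<mu>)) \<longlonglongrightarrow> \<mu> I"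
proof -
  let ?\<rho> = "dominating_measure borel \<mu>"
  interpret \<rho>: finite_measure ?\<rho> by (rule finite_dominating_measure[OF \<mu>])
  have int: "integrable ?\<rho> f" if "f \<in> borel_measurable borel" "\<And>x. norm (f x) \<le> B" for f :: "circle \<Rightarrow> complex" and B
    using that by (intro \<rho>.integrable_const_bound[of _ B]) auto
  have intP: "integrable ?\<rho> (P l)" for l by (rule int[OF _ norm_arc_trig_poly_le]) simp
  have intI: "integrable ?\<rho> (indicator I :: _ \<Rightarrow> complex)" by (rule int[of _ 1]) (auto simp: indicator_def)
  have est: "arc_estimate k j l (fourier_transform \<mu>) = cmeasure_integral borel \<mu> (P l)" for l
  proof -
    have "cmeasure_integral borel \<mu> (P l) = (\<Sum>n\<in>arc_freqs k j l. cmeasure_integral borel \<mu> (\<lambda>x. arc_coeffs k j l n * fourier_char n x))"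
      unfolding trig_poly_def[abs_def]
      by (rule cmeasure_integral_sum[OF \<mu>], rule int[of _ "norm (arc_coeffs k j l n)" for n]) (auto simp: norm_mult)
    also have "\<dots> = (\<Sum>n\<in>arc_freqs k j l. arc_coeffs k j l n * fourier_transform \<mu> n)"
      unfolding fourier_transform_def
      by (intro sum.cong cmeasure_integral_cmult[OF \<mu>] int[of _ 1]) auto
    finally show ?thesis by (simp add: arc_estimate_def)
  qed
  have bound: "norm (arc_estimate k j l (fourier_transform \<mu>) - \<mu> I) \<le> 4 * (\<integral>x. norm (P l x - indicator I x) \<partial>?\<rho>)" for l
  proof -
    have "arc_estimate k j l (fourier_transform \<mu>) - \<mu> I = cmeasure_integral borel \<mu> (\<lambda>x. P l x - indicator I x)"
      using cmeasure_integral_diff[OF \<mu> intP intI, of l] by (simp add: est cmeasure_integral_indicator[OF \<mu>])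
    then show ?thesis using norm_cmeasure_integral_le[OF \<mu> Bochner_Integration.integrable_diff[OF intP intI], of l] by simp
  qed
  have "(\<lambda>l. \<integral>x. norm (P l x - indicator I x) \<partial>?\<rho>) \<longlonglongrightarrow> (\<integral>x. 0 \<partial>?\<rho>)"
  proof (rule integral_dominated_convergence)
    show "AE x in ?\<rho>. (\<lambda>l. norm (P l x - indicator I x)) \<longlonglongrightarrow> 0"
      using tendsto_norm_zero[OF LIM_zero[OF arc_trig_poly_tendsto]] by (intro AE_I2)
    show "AE x in ?\<rho>. norm (norm (P l x - indicator I x)) \<le> 3" for l
    proof (rule AE_I2)
      fix x
      have "norm (P l x - indicator I x) \<le> norm (P l x) + norm (indicator I x :: complex)" by (rule norm_triangle_ineq4)
      also have "\<dots> \<le> 3" using norm_arc_trig_poly_le[of l x] by (simp add: indicator_def)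
      finally show "norm (norm (P l x - indicator I x)) \<le> 3" by simp
    qed
  qed measurable
  then have "(\<lambda>l. 4 * (\<integral>x. norm (P l x - indicator I x) \<partial>?\<rho>)) \<longlonglongrightarrow> 0"
    by (intro tendsto_mult_right_zero) simp
  then have "(\<lambda>l. arc_estimate k j l (fourier_transform \<mu>) - \<mu> I) \<longlonglongrightarrow> 0"
    by (rule Lim_null_comparison[rotated]) (intro always_eventually allI bound)
  then show ?thesis by (rule LIM_zero_cancel)
qed

text \<open>Parseval turns the squared norm of the polynomial into the noise variance of the
  estimate, which is thus of the order of the arc length. This is the source of the exponent
  1/2.\<close>

lemma arc_coeffs_L2:
  assumes j: "j < 2 ^ k"
  shows "(\<Sum>n\<in>arc_freqs k j l. (norm (arc_coeffs k j l n))\<^sup>2) \<le> 4 / 2 ^ k"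
proof -
  have nb: "norm (P l x - indicator I x) \<le> 3" for x
    using norm_triangle_ineq4[of "P l x" "indicator I x"] norm_arc_trig_poly_le[of l x] by (cases "x \<in> I") auto
  have "(norm (P l x))\<^sup>2 \<le> 2 * (norm (P l x - indicator I x))\<^sup>2 + 2 * indicator I x" for x
    using norm_diff_square_le[of "P l x - indicator I x" "- indicator I x"] by (cases "x \<in> I") auto
  then have "(\<integral>x. (norm (P l x))\<^sup>2 \<partial>circle_haar) \<le> (\<integral>x. 2 * (norm (P l x - indicator I x))\<^sup>2 + 2 * indicator I x \<partial>circle_haar)"
    by (intro integral_mono integrable_haar_bounded[OF _ norm_arc_trig_poly_le] Bochner_Integration.integrable_add
        integrable_mult_right integrable_haar_bounded[OF _ nb]) (auto simp: circle_haar.emeasure_eq_measure)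
  also have "\<dots> = 2 * (\<integral>x. (norm (P l x - indicator I x))\<^sup>2 \<partial>circle_haar) + 2 * measure circle_haar I"
    by (subst Bochner_Integration.integral_add)
      (auto intro!: integrable_mult_right integrable_haar_bounded[OF _ nb] simp: circle_haar.emeasure_eq_measure)
  also have "\<dots> \<le> 2 * (1 / 2 ^ k) + 2 * (1 / 2 ^ k)"
  proof -
    have "(1 / 2 ^ k) * (1 / 16) ^ l \<le> (1 / 2 ^ k :: real) * 1"
      by (intro mult_left_mono power_le_one) auto
    then show ?thesis using arc_trig_poly_L2[of l] measure_circle_haar_dyadic_arc[OF j] by simp
  qed
  finally show ?thesis by (simp add: parseval_trig_poly[OF finite_arc_freqs])
qed

text \<open>Consecutive polynomials are close to the same indicator, hence to each other; by
  Parseval this measures the increment of the noise estimates.\<close>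

lemma arc_coeffs_diff_L2:
  "(\<Sum>n\<in>arc_freqs k j (Suc l) \<union> arc_freqs k j l. (norm (arc_coeffs k j (Suc l) n - arc_coeffs k j l n))\<^sup>2) \<le> 4 * (1 / 16) ^ l"
proof -
  let ?G = "arc_freqs k j (Suc l) \<union> arc_freqs k j l"
  let ?d = "\<lambda>n. arc_coeffs k j (Suc l) n - arc_coeffs k j l n"
  have G: "finite ?G" by (simp add: finite_arc_freqs)
  have d: "trig_poly ?G ?d x = P (Suc l) x - P l x" for x
  proof -
    have "trig_poly ?G ?d x = trig_poly ?G (arc_coeffs k j (Suc l)) x - trig_poly ?G (arc_coeffs k j l) x"
      by (simp add: trig_poly_def left_diff_distrib sum_subtractf)
    moreover have "trig_poly ?G (arc_coeffs k j (Suc l)) x = P (Suc l) x" "trig_poly ?G (arc_coeffs k j l) x = P l x"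
      using G by (auto intro!: trig_poly_extend arc_coeffs_outside)
    ultimately show ?thesis by simp
  qed
  have nb: "norm (P l x - indicator I x) \<le> 3" for x l
    using norm_triangle_ineq4[of "P l x" "indicator I x"] norm_arc_trig_poly_le[of l x] by (cases "x \<in> I") auto
  have nb': "norm (trig_poly ?G ?d x) \<le> 4" for x
    unfolding d using norm_triangle_ineq4[of "P (Suc l) x" "P l x"] norm_arc_trig_poly_le[of l x] norm_arc_trig_poly_le[of "Suc l" x] by simp
  have "(norm (trig_poly ?G ?d x))\<^sup>2 \<le> 2 * (norm (P (Suc l) x - indicator I x))\<^sup>2 + 2 * (norm (P l x - indicator I x))\<^sup>2" for x
    unfolding d using norm_diff_square_le[of "P (Suc l) x - indicator I x" "P l x - indicator I x"] by simp
  then have "(\<integral>x. (norm (trig_poly ?G ?d x))\<^sup>2 \<partial>circle_haar) \<le> (\<integral>x. 2 * (norm (P (Suc l) x - indicator I x))\<^sup>2 + 2 * (norm (P l x - indicator I x))\<^sup>2 \<partial>circle_haar)"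
    by (intro integral_mono integrable_haar_bounded[OF _ nb'] Bochner_Integration.integrable_add
        integrable_mult_right integrable_haar_bounded[OF _ nb]) auto
  also have "\<dots> = 2 * (\<integral>x. (norm (P (Suc l) x - indicator I x))\<^sup>2 \<partial>circle_haar) + 2 * (\<integral>x. (norm (P l x - indicator I x))\<^sup>2 \<partial>circle_haar)"
    by (subst Bochner_Integration.integral_add)
      (auto intro!: integrable_mult_right integrable_haar_bounded[OF _ nb])
  also have "\<dots> \<le> 2 * (1 / 16) ^ l + 2 * (1 / 16) ^ l"
  proof -
    have "(1 / 2 ^ k) * (1 / 16) ^ l \<le> (1 :: real) * (1 / 16) ^ l"
      by (intro mult_right_mono) auto
    moreover have "(1 / 2 ^ k) * (1 / 16) ^ Suc l \<le> (1 :: real) * (1 / 16) ^ l"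
      by (intro mult_mono power_decreasing) auto
    ultimately show ?thesis using arc_trig_poly_L2[of l] arc_trig_poly_L2[of "Suc l"] by linarith
  qed
  finally show ?thesis by (simp add: parseval_trig_poly[OF G])
qed

end

text \<open>\<open>quad_exp t\<close> bounds both \<open>t * norm z\<close> and \<open>exp\<close> of it up to constants, and has explicit Gaussian expectation.\<close>

definition quad_exp :: "real \<Rightarrow> complex \<Rightarrow> real"
  where "quad_exp t z = exp (t * Re z) + exp (- (t * Re z)) + (exp (t * Im z) + exp (- (t * Im z)))"

lemma measurable_quad_exp [measurable]: "quad_exp t \<in> borel_measurable borel"
  unfolding quad_exp_def[abs_def] by measurable

lemma continuous_quad_exp: "(f \<longlongrightarrow> z) F \<Longrightarrow> ((\<lambda>x. quad_exp t (f x)) \<longlongrightarrow> quad_exp t z) F"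
  unfolding quad_exp_def by (intro tendsto_intros)

lemma exp_abs_le: "exp \<bar>x\<bar> \<le> exp x + exp (- x)" for x :: real
  by (cases "x \<ge> 0") (auto simp: abs_if)

lemma norm_le_quad_exp:
  assumes "t \<ge> 0"
  shows "t * norm z \<le> quad_exp t z"
proof -
  have "t * norm z \<le> t * (\<bar>Re z\<bar> + \<bar>Im z\<bar>)"
    using assms cmod_le by (intro mult_left_mono)
  also have "\<dots> = \<bar>t * Re z\<bar> + \<bar>t * Im z\<bar>" using assms by (simp add: abs_mult distrib_left)
  also have "\<dots> \<le> exp \<bar>t * Re z\<bar> + exp \<bar>t * Im z\<bar>"
    using exp_ge_add_one_self[of "\<bar>t * Re z\<bar>"] exp_ge_add_one_self[of "\<bar>t * Im z\<bar>"] by linarith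
  also have "\<dots> \<le> quad_exp t z"
    unfolding quad_exp_def by (intro add_mono exp_abs_le)
  finally show ?thesis .
qed

lemma quad_exp_le_imp:
  assumes "t \<ge> 0" "quad_exp t z \<le> exp c"
  shows "t * norm z \<le> 2 * c"
proof -
  have "exp \<bar>t * Re z\<bar> \<le> exp c" "exp \<bar>t * Im z\<bar> \<le> exp c"
    using assms(2) exp_abs_le[of "t * Re z"] exp_abs_le[of "t * Im z"]
      exp_gt_zero[of "t * Re z"] exp_gt_zero[of "- (t * Re z)"] exp_gt_zero[of "t * Im z"] exp_gt_zero[of "- (t * Im z)"]
    unfolding quad_exp_def by linarith+
  then have "\<bar>t * Re z\<bar> + \<bar>t * Im z\<bar> \<le> 2 * c" by simp
  moreover have "t * norm z \<le> t * (\<bar>Re z\<bar> + \<bar>Im z\<bar>)"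
    using assms cmod_le by (intro mult_left_mono)
  ultimately show ?thesis using assms(1) by (simp add: abs_mult distrib_left)
qed

context complex_gaussian
begin

text \<open>The four exponentials are exponential moments of the sum multiplied by \<open>t\<close>,
  \<open>- t\<close>, \<open>\<i> * t\<close> and \<open>- \<i> * t\<close>, and all four have the
  same expectation.\<close>

lemma nn_integral_quad_exp:
  assumes "finite F"
  shows "(\<integral>\<^sup>+\<omega>. ennreal (quad_exp t (\<Sum>n\<in>F. a n * \<xi> n \<omega>)) \<partial>P) = ennreal (4 * exp (t\<^sup>2 * (\<Sum>n\<in>F. (norm (a n))\<^sup>2) / 2))"
proof -
  define E where "E = ennreal (exp (t\<^sup>2 * (\<Sum>n\<in>F. (norm (a n))\<^sup>2) / 2))"
  have e: "(\<integral>\<^sup>+\<omega>. ennreal (exp (Re (c * (\<Sum>n\<in>F. a n * \<xi> n \<omega>)))) \<partial>P) = E" if "norm c = \<bar>t\<bar>" for c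
    using noise_exp_moment[OF assms, of "\<lambda>n. c * a n"] that
    by (simp add: E_def sum_distrib_left mult.assoc norm_mult power_mult_distrib)
  have [measurable]: "(\<lambda>\<omega>. \<Sum>n\<in>F. a n * \<xi> n \<omega>) \<in> borel_measurable P" by measurable
  have "(\<integral>\<^sup>+\<omega>. ennreal (quad_exp t (\<Sum>n\<in>F. a n * \<xi> n \<omega>)) \<partial>P)
      = (\<integral>\<^sup>+\<omega>. (ennreal (exp (Re (of_real t * (\<Sum>n\<in>F. a n * \<xi> n \<omega>)))) + ennreal (exp (Re (- of_real t * (\<Sum>n\<in>F. a n * \<xi> n \<omega>)))))
        + (ennreal (exp (Re (- (\<i> * of_real t) * (\<Sum>n\<in>F. a n * \<xi> n \<omega>)))) + ennreal (exp (Re ((\<i> * of_real t) * (\<Sum>n\<in>F. a n * \<xi> n \<omega>))))) \<partial>P)"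
    by (simp add: quad_exp_def ennreal_plus[symmetric] del: ennreal_plus)
  also have "\<dots> = (E + E) + (E + E)"
    using e[of "of_real t"] e[of "- of_real t"] e[of "- (\<i> * of_real t)"] e[of "\<i> * of_real t"]
    by (simp add: nn_integral_add norm_mult)
  also have "\<dots> = ennreal (4 * exp (t\<^sup>2 * (\<Sum>n\<in>F. (norm (a n))\<^sup>2) / 2))"
    by (simp add: E_def ennreal_plus[symmetric] del: ennreal_plus)
  finally show ?thesis .
qed

text \<open>The increments have geometrically decreasing first moments, so almost surely they are
  absolutely summable.\<close>

lemma AE_arc_estimate_convergent:
  assumes k: "k \<ge> 1"
  shows "AE \<omega> in P. convergent (\<lambda>l. arc_estimate k j l (\<lambda>n. \<xi> n \<omega>))"
proof -
  define D where "D l \<omega> = arc_estimate k j (Suc l) (\<lambda>n. \<xi> n \<omega>) - arc_estimate k j l (\<lambda>n. \<xi> n \<omega>)" for l \<omega>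
  let ?G = "\<lambda>l. arc_freqs k j (Suc l) \<union> arc_freqs k j l"
  have D: "D l \<omega> = (\<Sum>n\<in>?G l. (arc_coeffs k j (Suc l) n - arc_coeffs k j l n) * \<xi> n \<omega>)" for l \<omega>
  proof -
    have "arc_estimate k j (Suc l) (\<lambda>n. \<xi> n \<omega>) = (\<Sum>n\<in>?G l. arc_coeffs k j (Suc l) n * \<xi> n \<omega>)"
      "arc_estimate k j l (\<lambda>n. \<xi> n \<omega>) = (\<Sum>n\<in>?G l. arc_coeffs k j l n * \<xi> n \<omega>)"
      unfolding arc_estimate_def using finite_arc_freqs[OF k] arc_coeffs_outside[OF k]
      by (intro sum.mono_neutral_left; auto)+
    then show ?thesis by (simp add: D_def left_diff_distrib sum_subtractf)
  qed
  have [measurable]: "D l \<in> borel_measurable P" for l unfolding D[abs_def] by measurable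
  have E: "(\<integral>\<^sup>+\<omega>. ennreal (norm (D l \<omega>)) \<partial>P) \<le> ennreal (4 * exp 2 * (1 / 4) ^ l)" for l
  proof -
    \<comment> \<open>The scale \<open>4 ^ l\<close> normalises an increment whose coefficients have
      squared sum at most \<open>4 * (1 / 16) ^ l\<close>; half of the resulting 4 is the exponent
      in \<open>exp 2\<close>.\<close>
    have "ennreal (norm (D l \<omega>)) \<le> ennreal ((1 / 4) ^ l) * ennreal (quad_exp (4 ^ l) (D l \<omega>))" for \<omega>
    proof -
      have "norm (D l \<omega>) = (1 / 4) ^ l * (4 ^ l * norm (D l \<omega>))" by (simp add: power_one_over)
      also have "\<dots> \<le> (1 / 4) ^ l * quad_exp (4 ^ l) (D l \<omega>)"
        by (intro mult_left_mono norm_le_quad_exp) auto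
      finally show ?thesis by (subst ennreal_mult'[symmetric]) (auto intro: ennreal_leI)
    qed
    then have "(\<integral>\<^sup>+\<omega>. ennreal (norm (D l \<omega>)) \<partial>P) \<le> (\<integral>\<^sup>+\<omega>. ennreal ((1 / 4) ^ l) * ennreal (quad_exp (4 ^ l) (D l \<omega>)) \<partial>P)"
      by (intro nn_integral_mono)
    also have "\<dots> = ennreal ((1 / 4) ^ l) * (\<integral>\<^sup>+\<omega>. ennreal (quad_exp (4 ^ l) (D l \<omega>)) \<partial>P)"
      by (rule nn_integral_cmult) measurable
    also have "\<dots> \<le> ennreal ((1 / 4) ^ l) * ennreal (4 * exp 2)"
    proof (rule mult_left_mono)
      have "(4 ^ l)\<^sup>2 * (\<Sum>n\<in>?G l. (norm (arc_coeffs k j (Suc l) n - arc_coeffs k j l n))\<^sup>2) \<le> (4 ^ l)\<^sup>2 * (4 * (1 / 16) ^ l)"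
        by (intro mult_left_mono arc_coeffs_diff_L2[OF k]) simp
      also have "(4 ^ l)\<^sup>2 * (4 * (1 / 16) ^ l) = (4 :: real)"
        by (simp add: power2_eq_square power_mult_distrib[symmetric] power_one_over)
      finally show "(\<integral>\<^sup>+\<omega>. ennreal (quad_exp (4 ^ l) (D l \<omega>)) \<partial>P) \<le> ennreal (4 * exp 2)"
        unfolding D by (subst nn_integral_quad_exp) (auto simp: finite_arc_freqs[OF k] intro!: ennreal_leI)
    qed simp
    also have "\<dots> = ennreal (4 * exp 2 * (1 / 4) ^ l)"
      by (subst ennreal_mult'[symmetric]) (simp_all add: mult_ac)
    finally show ?thesis .
  qed
  have "(\<integral>\<^sup>+\<omega>. (\<Sum>l. ennreal (norm (D l \<omega>))) \<partial>P) = (\<Sum>l. \<integral>\<^sup>+\<omega>. ennreal (norm (D l \<omega>)) \<partial>P)"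
    by (rule nn_integral_suminf) measurable
  also have "\<dots> \<le> (\<Sum>l. ennreal (4 * exp 2 * (1 / 4) ^ l))"
    by (intro suminf_le E) auto
  also have "\<dots> = ennreal (\<Sum>l. 4 * exp 2 * (1 / 4) ^ l)"
    by (rule suminf_ennreal2) (auto intro!: summable_mult summable_geometric)
  also have "\<dots> < \<infinity>" by simp
  finally have "AE \<omega> in P. (\<Sum>l. ennreal (norm (D l \<omega>))) \<noteq> \<infinity>"
    by (intro nn_integral_noteq_infinite) auto
  then show ?thesis
  proof eventually_elim
    case (elim \<omega>)
    then have "summable (\<lambda>l. norm (D l \<omega>))"
      by (intro summable_suminf_not_top) auto
    then have "summable (\<lambda>l. D l \<omega>)" by (rule summable_norm_cancel)
    then have "convergent (\<lambda>n. \<Sum>l<n. D l \<omega>)" by (simp add: summable_iff_convergent)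
    then have "convergent (\<lambda>n. (\<Sum>l<n. D l \<omega>) + arc_estimate k j 0 (\<lambda>n. \<xi> n \<omega>))"
      by (intro convergent_add convergent_const)
    moreover have "(\<Sum>l<n. D l \<omega>) + arc_estimate k j 0 (\<lambda>n. \<xi> n \<omega>) = arc_estimate k j n (\<lambda>n. \<xi> n \<omega>)" for n
      unfolding D_def using sum_lessThan_telescope[of "\<lambda>l. arc_estimate k j l (\<lambda>n. \<xi> n \<omega>)" n] by simp
    ultimately show ?case by simp
  qed
qed

text \<open>Fatou's lemma in \<open>l\<close>. With \<open>t = sqrt (2 ^ k)\<close> the factor
  \<open>t ^ 2\<close> cancels the arc length in \<open>arc_coeffs_L2\<close>, so the bound is the
  same for all arcs of all levels.\<close>

lemma nn_integral_quad_exp_arc_value: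
  assumes k: "k \<ge> 1" and j: "j < 2 ^ k"
  shows "(\<integral>\<^sup>+\<omega>. ennreal (quad_exp (sqrt (2 ^ k)) (arc_value k j (\<lambda>n. \<xi> n \<omega>))) \<partial>P) \<le> ennreal (4 * exp 2)"
proof -
  let ?q = "\<lambda>l \<omega>. ennreal (quad_exp (sqrt (2 ^ k)) (arc_estimate k j l (\<lambda>n. \<xi> n \<omega>)))"
  have [measurable]: "(\<lambda>\<omega>. arc_estimate k j l (\<lambda>n. \<xi> n \<omega>)) \<in> borel_measurable P" for l
    unfolding arc_estimate_def by measurable
  have "AE \<omega> in P. ennreal (quad_exp (sqrt (2 ^ k)) (arc_value k j (\<lambda>n. \<xi> n \<omega>))) = liminf (\<lambda>l. ?q l \<omega>)"
    using AE_arc_estimate_convergent[OF k, of j]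
  proof eventually_elim
    case (elim \<omega>)
    then have "(\<lambda>l. arc_estimate k j l (\<lambda>n. \<xi> n \<omega>)) \<longlonglongrightarrow> arc_value k j (\<lambda>n. \<xi> n \<omega>)"
      unfolding arc_value_def by (simp add: convergent_LIMSEQ_iff)
    then have "(\<lambda>l. ?q l \<omega>) \<longlonglongrightarrow> ennreal (quad_exp (sqrt (2 ^ k)) (arc_value k j (\<lambda>n. \<xi> n \<omega>)))"
      by (intro tendsto_ennrealI continuous_quad_exp)
    then show ?case by (simp add: lim_imp_Liminf)
  qed
  then have "(\<integral>\<^sup>+\<omega>. ennreal (quad_exp (sqrt (2 ^ k)) (arc_value k j (\<lambda>n. \<xi> n \<omega>))) \<partial>P) = (\<integral>\<^sup>+\<omega>. liminf (\<lambda>l. ?q l \<omega>) \<partial>P)"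
    by (rule nn_integral_cong_AE)
  also have "\<dots> \<le> liminf (\<lambda>l. \<integral>\<^sup>+\<omega>. ?q l \<omega> \<partial>P)"
    by (rule nn_integral_liminf) measurable
  also have "\<dots> \<le> liminf (\<lambda>l. ennreal (4 * exp 2))"
  proof (intro Liminf_mono always_eventually allI)
    fix l
    have "2 ^ k * (\<Sum>n\<in>arc_freqs k j l. (norm (arc_coeffs k j l n))\<^sup>2) \<le> 2 ^ k * (4 / 2 ^ k)"
      by (intro mult_left_mono arc_coeffs_L2[OF k j]) simp
    then show "(\<integral>\<^sup>+\<omega>. ?q l \<omega> \<partial>P) \<le> ennreal (4 * exp 2)"
      unfolding arc_estimate_def
      by (subst nn_integral_quad_exp) (auto simp: finite_arc_freqs[OF k] intro!: ennreal_leI)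
  qed
  also have "\<dots> = ennreal (4 * exp 2)" by (simp add: Liminf_const)
  finally show ?thesis .
qed

text \<open>A Borel-Cantelli argument through one random series: the weight
  \<open>(1 / 4) ^ k\<close> against \<open>2 ^ k\<close> arcs leaves a geometric series, so the
  series is almost surely finite. Each of its terms then bounds \<open>sqrt (2 ^ k)\<close> times
  the noise on an arc linearly in \<open>k\<close>, and any exponent below 1/2 absorbs this
  factor.\<close>

lemma AE_noise_on_arcs_small:
  assumes \<beta>: "\<beta> < 1 / 2"
  shows "AE \<omega> in P. \<exists>k0. \<forall>k\<ge>k0. \<forall>j<2 ^ k. norm (arc_value k j (\<lambda>n. \<xi> n \<omega>)) \<le> (1 / 2 ^ k) powr \<beta>"
proof -
  let ?q = "\<lambda>k j \<omega>. ennreal (quad_exp (sqrt (2 ^ k)) (arc_value k j (\<lambda>n. \<xi> n \<omega>)))"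
  have noise_meas: "(\<lambda>\<omega> n. \<xi> n \<omega>) \<in> P \<rightarrow>\<^sub>M borel"
    by (rule measurable_coordinatewise_then_product) measurable
  have [measurable]: "(\<lambda>\<omega>. arc_value k j (\<lambda>n. \<xi> n \<omega>)) \<in> borel_measurable P" for k j
    by (rule measurable_compose[OF noise_meas measurable_arc_value])
  have "(\<integral>\<^sup>+\<omega>. (\<Sum>k. ennreal ((1 / 4) ^ Suc k) * (\<Sum>j<2 ^ Suc k. ?q (Suc k) j \<omega>)) \<partial>P)
      = (\<Sum>k. \<integral>\<^sup>+\<omega>. ennreal ((1 / 4) ^ Suc k) * (\<Sum>j<2 ^ Suc k. ?q (Suc k) j \<omega>) \<partial>P)"
    by (rule nn_integral_suminf) measurable
  also have "\<dots> \<le> (\<Sum>k. ennreal (4 * exp 2 * (1 / 2) ^ Suc k))"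
  proof (rule suminf_le)
    fix k
    have "(\<integral>\<^sup>+\<omega>. ennreal ((1 / 4) ^ Suc k) * (\<Sum>j<2 ^ Suc k. ?q (Suc k) j \<omega>) \<partial>P)
        = ennreal ((1 / 4) ^ Suc k) * (\<Sum>j<2 ^ Suc k. \<integral>\<^sup>+\<omega>. ?q (Suc k) j \<omega> \<partial>P)"
      by (subst nn_integral_cmult, measurable, subst nn_integral_sum, measurable)
    also have "\<dots> \<le> ennreal ((1 / 4) ^ Suc k) * (\<Sum>j<(2::nat) ^ Suc k. ennreal (4 * exp 2))"
      by (intro mult_left_mono sum_mono nn_integral_quad_exp_arc_value) auto
    also have "\<dots> = ennreal ((1 / 4) ^ Suc k * (2 ^ Suc k * (4 * exp 2)))"
      by (simp only: sum_constant card_lessThan ennreal_of_nat_eq_real_of_nat)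
        (subst ennreal_mult'[symmetric], simp, subst ennreal_mult'[symmetric], simp_all)
    also have "(1 / 4) ^ Suc k * (2 ^ Suc k * (4 * exp 2)) = 4 * exp 2 * (1 / 2 :: real) ^ Suc k"
      by (simp add: power_mult_distrib[symmetric] mult.assoc[symmetric])
    finally show "(\<integral>\<^sup>+\<omega>. ennreal ((1 / 4) ^ Suc k) * (\<Sum>j<2 ^ Suc k. ?q (Suc k) j \<omega>) \<partial>P) \<le> ennreal (4 * exp 2 * (1 / 2) ^ Suc k)" .
  qed auto
  also have "\<dots> = ennreal (\<Sum>k. 4 * exp 2 * (1 / 2) ^ Suc k)"
    by (rule suminf_ennreal2) (auto intro!: summable_mult summable_geometric)
  also have "\<dots> < \<infinity>" by simp
  finally have "AE \<omega> in P. (\<Sum>k. ennreal ((1 / 4) ^ Suc k) * (\<Sum>j<2 ^ Suc k. ?q (Suc k) j \<omega>)) \<noteq> \<infinity>"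
    by (intro nn_integral_noteq_infinite) auto
  then show ?thesis
  proof eventually_elim
    case (elim \<omega>)
    then obtain K where K: "0 \<le> K" "(\<Sum>k. ennreal ((1 / 4) ^ Suc k) * (\<Sum>j<2 ^ Suc k. ?q (Suc k) j \<omega>)) = ennreal K"
      by (cases "\<Sum>k. ennreal ((1 / 4) ^ Suc k) * (\<Sum>j<2 ^ Suc k. ?q (Suc k) j \<omega>)" rule: ennreal_cases) (auto simp del: power_Suc)
    define C where "C = ln (K + 1)"
    have b: "sqrt (2 ^ k) * norm (arc_value k j (\<lambda>n. \<xi> n \<omega>)) \<le> 2 * (C + real k * ln 4)"
      if kj: "k \<ge> 1" "j < 2 ^ k" for k j
    proof (rule quad_exp_le_imp)
      obtain k' where k': "k = Suc k'" using kj by (cases k) auto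
      have "ennreal ((1 / 4) ^ k) * ?q k j \<omega> \<le> ennreal ((1 / 4) ^ k) * (\<Sum>j<2 ^ k. ?q k j \<omega>)"
        using kj by (intro mult_left_mono member_le_sum) auto
      also have "\<dots> \<le> ennreal K"
        unfolding K(2)[symmetric] k'
        using sum_le_suminf[of "\<lambda>k. ennreal ((1 / 4) ^ Suc k) * (\<Sum>j<2 ^ Suc k. ?q (Suc k) j \<omega>)" "{k'}"] by simp
      finally have "(1 / 4) ^ k * quad_exp (sqrt (2 ^ k)) (arc_value k j (\<lambda>n. \<xi> n \<omega>)) \<le> K"
        using K(1) by (subst (asm) ennreal_mult'[symmetric]) (auto simp: ennreal_le_iff)
      then have "quad_exp (sqrt (2 ^ k)) (arc_value k j (\<lambda>n. \<xi> n \<omega>)) \<le> K * 4 ^ k"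
        by (simp add: field_simps power_one_over)
      also have "\<dots> \<le> (K + 1) * 4 ^ k" by (intro mult_right_mono) auto
      also have "\<dots> = exp (C + real k * ln 4)"
        using K(1) by (simp add: C_def exp_add exp_of_nat_mult)
      finally show "quad_exp (sqrt (2 ^ k)) (arc_value k j (\<lambda>n. \<xi> n \<omega>)) \<le> exp (C + real k * ln 4)" .
    qed simp
    \<comment> \<open>The gap between the exponents 1/2 and \<open>\<beta>\<close> appears as
      \<open>r ^ k\<close>, a geometric decay that beats the linear factor in
      \<open>k\<close>.\<close>
    define r where "r = 2 powr (\<beta> - 1 / 2)"
    have r: "0 < r" "r < 1" using \<beta> by (auto simp: r_def powr_less_one)
    have "(\<lambda>k. 2 * C * r ^ k + 2 * ln 4 * (real k * r ^ k)) \<longlonglongrightarrow> 2 * C * 0 + 2 * ln 4 * 0"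
      using r by (intro tendsto_intros LIMSEQ_power_zero powser_times_n_limit_0) auto
    then have "eventually (\<lambda>k. 2 * C * r ^ k + 2 * ln 4 * (real k * r ^ k) < 1) sequentially"
      by (intro order_tendstoD(2)) auto
    then obtain k1 where k1: "\<And>k. k \<ge> k1 \<Longrightarrow> 2 * C * r ^ k + 2 * ln 4 * (real k * r ^ k) < 1"
      by (auto simp: eventually_sequentially)
    show ?case
    proof (intro exI[of _ "max 1 k1"] allI impI)
      fix k j assume k: "max 1 k1 \<le> k" and j: "j < (2::nat) ^ k"
      have rk: "r ^ k = (1 / 2 ^ k) powr (1 / 2 - \<beta>)"
        by (simp add: r_def powr_power powr_divide powr_realpow[symmetric] powr_powr powr_minus_divide[symmetric] algebra_simps)
      have sq: "sqrt (2 ^ k) * (1 / 2 ^ k) powr (1 / 2) = 1"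
        by (simp add: powr_half_sqrt real_sqrt_divide)
      have "norm (arc_value k j (\<lambda>n. \<xi> n \<omega>)) = (1 / 2 ^ k) powr (1 / 2) * (sqrt (2 ^ k) * norm (arc_value k j (\<lambda>n. \<xi> n \<omega>)))"
        using sq by (simp add: mult.assoc[symmetric] mult.commute)
      also have "\<dots> \<le> (1 / 2 ^ k) powr (1 / 2) * (2 * (C + real k * ln 4))"
        using b[of k j] k j by (intro mult_left_mono) auto
      also have "(1 / 2 ^ k) powr (1 / 2) = (1 / 2 ^ k) powr \<beta> * r ^ k"
        by (simp add: rk powr_add[symmetric])
      also have "(1 / 2 ^ k) powr \<beta> * r ^ k * (2 * (C + real k * ln 4)) = (1 / 2 ^ k) powr \<beta> * (2 * C * r ^ k + 2 * ln 4 * (real k * r ^ k))"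
        by (simp add: algebra_simps)
      also have "\<dots> \<le> (1 / 2 ^ k) powr \<beta> * 1"
        using k1[of k] k by (intro mult_left_mono) auto
      finally show "norm (arc_value k j (\<lambda>n. \<xi> n \<omega>)) \<le> (1 / 2 ^ k) powr \<beta>" by simp
    qed
  qed
qed

end

section \<open>Recovery\<close>

definition heavy_arc :: "real \<Rightarrow> (nat \<Rightarrow> nat \<Rightarrow> complex) \<Rightarrow> nat \<Rightarrow> nat \<Rightarrow> nat \<Rightarrow> bool"
  where "heavy_arc s Y n k j \<longleftrightarrow> n \<le> k \<and> (1 / 2 ^ k) powr s \<le> norm (Y k j)"

text \<open>A Riemann sum of the Fourier integral over the maximal heavy arcs:
  \<open>real j / 2 ^ k\<close> is the left endpoint of the arc, and \<open>Y k j\<close> stands for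
  its measure.\<close>

definition heavy_arc_sum :: "real \<Rightarrow> (nat \<Rightarrow> nat \<Rightarrow> complex) \<Rightarrow> nat \<Rightarrow> int \<Rightarrow> complex"
  where "heavy_arc_sum s Y n m = (\<Sum>k. \<Sum>j<2 ^ k.
    if first_selected (heavy_arc s Y n) k j then Y k j * fourier_char m (to_circle (real j / 2 ^ k)) else 0)"

lemma norm_fourier_char_diff_left_endpoint:
  assumes "x \<in> dyadic_arc k j"
  shows "norm (fourier_char m (to_circle (real j / 2 ^ k)) - fourier_char m x) \<le> 2 * pi * \<bar>real_of_int m\<bar> / 2 ^ k"
proof -
  have "\<bar>real j / 2 ^ k - circle_coord x\<bar> \<le> 1 / 2 ^ k"
    using assms by (simp add: dyadic_arc_def dyadic_index_eq_iff add_divide_distrib)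
  then have "2 * pi * \<bar>real_of_int m\<bar> * \<bar>real j / 2 ^ k - circle_coord x\<bar> \<le> 2 * pi * \<bar>real_of_int m\<bar> * (1 / 2 ^ k)"
    by (intro mult_left_mono) auto
  then show ?thesis
    using fourier_char_lipschitz[of m "real j / 2 ^ k" "circle_coord x"] by simp
qed

text \<open>Of the two gaps, \<open>\<alpha> < s\<close> makes almost every point lie in heavy arcs,
  and \<open>s < \<beta>\<close> makes the noise a vanishing fraction \<open>r k\<close> of the
  threshold. Since selected arcs are disjoint, their errors add up to at most
  \<open>\<epsilon> n\<close> times the total mass of \<open>\<rho>\<close>, however many arcs there
  are.\<close>

lemma heavy_arc_sum_tendsto:
  assumes \<mu>: "complex_measure borel \<mu>"
    and dim: "cmeasure_dim \<mu> \<le> ennreal \<alpha>" and \<alpha>: "0 \<le> \<alpha>" "\<alpha> < s" "s < \<beta>"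
    and Y: "\<And>k j. k \<ge> k0 \<Longrightarrow> j < 2 ^ k \<Longrightarrow> norm (Y k j - \<mu> (dyadic_arc k j)) \<le> (1 / 2 ^ k) powr \<beta>"
  shows "(\<lambda>n. heavy_arc_sum s Y n m) \<longlonglongrightarrow> fourier_transform \<mu> m"
proof -
  let ?\<rho> = "dominating_measure borel \<mu>"
  let ?e = "fourier_char m"
  interpret \<rho>: finite_measure ?\<rho> by (rule finite_dominating_measure[OF \<mu>])
  have int: "integrable ?\<rho> f" if "f \<in> borel_measurable borel" "\<And>x. norm (f x) \<le> B" for f :: "circle \<Rightarrow> complex" and B
    using that by (intro \<rho>.integrable_const_bound[of _ B]) auto
  define r where "r n = (1 / 2 ^ n :: real) powr (\<beta> - s)" for n :: nat
  have r0: "r \<longlonglongrightarrow> 0"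
    unfolding r_def
  proof (rule tendsto_zero_powrI)
    show "(\<lambda>k. 1 / 2 ^ k :: real) \<longlonglongrightarrow> 0"
      using LIMSEQ_inverse_realpow_zero[of 2] by (simp add: inverse_eq_divide)
  qed (use \<alpha> in auto)
  have r_mono: "r k \<le> r n" if "n \<le> k" for n k
    unfolding r_def using that \<alpha> by (intro powr_mono2 divide_left_mono power_increasing) auto
  have r_mult: "(1 / 2 ^ k) powr \<beta> = r k * (1 / 2 ^ k) powr s" for k
    by (simp add: r_def powr_add[symmetric])
  \<comment> \<open>The first term is the relative noise on the selected arcs; the second is the
    change of the character across an arc, with the 4 of
    \<open>norm_cmeasure_integral_le\<close>.\<close>
  define \<epsilon> where "\<epsilon> n = 2 * r n + 4 * (2 * pi * \<bar>real_of_int m\<bar> * (1 / 2 ^ n))" for n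
  have \<epsilon>0: "\<epsilon> \<longlonglongrightarrow> 0"
  proof -
    have "(\<lambda>n. 1 / 2 ^ n :: real) \<longlonglongrightarrow> 0"
      using LIMSEQ_inverse_realpow_zero[of 2] by (simp add: inverse_eq_divide)
    then have "(\<lambda>n. 2 * r n + 4 * (2 * pi * \<bar>real_of_int m\<bar> * (1 / 2 ^ n))) \<longlonglongrightarrow> 2 * 0 + 4 * (2 * pi * \<bar>real_of_int m\<bar> * 0)"
      by (intro tendsto_intros r0)
    then show ?thesis by (simp add: \<epsilon>_def[abs_def])
  qed
  obtain n0 where n0: "\<And>n. n \<ge> n0 \<Longrightarrow> r n < 1 / 2"
    using order_tendstoD(2)[OF r0, of "1 / 2"] by (auto simp: eventually_sequentially)
  have main: "norm (heavy_arc_sum s Y n m - fourier_transform \<mu> m) \<le> \<epsilon> n * measure ?\<rho> UNIV"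
    if n: "n \<ge> n0" "n \<ge> k0" for n
  proof -
    define S where "S = heavy_arc s Y n"
    define G where "G = first_level S"
    define D where "D k = {j. j < 2 ^ k \<and> first_selected S k j}" for k
    have D: "finite (D k)" for k by (simp add: D_def)
    have G_arcs: "G k = (\<Union>j\<in>D k. dyadic_arc k j)" for k
      unfolding G_def D_def by (rule first_level_eq)
    have G_sets[measurable]: "G k \<in> sets borel" for k by (simp add: G_def)
    have disj: "disjoint_family G" unfolding G_def by (rule disjoint_first_level)
    have Dn: "k \<ge> n" "(1 / 2 ^ k) powr s \<le> norm (Y k j)" "j < 2 ^ k" if "j \<in> D k" for k j
      using that by (auto simp: D_def S_def first_selected_def heavy_arc_def)
    \<comment> \<open>On a selected arc the noise is less than half the threshold that the
      observation reaches. So the threshold is at most twice the norm of the true value, and the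
      absolute noise becomes noise relative to \<open>\<rho>\<close>.\<close>
    have small: "norm (Y k j - \<mu> (dyadic_arc k j)) \<le> 2 * r n * measure ?\<rho> (dyadic_arc k j)" if jD: "j \<in> D k" for k j
    proof -
      have k: "k \<ge> n" and j: "j < 2 ^ k" and big: "(1 / 2 ^ k) powr s \<le> norm (Y k j)" using Dn[OF jD] by auto
      have d: "norm (Y k j - \<mu> (dyadic_arc k j)) \<le> r k * (1 / 2 ^ k) powr s"
        using Y[of k j] k j n by (simp add: r_mult[symmetric])
      have "r k < 1 / 2" using n0[of k] k n by simp
      then have "r k * (1 / 2 ^ k) powr s \<le> 1 / 2 * (1 / 2 ^ k) powr s" by (intro mult_right_mono) auto
      moreover have "norm (Y k j) \<le> norm (Y k j - \<mu> (dyadic_arc k j)) + norm (\<mu> (dyadic_arc k j))"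
        by (metis diff_add_cancel norm_triangle_ineq)
      ultimately have "(1 / 2 ^ k) powr s \<le> 2 * norm (\<mu> (dyadic_arc k j))" using d big by linarith
      also have "\<dots> \<le> 2 * measure ?\<rho> (dyadic_arc k j)" using norm_complex_measure_le[OF \<mu>, of "dyadic_arc k j"] by simp
      finally have "r k * (1 / 2 ^ k) powr s \<le> r n * (2 * measure ?\<rho> (dyadic_arc k j))"
        using r_mono[OF k] by (intro mult_mono) (auto simp: r_def)
      with d show ?thesis by simp
    qed
    define A where "A k = (\<Sum>j\<in>D k. Y k j * ?e (to_circle (real j / 2 ^ k)))" for k
    have sum_A: "heavy_arc_sum s Y n m = (\<Sum>k. A k)"
    proof -
      have "(\<Sum>j<2 ^ k. if first_selected S k j then Y k j * ?e (to_circle (real j / 2 ^ k)) else 0) = A k" for k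
        unfolding A_def D_def by (subst sum.inter_filter[symmetric]) (auto intro!: sum.cong)
      then show ?thesis by (simp add: heavy_arc_sum_def S_def)
    qed
    define B where "B k = cmeasure_integral borel \<mu> (\<lambda>x. indicator (G k) x * ?e x)" for k
    have arc_meas: "measure ?\<rho> (G k) = (\<Sum>j\<in>D k. measure ?\<rho> (dyadic_arc k j))" for k
      unfolding G_arcs by (rule \<rho>.finite_measure_finite_Union) (auto simp: D intro: disjoint_dyadic_arc)
    have AB: "norm (A k - B k) \<le> \<epsilon> n * measure ?\<rho> (G k)" for k
    proof (cases "k \<ge> n")
      case False
      then have "D k = {}" using Dn(1) by force
      then have "A k = 0" "G k = {}" by (simp_all add: A_def G_arcs)
      then show ?thesis by (simp add: B_def cmeasure_integral_zero[OF \<mu>])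
    next
      case True
      define h where "h x = (\<Sum>j\<in>D k. ?e (to_circle (real j / 2 ^ k)) * indicator (dyadic_arc k j) x)" for x
      have ind: "indicator (G k) x = (\<Sum>j\<in>D k. indicator (dyadic_arc k j) x :: complex)" for x
        unfolding G_arcs by (rule indicator_UN_disjoint) (auto simp: D intro: disjoint_dyadic_arc)
      have hd: "norm (h x - indicator (G k) x * ?e x) \<le> 2 * pi * \<bar>real_of_int m\<bar> / 2 ^ k * indicator (G k) x" for x
      proof (cases "x \<in> G k")
        case True
        then obtain j where j: "j \<in> D k" "x \<in> dyadic_arc k j" by (auto simp: G_arcs)
        have "h x = (\<Sum>i\<in>D k. if i = j then ?e (to_circle (real i / 2 ^ k)) else 0)"
          unfolding h_def using j(2) by (intro sum.cong) (auto simp: dyadic_arc_def)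
        then have "h x = ?e (to_circle (real j / 2 ^ k))" using j(1) D by (simp add: sum.delta)
        then show ?thesis using True norm_fourier_char_diff_left_endpoint[OF j(2)] by simp
      next
        case False
        then have "h x = 0" unfolding h_def G_arcs by (auto intro!: sum.neutral)
        with False show ?thesis by simp
      qed
      have inth: "integrable ?\<rho> h" unfolding h_def
        by (intro Bochner_Integration.integrable_sum int[of _ 1]) (auto simp: norm_mult indicator_def)
      have intG: "integrable ?\<rho> (\<lambda>x. indicator (G k) x * ?e x)"
        by (intro int[of _ 1]) (auto simp: norm_mult indicator_def)
      have "cmeasure_integral borel \<mu> h = (\<Sum>j\<in>D k. ?e (to_circle (real j / 2 ^ k)) * \<mu> (dyadic_arc k j))"
      proof -
        have i1: "integrable ?\<rho> (indicator (dyadic_arc k j) :: _ \<Rightarrow> complex)" for j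
          by (intro int[of _ 1]) (auto simp: indicator_def)
        have "cmeasure_integral borel \<mu> h = (\<Sum>j\<in>D k. cmeasure_integral borel \<mu> (\<lambda>x. ?e (to_circle (real j / 2 ^ k)) * indicator (dyadic_arc k j) x))"
          unfolding h_def[abs_def] by (intro cmeasure_integral_sum[OF \<mu>] integrable_mult_right i1)
        then show ?thesis
          by (simp add: cmeasure_integral_cmult[OF \<mu> i1] cmeasure_integral_indicator[OF \<mu>])
      qed
      then have "A k - B k = (\<Sum>j\<in>D k. (Y k j - \<mu> (dyadic_arc k j)) * ?e (to_circle (real j / 2 ^ k)))
          + cmeasure_integral borel \<mu> (\<lambda>x. h x - indicator (G k) x * ?e x)"
        unfolding A_def B_def cmeasure_integral_diff[OF \<mu> inth intG]
        by (simp add: left_diff_distrib sum_subtractf mult.commute)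
      then have "norm (A k - B k) \<le> norm (\<Sum>j\<in>D k. (Y k j - \<mu> (dyadic_arc k j)) * ?e (to_circle (real j / 2 ^ k)))
          + norm (cmeasure_integral borel \<mu> (\<lambda>x. h x - indicator (G k) x * ?e x))"
        by (simp add: norm_triangle_ineq)
      also have "norm (\<Sum>j\<in>D k. (Y k j - \<mu> (dyadic_arc k j)) * ?e (to_circle (real j / 2 ^ k))) \<le> (\<Sum>j\<in>D k. 2 * r n * measure ?\<rho> (dyadic_arc k j))"
        by (rule order_trans[OF norm_sum sum_mono]) (simp add: norm_mult small)
      also have "\<dots> = 2 * r n * measure ?\<rho> (G k)" by (simp add: arc_meas sum_distrib_left)
      also have "norm (cmeasure_integral borel \<mu> (\<lambda>x. h x - indicator (G k) x * ?e x)) \<le> 4 * (\<integral>x. norm (h x - indicator (G k) x * ?e x) \<partial>?\<rho>)"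
        by (rule norm_cmeasure_integral_le[OF \<mu> Bochner_Integration.integrable_diff[OF inth intG]])
      also have "(\<integral>x. norm (h x - indicator (G k) x * ?e x) \<partial>?\<rho>) \<le> (\<integral>x. 2 * pi * \<bar>real_of_int m\<bar> / 2 ^ k * indicator (G k) x \<partial>?\<rho>)"
        by (intro integral_mono hd integrable_norm Bochner_Integration.integrable_diff inth intG integrable_mult_right)
          (auto simp: \<rho>.emeasure_eq_measure)
      also have "\<dots> = 2 * pi * \<bar>real_of_int m\<bar> / 2 ^ k * measure ?\<rho> (G k)" by simp
      also have "\<dots> \<le> 2 * pi * \<bar>real_of_int m\<bar> * (1 / 2 ^ n) * measure ?\<rho> (G k)"
      proof -
        have "1 / 2 ^ k \<le> (1 / 2 ^ n :: real)" using True by (intro divide_left_mono power_increasing) auto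
        then have "2 * pi * \<bar>real_of_int m\<bar> * (1 / 2 ^ k) \<le> 2 * pi * \<bar>real_of_int m\<bar> * (1 / 2 ^ n)"
          by (intro mult_left_mono) auto
        then show ?thesis by (intro mult_right_mono) auto
      qed
      finally show ?thesis by (simp add: \<epsilon>_def algebra_simps)
    qed
    have Gsums: "(\<lambda>k. measure ?\<rho> (G k)) sums measure ?\<rho> (\<Union>k. G k)"
      using disj by (intro \<rho>.finite_measure_UNION) auto
    \<comment> \<open>A true value above twice the threshold remains above the threshold after
      noise, so the arcs of \<open>AE_heavy_arcs\<close> are selected.\<close>
    have Gfull: "AE x in ?\<rho>. x \<in> (\<Union>k. G k)"
      using AE_heavy_arcs[OF \<mu> dim \<alpha>(1,2), of n]
    proof eventually_elim
      case (elim x)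
      then obtain k where k: "k \<ge> n" "2 * (1 / 2 ^ k) powr s < norm (\<mu> (dyadic_arc k (dyadic_index k x)))" by blast
      let ?j = "dyadic_index k x"
      have "norm (Y k ?j - \<mu> (dyadic_arc k ?j)) \<le> r k * (1 / 2 ^ k) powr s"
        using Y[of k ?j] k n dyadic_index_less by (simp add: r_mult[symmetric])
      also have "\<dots> \<le> 1 * (1 / 2 ^ k) powr s" using n0[of k] k n by (intro mult_right_mono) auto
      finally have "norm (Y k ?j - \<mu> (dyadic_arc k ?j)) \<le> (1 / 2 ^ k) powr s" by simp
      moreover have "norm (\<mu> (dyadic_arc k ?j)) \<le> norm (Y k ?j - \<mu> (dyadic_arc k ?j)) + norm (Y k ?j)"
        by (metis norm_minus_commute norm_triangle_sub add.commute)
      ultimately have "(1 / 2 ^ k) powr s \<le> norm (Y k ?j)" using k(2) by linarith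
      then have "S k ?j" using k by (simp add: S_def heavy_arc_def)
      then show ?case unfolding G_def UN_first_level by blast
    qed
    \<comment> \<open>The sets \<open>G k\<close> carry almost all of \<open>\<rho>\<close>, so a
      partial sum misses the Fourier coefficient only by an integral over the remaining levels
      \<open>R K\<close>, whose measure tends to 0.\<close>
    have Bsums: "B sums fourier_transform \<mu> m"
      unfolding sums_def
    proof (rule LIM_zero_cancel, rule Lim_null_comparison)
      define R where "R K = (\<Union>k. G k) - (\<Union>k<K. G k)" for K :: nat
      have [measurable]: "R K \<in> sets borel" for K unfolding R_def by measurable
      have intR: "integrable ?\<rho> (\<lambda>x. indicator (G k) x * ?e x)" for k
        by (intro int[of _ 1]) (auto simp: norm_mult indicator_def)
      have inte: "integrable ?\<rho> ?e" by (intro int[of _ 1]) auto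
      show "eventually (\<lambda>K. norm ((\<Sum>k<K. B k) - fourier_transform \<mu> m) \<le> 4 * (measure ?\<rho> (\<Union>k. G k) - (\<Sum>k<K. measure ?\<rho> (G k)))) sequentially"
      proof (intro always_eventually allI)
        fix K
        have eq: "(\<Sum>k<K. B k) - fourier_transform \<mu> m = cmeasure_integral borel \<mu> (\<lambda>x. (\<Sum>k<K. indicator (G k) x * ?e x) - ?e x)"
          unfolding B_def fourier_transform_def cmeasure_integral_sum[OF \<mu> intR, symmetric]
          by (rule cmeasure_integral_diff[OF \<mu> Bochner_Integration.integrable_sum[OF intR] inte, symmetric])
        have "norm ((\<Sum>k<K. B k) - fourier_transform \<mu> m) \<le> 4 * (\<integral>x. norm ((\<Sum>k<K. indicator (G k) x * ?e x) - ?e x) \<partial>?\<rho>)"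
          unfolding eq
          by (rule norm_cmeasure_integral_le[OF \<mu> Bochner_Integration.integrable_diff[OF Bochner_Integration.integrable_sum[OF intR] inte]])
        also have "(\<integral>x. norm ((\<Sum>k<K. indicator (G k) x * ?e x) - ?e x) \<partial>?\<rho>) = (\<integral>x. indicator (R K) x \<partial>?\<rho>)"
        proof (rule integral_cong_AE)
          show "AE x in ?\<rho>. norm ((\<Sum>k<K. indicator (G k) x * ?e x) - ?e x) = indicator (R K) x"
            using Gfull
          proof eventually_elim
            case (elim x)
            have "(\<Sum>k<K. indicator (G k) x * ?e x) = indicator (\<Union>k<K. G k) x * ?e x"
              unfolding sum_distrib_right[symmetric]
              by (subst indicator_UN_disjoint[OF _ disjoint_family_on_mono[OF subset_UNIV disj]]) simp_all
            then show ?case using elim by (cases "x \<in> (\<Union>k<K. G k)") (auto simp: R_def)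
          qed
        qed measurable
        also have "\<dots> = measure ?\<rho> (R K)" by simp
        also have "\<dots> = measure ?\<rho> (\<Union>k. G k) - measure ?\<rho> (\<Union>k<K. G k)"
          unfolding R_def by (intro \<rho>.finite_measure_Diff) auto
        also have "measure ?\<rho> (\<Union>k<K. G k) = (\<Sum>k<K. measure ?\<rho> (G k))"
          using disjoint_family_on_mono[OF subset_UNIV disj] by (intro \<rho>.finite_measure_finite_Union) auto
        finally show "norm ((\<Sum>k<K. B k) - fourier_transform \<mu> m) \<le> 4 * (measure ?\<rho> (\<Union>k. G k) - (\<Sum>k<K. measure ?\<rho> (G k)))" by simp
      qed
      have "(\<lambda>K. 4 * (measure ?\<rho> (\<Union>k. G k) - (\<Sum>k<K. measure ?\<rho> (G k)))) \<longlonglongrightarrow> 4 * (measure ?\<rho> (\<Union>k. G k) - measure ?\<rho> (\<Union>k. G k))"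
        using Gsums unfolding sums_def by (intro tendsto_intros)
      then show "(\<lambda>K. 4 * (measure ?\<rho> (\<Union>k. G k) - (\<Sum>k<K. measure ?\<rho> (G k)))) \<longlonglongrightarrow> 0" by simp
    qed
    have \<epsilon>nn: "0 \<le> \<epsilon> n" by (auto simp: \<epsilon>_def r_def intro!: add_nonneg_nonneg mult_nonneg_nonneg)
    have bsum: "summable (\<lambda>k. \<epsilon> n * measure ?\<rho> (G k))" using Gsums by (intro summable_mult sums_summable)
    have dsum: "summable (\<lambda>k. A k - B k)"
      by (rule summable_comparison_test'[OF bsum, of 0]) (rule AB)
    have "heavy_arc_sum s Y n m - fourier_transform \<mu> m = (\<Sum>k. A k - B k)"
    proof -
      have "summable (\<lambda>k. (A k - B k) + B k)" using dsum sums_summable[OF Bsums] by (rule summable_add)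
      then have "(\<Sum>k. A k - B k) = (\<Sum>k. A k) - (\<Sum>k. B k)"
        using sums_summable[OF Bsums] by (intro suminf_diff[symmetric]) auto
      then show ?thesis using sums_unique[OF Bsums] by (simp add: sum_A)
    qed
    also have "norm \<dots> \<le> (\<Sum>k. \<epsilon> n * measure ?\<rho> (G k))"
      by (rule norm_suminf_le[OF AB bsum])
    also have "\<dots> = \<epsilon> n * measure ?\<rho> (\<Union>k. G k)"
      using sums_unique[OF sums_mult[OF Gsums, of "\<epsilon> n"]] by simp
    also have "\<dots> \<le> \<epsilon> n * measure ?\<rho> UNIV"
      using \<epsilon>nn by (intro mult_left_mono \<rho>.finite_measure_mono) auto
    finally show ?thesis .
  qed
  have "(\<lambda>n. heavy_arc_sum s Y n m - fourier_transform \<mu> m) \<longlonglongrightarrow> 0"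
  proof (rule Lim_null_comparison)
    show "eventually (\<lambda>n. norm (heavy_arc_sum s Y n m - fourier_transform \<mu> m) \<le> \<epsilon> n * measure ?\<rho> UNIV) sequentially"
      using main by (intro eventually_sequentiallyI[of "max n0 k0"]) auto
    show "(\<lambda>n. \<epsilon> n * measure ?\<rho> UNIV) \<longlonglongrightarrow> 0"
      using tendsto_mult_right[OF \<epsilon>0, of "measure ?\<rho> UNIV"] by simp
  qed
  then show ?thesis by (rule LIM_zero_cancel)
qed

definition recovery_map :: "real \<Rightarrow> (int \<Rightarrow> complex) \<Rightarrow> int \<Rightarrow> complex"
  where "recovery_map s y m = lim (\<lambda>n. heavy_arc_sum s (\<lambda>k j. arc_value k j y) n m)"

lemma measurable_recovery_map: "recovery_map s \<in> borel \<rightarrow>\<^sub>M borel"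
proof (rule measurable_coordinatewise_then_product)
  fix m
  have [measurable]: "Measurable.pred borel (\<lambda>y. heavy_arc s (\<lambda>k j. arc_value k j y) n k j)" for n k j
    unfolding heavy_arc_def by measurable
  have [measurable]: "Measurable.pred borel (\<lambda>y. first_selected (heavy_arc s (\<lambda>k j. arc_value k j y) n) k j)" for n k j
    unfolding first_selected_def by measurable
  show "(\<lambda>y. recovery_map s y m) \<in> borel_measurable borel"
    unfolding recovery_map_def heavy_arc_sum_def by measurable
qed

lemma (in complex_gaussian) admits_recovery_fourier_space:
  assumes \<alpha>: "0 \<le> \<alpha>" "\<alpha> < 1 / 2"
  shows "admits_recovery P \<xi> (fourier_space \<alpha>)"
proof -
  \<comment> \<open>\<open>s\<close> and \<open>\<beta>\<close> cut the interval from
    \<open>\<alpha>\<close> to 1/2 into three equal parts. They depend on \<open>\<alpha>\<close>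
    only, because one map has to serve all measures.\<close>
  define s where "s = (2 * \<alpha> + 1 / 2) / 3"
  define \<beta> where "\<beta> = (\<alpha> + 1) / 3"
  have ord: "\<alpha> < s" "s < \<beta>" "\<beta> < 1 / 2" using \<alpha> by (auto simp: s_def \<beta>_def)
  have "AE \<omega> in P. recovery_map s (\<lambda>n. x n + \<xi> n \<omega>) = x" if x: "x \<in> fourier_space \<alpha>" for x
  proof -
    obtain \<mu> where \<mu>: "complex_measure borel \<mu>" "cmeasure_dim \<mu> \<le> ennreal \<alpha>" "x = fourier_transform \<mu>"
      using x by (auto simp: fourier_space_def)
    have conv: "AE \<omega> in P. \<forall>k\<in>{1..}. \<forall>j. convergent (\<lambda>l. arc_estimate k j l (\<lambda>n. \<xi> n \<omega>))"
      by (intro AE_ball_countable' AE_all_countable[THEN iffD2] allI AE_arc_estimate_convergent) auto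
    show ?thesis
      using conv AE_noise_on_arcs_small[OF ord(3)]
    proof eventually_elim
      case (elim \<omega>)
      then obtain k0 where k0: "\<And>k j. k \<ge> k0 \<Longrightarrow> j < 2 ^ k \<Longrightarrow> norm (arc_value k j (\<lambda>n. \<xi> n \<omega>)) \<le> (1 / 2 ^ k) powr \<beta>"
        by blast
      have val: "arc_value k j (\<lambda>n. x n + \<xi> n \<omega>) = \<mu> (dyadic_arc k j) + arc_value k j (\<lambda>n. \<xi> n \<omega>)" if k: "k \<ge> 1" for k j
      proof -
        have "(\<lambda>l. arc_estimate k j l (\<lambda>n. \<xi> n \<omega>)) \<longlonglongrightarrow> arc_value k j (\<lambda>n. \<xi> n \<omega>)"
          using elim(1) k unfolding arc_value_def by (simp add: convergent_LIMSEQ_iff)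
        from tendsto_add[OF arc_estimate_tendsto[OF k \<mu>(1), of j] this]
        show ?thesis
          unfolding \<mu>(3) arc_value_def[of k j "\<lambda>n. fourier_transform \<mu> n + \<xi> n \<omega>"] arc_estimate_add by (rule limI)
      qed
      have "(\<lambda>n. heavy_arc_sum s (\<lambda>k j. arc_value k j (\<lambda>n. x n + \<xi> n \<omega>)) n m) \<longlonglongrightarrow> x m" for m
        unfolding \<mu>(3)
      proof (rule heavy_arc_sum_tendsto[OF \<mu>(1,2) \<alpha>(1) ord(1,2)])
        fix k j assume "max 1 k0 \<le> k" "j < (2::nat) ^ k"
        then show "norm (arc_value k j (\<lambda>n. fourier_transform \<mu> n + \<xi> n \<omega>) - \<mu> (dyadic_arc k j)) \<le> (1 / 2 ^ k) powr \<beta>"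
          using val[of k j] k0[of k j] unfolding \<mu>(3) by simp
      qed
      then show ?case by (auto simp: recovery_map_def fun_eq_iff intro: limI)
    qed
  qed
  then show ?thesis
    unfolding admits_recovery_def using measurable_recovery_map by blast
qed

section \<open>Random Cantor sets\<close>

locale random_cantor =
  fixes N M :: nat
  assumes M: "2 \<le> M" and NM: "M < N"
begin

lemma N_pos [simp]: "0 < N" and M_pos [simp]: "0 < M"
  using M NM by auto

text \<open>Cells of level \<open>k\<close> are numbered from left to right in the grid of mesh \<open>1 / (N * M) ^ k\<close>. Each
  of the \<open>N\<close> slots of a cell contains \<open>M\<close> subcells, one of which is kept, as prescribed by \<open>c\<close>;
  the \<open>N ^ k\<close> kept cells of level \<open>k\<close> are indexed by \<open>i\<close>.\<close>

fun cell :: "nat \<Rightarrow> (nat \<times> nat \<Rightarrow> nat) \<Rightarrow> nat \<Rightarrow> nat" where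
  "cell 0 c i = 0"
| "cell (Suc k) c i = (cell k c (i div N) * N + i mod N) * M
    + c (k, cell k c (i div N) * N + i mod N) mod M"

abbreviation slot :: "nat \<Rightarrow> (nat \<times> nat \<Rightarrow> nat) \<Rightarrow> nat \<Rightarrow> nat"
  where "slot k c i \<equiv> cell k c (i div N) * N + i mod N"

lemma cell_Suc_div: "cell (Suc k) c i div M = slot k c i"
  by simp

lemma cell_Suc_mod: "cell (Suc k) c i mod M = c (k, slot k c i) mod M"
  by simp

lemma slot_div: "slot k c i div N = cell k c (i div N)" and slot_mod: "slot k c i mod N = i mod N"
  by simp_all

text \<open>Division by \<open>M\<close> and reduction modulo \<open>N\<close> read the slot digits
  of the index back from a cell number, whatever the choices. Hence two Cantor sets can share a cell
  only under one and the same index, and common cells may be counted by indices.\<close>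

lemma cell_eq_imp:
  assumes "cell k c i = cell k c' i'" "i < N ^ k" "i' < N ^ k"
  shows "i = i'"
  using assms
proof (induct k arbitrary: i i')
  case (Suc k)
  have s: "slot k c i = slot k c' i'"
    using Suc.prems(1) cell_Suc_div by metis
  then have "cell k c (i div N) = cell k c' (i' div N)" "i mod N = i' mod N"
    using slot_div slot_mod by metis+
  moreover have "i div N < N ^ k" "i' div N < N ^ k"
    using Suc.prems by (simp_all add: less_mult_imp_div_less mult.commute)
  ultimately show ?case
    using Suc.hyps by (metis div_mult_mod_eq)
qed simp

text \<open>The branching rule for common cells. The slot on the right is written with
  \<open>c'\<close> for both choices, so that for fixed \<open>c'\<close> it names a nonrandom
  coordinate of \<open>c\<close>.\<close>

lemma cell_Suc_eq_iff:
  assumes "i < N ^ Suc k"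
  shows "cell (Suc k) c i = cell (Suc k) c' i \<longleftrightarrow>
    cell k c (i div N) = cell k c' (i div N) \<and> c (k, slot k c' i) mod M = c' (k, slot k c' i) mod M"
proof
  assume eq: "cell (Suc k) c i = cell (Suc k) c' i"
  then have s: "slot k c i = slot k c' i" using cell_Suc_div by metis
  then have "cell k c (i div N) = cell k c' (i div N)" using N_pos by simp
  moreover have "c (k, slot k c' i) mod M = c' (k, slot k c' i) mod M"
    using eq cell_Suc_mod s by metis
  ultimately show "cell k c (i div N) = cell k c' (i div N) \<and> c (k, slot k c' i) mod M = c' (k, slot k c' i) mod M" ..
qed simp

lemma slot_inj:
  assumes "i < N ^ Suc k" "i' < N ^ Suc k" "slot k c i = slot k c i'"
  shows "i = i'"
proof (rule cell_eq_imp[OF _ assms(1,2)])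
  show "cell (Suc k) c i = cell (Suc k) c i'" by (simp only: cell.simps assms(3))
qed

lemma cell_less: "i < N ^ k \<Longrightarrow> cell k c i < (N * M) ^ k"
proof (induct k arbitrary: i)
  case (Suc k)
  have "i div N < N ^ k" using Suc.prems by (simp add: less_mult_imp_div_less mult.commute)
  then have "cell k c (i div N) < (N * M) ^ k" by (rule Suc.hyps)
  then have "Suc (cell k c (i div N)) \<le> (N * M) ^ k" by simp
  then have "Suc (cell k c (i div N)) * (N * M) \<le> (N * M) ^ k * (N * M)" by (rule mult_le_mono1)
  moreover have "cell (Suc k) c i < Suc (cell k c (i div N)) * (N * M)"
  proof -
    have "Suc (slot k c i) \<le> Suc (cell k c (i div N)) * N"
      using mod_less_divisor[of N i] by (simp add: Suc_le_eq)
    then have "Suc (slot k c i) * M \<le> Suc (cell k c (i div N)) * N * M" by (rule mult_le_mono1)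
    moreover have "cell (Suc k) c i < Suc (slot k c i) * M"
      using mod_less_divisor[of M "c (k, slot k c i)"] by simp
    ultimately show ?thesis by (simp only: mult.assoc)
  qed
  ultimately show ?case by (simp only: power_Suc mult.commute[of "N * M"])
qed simp

lemma slot_less: "i < N ^ Suc k \<Longrightarrow> slot k c i < (N * M) ^ k * N"
proof -
  assume "i < N ^ Suc k"
  then have "i div N < N ^ k" by (simp add: less_mult_imp_div_less mult.commute)
  then have "Suc (cell k c (i div N)) * N \<le> (N * M) ^ k * N"
    using cell_less by (intro mult_le_mono1) (simp add: Suc_le_eq)
  moreover have "slot k c i < Suc (cell k c (i div N)) * N"
    using mod_less_divisor[of N i] by simp
  ultimately show ?thesis by (simp only: less_le_trans)
qed

text \<open>Cells of level \<open>k\<close> read finitely many choices, all of lower levels; this is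
  what makes them independent of the choices made at level \<open>k\<close>.\<close>

lemma cell_cong:
  assumes "\<And>l q. l < k \<Longrightarrow> q < (N * M) ^ l * N \<Longrightarrow> c (l, q) = c' (l, q)" "i < N ^ k"
  shows "cell k c i = cell k c' i"
  using assms
proof (induct k arbitrary: i)
  case (Suc k)
  have i: "i div N < N ^ k" using Suc.prems(2) by (simp add: less_mult_imp_div_less mult.commute)
  have eq: "cell k c (i div N) = cell k c' (i div N)"
    by (rule Suc.hyps) (use Suc.prems(1) i in auto)
  have "c (k, slot k c' i) = c' (k, slot k c' i)"
    using slot_less[OF Suc.prems(2)] by (intro Suc.prems(1)) auto
  then show ?case by (simp add: eq)
qed simp

lemma cell_Suc_bounds:
  "cell k c (i div N) * (N * M) \<le> cell (Suc k) c i"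
  "cell (Suc k) c i + 1 \<le> (cell k c (i div N) + 1) * (N * M)"
proof -
  show "cell k c (i div N) * (N * M) \<le> cell (Suc k) c i"
    by (simp add: algebra_simps)
  have "Suc (slot k c i) \<le> Suc (cell k c (i div N)) * N"
    using mod_less_divisor[of N i] by (simp add: Suc_le_eq)
  then have "Suc (slot k c i) * M \<le> Suc (cell k c (i div N)) * N * M" by (rule mult_le_mono1)
  moreover have "cell (Suc k) c i < Suc (slot k c i) * M"
    using mod_less_divisor[of M "c (k, slot k c i)"] by simp
  ultimately show "cell (Suc k) c i + 1 \<le> (cell k c (i div N) + 1) * (N * M)"
    by (simp only: mult.assoc Suc_eq_plus1[symmetric] Suc_le_eq)
qed

text \<open>The number formed by the first \<open>k\<close> base \<open>N\<close> digits of
  \<open>u\<close>: for uniform \<open>u\<close> a uniformly distributed kept cell, consistently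
  over the levels.\<close>

definition kept :: "nat \<Rightarrow> real \<Rightarrow> nat"
  where "kept k u = nat \<lfloor>real N ^ k * u\<rfloor>"

lemma kept_less:
  assumes "0 \<le> u" "u < 1"
  shows "kept k u < N ^ k"
proof -
  have "real N ^ k * u < real N ^ k" using assms by simp
  then have "\<lfloor>real N ^ k * u\<rfloor> < int (N ^ k)" by (simp add: floor_less_iff)
  then show ?thesis unfolding kept_def by (subst nat_less_iff) (use assms in auto)
qed

lemma kept_div:
  assumes "0 \<le> u"
  shows "kept (Suc k) u div N = kept k u"
proof -
  have "\<lfloor>real N ^ k * u\<rfloor> = \<lfloor>real N ^ Suc k * u / real_of_int (int N)\<rfloor>"
    by (simp add: mult.assoc)
  also have "\<dots> = \<lfloor>real N ^ Suc k * u\<rfloor> div int N"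
    by (rule floor_divide_real_eq_div) simp
  finally show ?thesis
    unfolding kept_def using assms by (simp add: nat_div_distrib)
qed

definition approx_point :: "(nat \<times> nat \<Rightarrow> nat) \<Rightarrow> nat \<Rightarrow> real \<Rightarrow> real"
  where "approx_point c k u = real (cell k c (kept k u)) / real (N * M) ^ k"

text \<open>Nesting of the cells around \<open>u\<close>: left endpoints increase and right
  endpoints decrease, so the left endpoints converge and their limit lies in every closed
  cell.\<close>

lemma approx_point_Suc:
  assumes "0 \<le> u"
  shows "approx_point c k u \<le> approx_point c (Suc k) u"
    "approx_point c (Suc k) u + 1 / real (N * M) ^ Suc k \<le> approx_point c k u + 1 / real (N * M) ^ k"
proof -
  let ?b = "real (N * M)"
  have b: "?b > 0" by (simp only: of_nat_0_less_iff nat_0_less_mult_iff N_pos M_pos)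
  have "real (cell k c (kept k u)) * ?b \<le> real (cell (Suc k) c (kept (Suc k) u))"
    using cell_Suc_bounds(1)[of k c "kept (Suc k) u"] unfolding kept_div[OF assms]
    by (simp only: of_nat_mult[symmetric] of_nat_le_iff)
  then have "real (cell k c (kept k u)) * ?b / ?b ^ Suc k \<le> real (cell (Suc k) c (kept (Suc k) u)) / ?b ^ Suc k"
    using b by (intro divide_right_mono) auto
  then show "approx_point c k u \<le> approx_point c (Suc k) u"
    unfolding approx_point_def using b by (simp del: of_nat_mult cell.simps)
  have "real (cell (Suc k) c (kept (Suc k) u)) + 1 \<le> (real (cell k c (kept k u)) + 1) * ?b"
    using cell_Suc_bounds(2)[of k c "kept (Suc k) u"] unfolding kept_div[OF assms]
    by (metis (no_types, lifting) of_nat_1 of_nat_add of_nat_le_iff of_nat_mult)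
  then have "(real (cell (Suc k) c (kept (Suc k) u)) + 1) / ?b ^ Suc k \<le> (real (cell k c (kept k u)) + 1) * ?b / ?b ^ Suc k"
    using b by (intro divide_right_mono) auto
  then show "approx_point c (Suc k) u + 1 / ?b ^ Suc k \<le> approx_point c k u + 1 / ?b ^ k"
    unfolding approx_point_def using b by (simp add: add_divide_distrib del: of_nat_mult cell.simps)
qed

definition cantor_point :: "(nat \<times> nat \<Rightarrow> nat) \<Rightarrow> real \<Rightarrow> real"
  where "cantor_point c u = lim (\<lambda>k. approx_point c k u)"

lemma cantor_point_props:
  assumes "0 \<le> u"
  shows "(\<lambda>k. approx_point c k u) \<longlonglongrightarrow> cantor_point c u"
    "approx_point c k u \<le> cantor_point c u" "cantor_point c u \<le> approx_point c k u + 1 / real (N * M) ^ k"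
proof -
  let ?b = "real (N * M)"
  have inc: "incseq (\<lambda>k. approx_point c k u)" by (intro incseq_SucI approx_point_Suc(1) assms)
  have dec: "decseq (\<lambda>k. approx_point c k u + 1 / ?b ^ k)" by (intro decseq_SucI approx_point_Suc(2) assms)
  have pos: "0 \<le> 1 / ?b ^ k" for k by simp
  have "approx_point c k u \<le> approx_point c 0 u + 1 / ?b ^ 0" for k
    using decseqD[OF dec, of 0 k] pos[of k] by linarith
  then obtain L where L: "(\<lambda>k. approx_point c k u) \<longlonglongrightarrow> L" "\<forall>k. approx_point c k u \<le> L"
    using incseq_convergent[OF inc] by blast
  have eq: "cantor_point c u = L" unfolding cantor_point_def by (rule limI[OF L(1)])
  show "(\<lambda>k. approx_point c k u) \<longlonglongrightarrow> cantor_point c u" "approx_point c k u \<le> cantor_point c u"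
    using L by (auto simp: eq)
  have "approx_point c m u \<le> approx_point c k u + 1 / ?b ^ k" if "m \<ge> k" for m
    using decseqD[OF dec that] pos[of m] by linarith
  then show "cantor_point c u \<le> approx_point c k u + 1 / ?b ^ k"
    unfolding eq by (intro LIMSEQ_le_const2[OF L(1)]) blast
qed

end

context random_cantor
begin

lemma N_nonzero [simp]: "N \<noteq> 0" and M_nonzero [simp]: "M \<noteq> 0"
  using M NM by auto

abbreviation unif :: "real measure"
  where "unif \<equiv> restrict_space lborel {0..<1}"

lemma prob_space_unif: "prob_space unif"
  by (auto intro!: prob_spaceI simp: emeasure_restrict_space)

lemma mesh_pos: "0 < real (N * M)"
  by (simp only: of_nat_0_less_iff nat_0_less_mult_iff N_pos M_pos)

lemma measurable_kept [measurable]: "kept k \<in> unif \<rightarrow>\<^sub>M count_space UNIV"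
proof -
  have "kept k \<in> borel \<rightarrow>\<^sub>M count_space UNIV" unfolding kept_def[abs_def] by measurable
  then show ?thesis by (intro measurable_restrict_space1) simp
qed

lemma measurable_approx_point [measurable]: "approx_point c k \<in> borel_measurable unif"
  unfolding approx_point_def[abs_def] by measurable

lemma measurable_cantor_point [measurable]: "cantor_point c \<in> borel_measurable unif"
  unfolding cantor_point_def[abs_def] by measurable

lemma measure_kept_eq:
  assumes "i < N ^ k"
  shows "measure unif {u \<in> space unif. kept k u = i} = 1 / real N ^ k"
proof -
  have Nk: "real N ^ k > 0" by simp
  have i: "real i + 1 \<le> real N ^ k"
  proof -
    have "real (Suc i) \<le> real (N ^ k)" using assms by (simp only: of_nat_le_iff Suc_le_eq)
    then show ?thesis by simp
  qed
  have kept_iff: "kept k u = i \<longleftrightarrow> real i / real N ^ k \<le> u \<and> u < (real i + 1) / real N ^ k" if "0 \<le> u" for u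
  proof -
    have "kept k u = i \<longleftrightarrow> \<lfloor>real N ^ k * u\<rfloor> = int i"
      unfolding kept_def using that by (auto simp: nat_eq_iff)
    then show ?thesis using Nk by (simp add: floor_eq_iff pos_divide_le_eq pos_less_divide_eq mult.commute)
  qed
  have "{u \<in> space unif. kept k u = i} = {real i / real N ^ k ..< (real i + 1) / real N ^ k}"
  proof (intro set_eqI iffI)
    fix u assume "u \<in> {u \<in> space unif. kept k u = i}"
    then show "u \<in> {real i / real N ^ k ..< (real i + 1) / real N ^ k}"
      using kept_iff[of u] by (simp add: space_restrict_space)
  next
    fix u assume u: "u \<in> {real i / real N ^ k ..< (real i + 1) / real N ^ k}"
    moreover have "0 \<le> real i / real N ^ k" by simp
    moreover have "(real i + 1) / real N ^ k \<le> 1" using i Nk by (simp add: pos_divide_le_eq)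
    ultimately have "0 \<le> u" "u < 1" unfolding atLeastLessThan_iff by linarith+
    then show "u \<in> {u \<in> space unif. kept k u = i}"
      using kept_iff[of u] u by (simp add: space_restrict_space)
  qed
  note eq = this
  have "{real i / real N ^ k ..< (real i + 1) / real N ^ k} \<subseteq> {0..<1}"
    unfolding eq[symmetric] by (auto simp: space_restrict_space)
  then have "measure unif {real i / real N ^ k ..< (real i + 1) / real N ^ k} = measure lborel {real i / real N ^ k ..< (real i + 1) / real N ^ k}"
    by (intro measure_restrict_space) auto
  also have "\<dots> = (real i + 1) / real N ^ k - real i / real N ^ k"
    by (rule measure_lborel_Ico) (rule divide_right_mono, simp_all)
  finally show ?thesis unfolding eq by (simp add: add_divide_distrib)
qed

lemma integral_kept:
  fixes f :: "nat \<Rightarrow> complex"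
  shows "(\<integral>u. f (kept k u) \<partial>unif) = (\<Sum>i<N ^ k. f i) / of_nat N ^ k"
proof -
  interpret prob_space unif by (rule prob_space_unif)
  have "(\<integral>u. f (kept k u) \<partial>unif) = (\<integral>u. (\<Sum>i<N ^ k. f i * of_real (indicator {u \<in> space unif. kept k u = i} u)) \<partial>unif)"
  proof (rule Bochner_Integration.integral_cong[OF refl])
    fix u assume u: "u \<in> space unif"
    then have "kept k u < N ^ k" by (intro kept_less) (auto simp: space_restrict_space)
    moreover have "(\<Sum>i<N ^ k. f i * of_real (indicator {u \<in> space unif. kept k u = i} u)) = (\<Sum>i<N ^ k. if i = kept k u then f i else 0)"
      using u by (intro sum.cong) (auto simp: indicator_def)
    ultimately show "f (kept k u) = (\<Sum>i<N ^ k. f i * of_real (indicator {u \<in> space unif. kept k u = i} u))"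
      by (simp add: sum.delta)
  qed
  also have "\<dots> = (\<Sum>i<N ^ k. f i * of_real (measure unif {u \<in> space unif. kept k u = i}))"
  proof -
    have int: "integrable unif (\<lambda>u. complex_of_real (indicator {u \<in> space unif. kept k u = i} u))" for i
    proof (rule integrable_const_bound[of _ 1])
      show "(\<lambda>u. complex_of_real (indicator {u \<in> space unif. kept k u = i} u)) \<in> borel_measurable unif" by measurable
    qed (auto simp: indicator_def)
    have "(\<integral>u. complex_of_real (indicator {u \<in> space unif. kept k u = i} u) \<partial>unif) = of_real (measure unif {u \<in> space unif. kept k u = i})" for i
    proof -
      have "{u \<in> space unif. kept k u = i} \<inter> space unif = {u \<in> space unif. kept k u = i}" by blast
      then show ?thesis by (simp only: integral_complex_of_real Bochner_Integration.integral_indicator)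
    qed
    then show ?thesis using int by (subst Bochner_Integration.integral_sum) (simp_all add: integrable_mult_right)
  qed
  also have "\<dots> = (\<Sum>i<N ^ k. f i) / of_nat N ^ k"
  proof -
    have "f i * of_real (measure unif {u \<in> space unif. kept k u = i}) = f i / of_nat N ^ k" if "i < N ^ k" for i
      by (subst measure_kept_eq[OF that]) simp
    then show ?thesis
      unfolding sum_divide_distrib by (intro sum.cong refl) (simp only: lessThan_iff)
  qed
  finally show ?thesis .
qed

section \<open>The Cantor measure and its Fourier coefficients\<close>

definition cantor_measure :: "(nat \<times> nat \<Rightarrow> nat) \<Rightarrow> circle measure"
  where "cantor_measure c = distr unif borel (\<lambda>u. to_circle (cantor_point c u))"

definition cantor_charge :: "(nat \<times> nat \<Rightarrow> nat) \<Rightarrow> circle set \<Rightarrow> complex"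
  where "cantor_charge c A = of_real (measure (cantor_measure c) A)"

lemma measurable_to_circle_cantor_point [measurable]: "(\<lambda>u. to_circle (cantor_point c u)) \<in> borel_measurable unif"
  by (rule measurable_compose[OF measurable_cantor_point measurable_to_circle])

lemma sets_cantor_measure [simp]: "sets (cantor_measure c) = sets borel"
  by (simp add: cantor_measure_def)

lemma prob_space_cantor_measure: "prob_space (cantor_measure c)"
  unfolding cantor_measure_def by (intro prob_space.prob_space_distr prob_space_unif) measurable

lemma finite_cantor_measure: "finite_measure (cantor_measure c)"
  using prob_space_cantor_measure by (simp add: prob_space_def)

lemma complex_measure_cantor_charge: "complex_measure borel (cantor_charge c)"
  unfolding cantor_charge_def[abs_def]
  by (rule complex_measure_of_measure(1)[OF finite_cantor_measure]) simp

lemma fourier_cantor_charge: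
  "fourier_transform (cantor_charge c) j = (\<integral>u. fourier_char j (to_circle (cantor_point c u)) \<partial>unif)"
proof -
  have "fourier_transform (cantor_charge c) j = (\<integral>x. fourier_char j x \<partial>cantor_measure c)"
    unfolding fourier_transform_def cantor_charge_def[abs_def]
    by (rule complex_measure_of_measure(2)[OF finite_cantor_measure]) simp
  also have "\<dots> = (\<integral>u. fourier_char j (to_circle (cantor_point c u)) \<partial>unif)"
    unfolding cantor_measure_def by (rule integral_distr) measurable
  finally show ?thesis .
qed

lemma fourier_cantor_charge_0: "fourier_transform (cantor_charge c) 0 = 1"
  using prob_space.prob_space[OF prob_space_unif] by (simp add: fourier_cantor_charge)

text \<open>Fourier coefficients of the uniform measure on the left endpoints of the kept cells.
  This measure lives on a finite grid, where discrete orthogonality is available.\<close>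

definition cantor_coeff :: "nat \<Rightarrow> (nat \<times> nat \<Rightarrow> nat) \<Rightarrow> int \<Rightarrow> complex"
  where "cantor_coeff k c j = (\<Sum>i<N ^ k. fourier_char j (to_circle (real (cell k c i) / real (N * M) ^ k))) / of_nat N ^ k"

lemma inverse_mesh_tendsto: "(\<lambda>k. 1 / real (N * M) ^ k) \<longlonglongrightarrow> 0"
proof -
  have "2 * 1 \<le> M * N" using M N_pos by (intro mult_le_mono) (simp_all add: Suc_le_eq)
  then have "1 < real (N * M)" by (simp add: mult.commute del: of_nat_mult)
  then show ?thesis using LIMSEQ_inverse_realpow_zero by (simp add: inverse_eq_divide)
qed

lemma cantor_coeff_tendsto:
  "(\<lambda>k. cantor_coeff k c j) \<longlonglongrightarrow> fourier_transform (cantor_charge c) j"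
proof (rule LIM_zero_cancel, rule Lim_null_comparison)
  interpret prob_space unif by (rule prob_space_unif)
  show "eventually (\<lambda>k. norm (cantor_coeff k c j - fourier_transform (cantor_charge c) j) \<le> 2 * pi * \<bar>real_of_int j\<bar> * (1 / real (N * M) ^ k)) sequentially"
  proof (intro always_eventually allI)
    fix k
    have m1[measurable]: "(\<lambda>u. fourier_char j (to_circle (approx_point c k u))) \<in> borel_measurable unif"
      by (rule measurable_compose[OF measurable_approx_point]) measurable
    have m2[measurable]: "(\<lambda>u. fourier_char j (to_circle (cantor_point c u))) \<in> borel_measurable unif"
      by (rule measurable_compose[OF measurable_cantor_point]) measurable
    have i1: "integrable unif (\<lambda>u. fourier_char j (to_circle (approx_point c k u)))"
      by (rule integrable_const_bound[of _ 1]) auto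
    have i2: "integrable unif (\<lambda>u. fourier_char j (to_circle (cantor_point c u)))"
      by (rule integrable_const_bound[of _ 1]) auto
    have "cantor_coeff k c j = (\<integral>u. fourier_char j (to_circle (approx_point c k u)) \<partial>unif)"
      unfolding cantor_coeff_def approx_point_def by (rule integral_kept[symmetric])
    then have "cantor_coeff k c j - fourier_transform (cantor_charge c) j
        = (\<integral>u. fourier_char j (to_circle (approx_point c k u)) - fourier_char j (to_circle (cantor_point c u)) \<partial>unif)"
      using i1 i2 by (simp add: fourier_cantor_charge)
    also have "norm \<dots> \<le> (\<integral>u. norm (fourier_char j (to_circle (approx_point c k u)) - fourier_char j (to_circle (cantor_point c u))) \<partial>unif)"
      by (rule integral_norm_bound)
    also have "\<dots> \<le> (\<integral>u. 2 * pi * \<bar>real_of_int j\<bar> * (1 / real (N * M) ^ k) \<partial>unif)"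
    proof (rule integral_mono)
      fix u assume "u \<in> space unif"
      then have "0 \<le> u" by (simp add: space_restrict_space)
      then have "\<bar>approx_point c k u - cantor_point c u\<bar> \<le> 1 / real (N * M) ^ k"
        using cantor_point_props(2,3)[of u c k] by linarith
      then have "2 * pi * \<bar>real_of_int j\<bar> * \<bar>approx_point c k u - cantor_point c u\<bar> \<le> 2 * pi * \<bar>real_of_int j\<bar> * (1 / real (N * M) ^ k)"
        by (intro mult_left_mono) auto
      then show "norm (fourier_char j (to_circle (approx_point c k u)) - fourier_char j (to_circle (cantor_point c u))) \<le> 2 * pi * \<bar>real_of_int j\<bar> * (1 / real (N * M) ^ k)"
        using fourier_char_lipschitz[of j "approx_point c k u" "cantor_point c u"] by (rule order_trans[rotated])
    qed (intro integrable_norm Bochner_Integration.integrable_diff i1 i2, simp)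
    also have "\<dots> = 2 * pi * \<bar>real_of_int j\<bar> * (1 / real (N * M) ^ k)" using prob_space by simp
    finally show "norm (cantor_coeff k c j - fourier_transform (cantor_charge c) j) \<le> 2 * pi * \<bar>real_of_int j\<bar> * (1 / real (N * M) ^ k)" .
  qed
  show "(\<lambda>k. 2 * pi * \<bar>real_of_int j\<bar> * (1 / real (N * M) ^ k)) \<longlonglongrightarrow> 0"
    using tendsto_mult_left[OF inverse_mesh_tendsto, of "2 * pi * \<bar>real_of_int j\<bar>"] by simp
qed

section \<open>Support and dimension of the Cantor measure\<close>

definition kept_arc :: "(nat \<times> nat \<Rightarrow> nat) \<Rightarrow> nat \<Rightarrow> nat \<Rightarrow> circle set"
  where "kept_arc c k i = to_circle ` {real (cell k c i) / real (N * M) ^ k .. real (cell k c i) / real (N * M) ^ k + 1 / real (N * M) ^ k}"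

definition cantor_support :: "(nat \<times> nat \<Rightarrow> nat) \<Rightarrow> circle set"
  where "cantor_support c = (\<Inter>k. \<Union>i<N ^ k. kept_arc c k i)"

lemma closed_kept_arc: "closed (kept_arc c k i)"
  unfolding kept_arc_def by (rule compact_imp_closed[OF compact_to_circle_image])

lemma bounded_kept_arc: "bounded (kept_arc c k i)"
  unfolding kept_arc_def by (rule compact_imp_bounded[OF compact_to_circle_image])

lemma diameter_kept_arc_le: "diameter (kept_arc c k i) \<le> 1 / real (N * M) ^ k"
proof -
  have "dist x y \<le> 1 / real (N * M) ^ k" if "x \<in> kept_arc c k i" "y \<in> kept_arc c k i" for x y
  proof -
    from that
    obtain s t where st: "x = to_circle s" "y = to_circle t"
    "s \<in> {real (cell k c i) / real (N * M) ^ k .. real (cell k c i) / real (N * M) ^ k + 1 / real (N * M) ^ k}"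
    "t \<in> {real (cell k c i) / real (N * M) ^ k .. real (cell k c i) / real (N * M) ^ k + 1 / real (N * M) ^ k}"
    unfolding kept_arc_def by blast
  have "\<bar>s - t\<bar> \<le> 1 / real (N * M) ^ k" using st(3,4) unfolding atLeastAtMost_iff by linarith
    then show ?thesis
      unfolding st(1,2) using dist_to_circle_le[of s t] by linarith
  qed
  moreover have "kept_arc c k i \<noteq> {}" by (simp add: kept_arc_def)
  ultimately show ?thesis
    unfolding diameter_def by (auto intro!: cSUP_least)
qed

lemma to_circle_cantor_point_in_support:
  assumes "0 \<le> u" "u < 1"
  shows "to_circle (cantor_point c u) \<in> cantor_support c"
  unfolding cantor_support_def
proof (intro INT_I)
  fix k
  have "to_circle (cantor_point c u) \<in> kept_arc c k (kept k u)"
    unfolding kept_arc_def using cantor_point_props(2,3)[OF assms(1), of c k]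
    by (intro imageI) (simp add: approx_point_def)
  then show "to_circle (cantor_point c u) \<in> (\<Union>i<N ^ k. kept_arc c k i)"
    using kept_less[OF assms, of k] by blast
qed

lemma cantor_support_sets: "cantor_support c \<in> sets borel"
  unfolding cantor_support_def using closed_kept_arc by (intro sets.countable_INT) auto

lemma total_variation_cantor_charge: "total_variation borel (cantor_charge c) (UNIV - cantor_support c) = 0"
proof (subst total_variation_eq_0_iff[OF complex_measure_cantor_charge])
  show "UNIV - cantor_support c \<in> sets borel" using cantor_support_sets by auto
  show "\<forall>A\<in>sets borel. A \<subseteq> UNIV - cantor_support c \<longrightarrow> cantor_charge c A = 0"
  proof (intro ballI impI)
    fix A :: "circle set" assume A: "A \<in> sets borel" "A \<subseteq> UNIV - cantor_support c"
    have "(\<lambda>u. to_circle (cantor_point c u)) -` A \<inter> space unif = {}"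
      using A(2) to_circle_cantor_point_in_support[of _ c] by (auto simp: space_restrict_space)
    then show "cantor_charge c A = 0"
      unfolding cantor_charge_def cantor_measure_def
      by (subst measure_distr[OF measurable_to_circle_cantor_point A(1)]) simp
  qed
qed

text \<open>The \<open>N ^ k\<close> arcs of level \<open>k\<close> have total gauge at most
  \<open>q ^ k\<close>, where \<open>q < 1\<close> is exactly the hypothesis on \<open>N\<close> and
  \<open>M\<close>.\<close>

lemma hausdorff_dim_cantor_support:
  assumes \<alpha>: "0 < \<alpha>" and NMa: "real N < real (N * M) powr \<alpha>"
  shows "hausdorff_dim (cantor_support c) \<le> ennreal \<alpha>"
proof -
  let ?b = "real (N * M)"
  define q where "q = real N / ?b powr \<alpha>"
  have q: "0 \<le> q" "q < 1" unfolding q_def using NMa by (auto simp: divide_less_eq_1)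
  have pre: "hausdorff_premeasure \<alpha> \<delta> (cantor_support c) \<le> ennreal (q ^ k)" if \<delta>: "1 / ?b ^ k \<le> \<delta>" for \<delta> k
  proof -
    define U where "U i = (if i < N ^ k then kept_arc c k i else {})" for i
    have "hausdorff_premeasure \<alpha> \<delta> (cantor_support c) \<le> (\<Sum>i. hausdorff_gauge \<alpha> (U i))"
      unfolding hausdorff_premeasure_def
    proof (rule INF_lower, intro CollectI conjI allI)
      show "cantor_support c \<subseteq> (\<Union>i. U i)"
        unfolding cantor_support_def U_def by fastforce
      fix i show "bounded (U i)" by (simp add: U_def bounded_kept_arc)
      have "0 \<le> \<delta>" using \<delta> by (rule order_trans[rotated]) simp
      then show "diameter (U i) \<le> \<delta>"
        using diameter_kept_arc_le[of c k i] \<delta> by (auto simp: U_def diameter_def[of "{}"])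
    qed
    also have "\<dots> = (\<Sum>i<N ^ k. hausdorff_gauge \<alpha> (U i))"
      by (rule suminf_finite) (auto simp: U_def hausdorff_gauge_def)
    also have "\<dots> \<le> (\<Sum>i<N ^ k. ennreal ((1 / ?b ^ k) powr \<alpha>))"
    proof (rule sum_mono)
      fix i assume "i \<in> {..<N ^ k}"
      have "diameter (kept_arc c k i) powr \<alpha> \<le> (1 / ?b ^ k) powr \<alpha>"
        using \<alpha> by (intro powr_mono2 diameter_kept_arc_le diameter_ge_0 bounded_kept_arc) auto
      then show "hausdorff_gauge \<alpha> (U i) \<le> ennreal ((1 / ?b ^ k) powr \<alpha>)"
        using \<alpha> by (auto simp: U_def hausdorff_gauge_def intro: ennreal_leI)
    qed
    also have "\<dots> = ennreal (real (N ^ k) * (1 / ?b ^ k) powr \<alpha>)"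
      by (simp add: ennreal_mult' ennreal_of_nat_eq_real_of_nat)
    also have "real (N ^ k) * (1 / ?b ^ k) powr \<alpha> = q ^ k"
    proof -
      have "(?b ^ k) powr \<alpha> = (?b powr \<alpha>) ^ k"
        using mesh_pos by (simp add: powr_realpow[symmetric] powr_powr mult.commute del: of_nat_mult)
      then show ?thesis using mesh_pos by (simp add: q_def power_divide powr_divide del: of_nat_mult)
    qed
    finally show ?thesis .
  qed
  have "hausdorff_outer_measure \<alpha> (cantor_support c) = 0"
  proof -
    have "hausdorff_premeasure \<alpha> \<delta> (cantor_support c) \<le> 0" if \<delta>: "\<delta> > 0" for \<delta>
    proof (rule LIMSEQ_le_const)
      show "(\<lambda>k. ennreal (q ^ k)) \<longlonglongrightarrow> 0"
        using tendsto_ennrealI[OF LIMSEQ_realpow_zero[OF q]] by simp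
      obtain K where K: "\<And>k. k \<ge> K \<Longrightarrow> 1 / ?b ^ k < \<delta>"
        using order_tendstoD(2)[OF inverse_mesh_tendsto \<delta>] by (auto simp: eventually_sequentially)
      show "\<exists>K. \<forall>k\<ge>K. hausdorff_premeasure \<alpha> \<delta> (cantor_support c) \<le> ennreal (q ^ k)"
        using pre K less_imp_le by blast
    qed
    then have "hausdorff_outer_measure \<alpha> (cantor_support c) \<le> 0"
      unfolding hausdorff_outer_measure_def by (intro SUP_least) auto
    then show ?thesis by simp
  qed
  then show ?thesis
    unfolding hausdorff_dim_def using \<alpha> by (intro INF_lower) auto
qed

text \<open>Valid for every \<open>c\<close>, so a detector must succeed on each realisation and
  hence on their average. The coefficient at 0 is the total mass 1, which excludes the zero
  sequence.\<close>

lemma fourier_cantor_charge_in_fourier_space: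
  assumes \<alpha>: "0 < \<alpha>" and NMa: "real N < real (N * M) powr \<alpha>"
  shows "fourier_transform (cantor_charge c) \<in> fourier_space \<alpha> - {\<lambda>_. 0}"
proof -
  have "cmeasure_dim (cantor_charge c) \<le> hausdorff_dim (cantor_support c)"
    unfolding cmeasure_dim_def using cantor_support_sets total_variation_cantor_charge by (intro INF_lower) auto
  also have "\<dots> \<le> ennreal \<alpha>" by (rule hausdorff_dim_cantor_support[OF assms])
  finally have "fourier_transform (cantor_charge c) \<in> fourier_space \<alpha>"
    unfolding fourier_space_def using complex_measure_cantor_charge by blast
  moreover have "fourier_transform (cantor_charge c) \<noteq> (\<lambda>_. 0)"
    using fourier_cantor_charge_0[of c] by (metis zero_neq_one)
  ultimately show ?thesis by simp
qed

end

section \<open>Common cells of two random Cantor sets\<close>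

text \<open>Independence of disjoint finite sets of coordinates, reduced to a finite product. For
  this, \<open>h\<close> is evaluated on finitely many coordinates by filling in the others from a
  fixed point \<open>z\<close>.\<close>

lemma (in product_prob_space) nn_integral_PiM_split:
  fixes h :: "('i \<Rightarrow> 'a) \<Rightarrow> ennreal" and f :: "'i \<Rightarrow> 'a \<Rightarrow> ennreal"
  assumes I: "I = UNIV" and fin: "finite A" "finite Q" and disj: "A \<inter> Q = {}"
    and h: "h \<in> borel_measurable (PiM I M)" "\<And>x y. (\<And>i. i \<in> A \<Longrightarrow> x i = y i) \<Longrightarrow> h x = h y"
    and f[measurable]: "\<And>i. i \<in> Q \<Longrightarrow> f i \<in> borel_measurable (M i)"
  shows "(\<integral>\<^sup>+x. h x * (\<Prod>i\<in>Q. f i (x i)) \<partial>PiM I M) = (\<integral>\<^sup>+x. h x \<partial>PiM I M) * (\<Prod>i\<in>Q. \<integral>\<^sup>+y. f i y \<partial>M i)"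
proof -
  obtain z where z: "z \<in> space (PiM I M)" using P.not_empty by blast
  define ext where "ext x = (\<lambda>i. if i \<in> A then x i else z i)" for x :: "'i \<Rightarrow> 'a"
  have ext[measurable]: "ext \<in> PiM A M \<rightarrow>\<^sub>M PiM I M"
    unfolding ext_def[abs_def] I
  proof (rule measurable_PiM_single')
    fix i
    show "(\<lambda>x. if i \<in> A then x i else z i) \<in> PiM A M \<rightarrow>\<^sub>M M i"
      using z by (cases "i \<in> A") (auto simp: space_PiM I PiE_iff intro!: measurable_component_singleton measurable_const)
  qed (use z in \<open>auto simp: space_PiM I PiE_def Pi_def split: if_splits\<close>)
  have ext': "ext \<in> PiM (A \<union> Q) M \<rightarrow>\<^sub>M PiM I M"
    unfolding ext_def[abs_def] I
  proof (rule measurable_PiM_single')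
    fix i
    show "(\<lambda>x. if i \<in> A then x i else z i) \<in> PiM (A \<union> Q) M \<rightarrow>\<^sub>M M i"
      using z by (cases "i \<in> A") (auto simp: space_PiM I PiE_iff intro!: measurable_component_singleton measurable_const)
  qed (use z in \<open>auto simp: space_PiM I PiE_def Pi_def split: if_splits\<close>)
  let ?F = "\<lambda>x. h (ext x) * (\<Prod>i\<in>Q. f i (x i))"
  have hext: "h (ext x) = h y" if "\<And>i. i \<in> A \<Longrightarrow> x i = y i" for x y
    by (rule h(2)) (simp add: ext_def that)
  have hm[measurable]: "(\<lambda>x. h (ext x)) \<in> borel_measurable (PiM A M)"
    by (rule measurable_compose[OF ext h(1)])
  have hm'[measurable]: "(\<lambda>x. h (ext x)) \<in> borel_measurable (PiM (A \<union> Q) M)"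
    by (rule measurable_compose[OF ext' h(1)])
  have comp: "(\<lambda>x. f i (x i)) \<in> borel_measurable (PiM J M)" if "i \<in> Q" "i \<in> J" for i J
    by (rule measurable_compose[where N = "M i" and g = "f i"]) (auto simp: that f intro: measurable_component_singleton)
  have fm[measurable]: "(\<lambda>x. \<Prod>i\<in>Q. f i (x i)) \<in> borel_measurable (PiM (A \<union> Q) M)"
    by (intro borel_measurable_prod_ennreal comp) auto
  have fmQ[measurable]: "(\<lambda>x. \<Prod>i\<in>Q. f i (x i)) \<in> borel_measurable (PiM Q M)"
    by (intro borel_measurable_prod_ennreal comp) auto
  have "(\<integral>\<^sup>+x. h x * (\<Prod>i\<in>Q. f i (x i)) \<partial>PiM I M) = (\<integral>\<^sup>+x. ?F (restrict x (A \<union> Q)) \<partial>PiM I M)"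
  proof (rule nn_integral_cong)
    fix x
    have "h (ext (restrict x (A \<union> Q))) = h x" by (rule hext) simp
    moreover have "(\<Prod>i\<in>Q. f i (restrict x (A \<union> Q) i)) = (\<Prod>i\<in>Q. f i (x i))" by (rule prod.cong) auto
    ultimately show "h x * (\<Prod>i\<in>Q. f i (x i)) = ?F (restrict x (A \<union> Q))" by simp
  qed
  also have "\<dots> = (\<integral>\<^sup>+x. ?F x \<partial>distr (PiM I M) (PiM (A \<union> Q) M) (\<lambda>x. restrict x (A \<union> Q)))"
    using I by (intro nn_integral_distr[symmetric] measurable_restrict_subset) auto
  also have "\<dots> = (\<integral>\<^sup>+x. ?F x \<partial>PiM (A \<union> Q) M)"
    using I fin by (subst distr_PiM_restrict_finite) auto
  also have "\<dots> = (\<integral>\<^sup>+x. \<integral>\<^sup>+y. ?F (merge A Q (x, y)) \<partial>PiM Q M \<partial>PiM A M)"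
    by (rule product_nn_integral_fold[OF disj fin]) measurable
  also have "\<dots> = (\<integral>\<^sup>+x. h (ext x) * (\<integral>\<^sup>+y. (\<Prod>i\<in>Q. f i (y i)) \<partial>PiM Q M) \<partial>PiM A M)"
  proof (rule nn_integral_cong)
    fix x
    have "(\<integral>\<^sup>+y. ?F (merge A Q (x, y)) \<partial>PiM Q M) = (\<integral>\<^sup>+y. h (ext x) * (\<Prod>i\<in>Q. f i (y i)) \<partial>PiM Q M)"
    proof (rule nn_integral_cong)
      fix y
      have "h (ext (merge A Q (x, y))) = h (ext x)" by (rule hext) (simp add: merge_def ext_def)
      moreover have "(\<Prod>i\<in>Q. f i (merge A Q (x, y) i)) = (\<Prod>i\<in>Q. f i (y i))"
        using disj by (intro prod.cong) (auto simp: merge_def)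
      ultimately show "?F (merge A Q (x, y)) = h (ext x) * (\<Prod>i\<in>Q. f i (y i))" by simp
    qed
    also have "\<dots> = h (ext x) * (\<integral>\<^sup>+y. (\<Prod>i\<in>Q. f i (y i)) \<partial>PiM Q M)"
      by (rule nn_integral_cmult) measurable
    finally show "(\<integral>\<^sup>+y. ?F (merge A Q (x, y)) \<partial>PiM Q M) = h (ext x) * (\<integral>\<^sup>+y. (\<Prod>i\<in>Q. f i (y i)) \<partial>PiM Q M)" .
  qed
  also have "\<dots> = (\<integral>\<^sup>+x. h (ext x) \<partial>PiM A M) * (\<integral>\<^sup>+y. (\<Prod>i\<in>Q. f i (y i)) \<partial>PiM Q M)"
    by (rule nn_integral_multc) measurable
  also have "(\<integral>\<^sup>+y. (\<Prod>i\<in>Q. f i (y i)) \<partial>PiM Q M) = (\<Prod>i\<in>Q. \<integral>\<^sup>+y. f i y \<partial>M i)"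
    by (rule product_nn_integral_prod[OF fin(2) f])
  also have "(\<integral>\<^sup>+x. h (ext x) \<partial>PiM A M) = (\<integral>\<^sup>+x. h (ext x) \<partial>distr (PiM I M) (PiM A M) (\<lambda>x. restrict x A))"
    using I fin by (subst distr_PiM_restrict_finite) auto
  also have "\<dots> = (\<integral>\<^sup>+x. h (ext (restrict x A)) \<partial>PiM I M)"
    using I by (intro nn_integral_distr measurable_restrict_subset) auto
  also have "\<dots> = (\<integral>\<^sup>+x. h x \<partial>PiM I M)"
    by (intro nn_integral_cong hext) simp
  finally show ?thesis .
qed

context random_cantor
begin

definition choice :: "nat measure"
  where "choice = measure_pmf (pmf_of_set {..<M})"

definition choices :: "(nat \<times> nat \<Rightarrow> nat) measure"
  where "choices = PiM UNIV (\<lambda>_. choice)"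

sublocale choices: product_prob_space "\<lambda>_ :: nat \<times> nat. choice" UNIV
  by (intro product_prob_spaceI) (simp add: choice_def measure_pmf.prob_space_axioms)

lemma sets_choice [simp, measurable_cong]: "sets choice = sets (count_space UNIV)"
  by (simp add: choice_def)

lemma space_choice [simp]: "space choice = UNIV"
  by (simp add: choice_def)

lemma space_choices [simp]: "space choices = UNIV"
  by (simp add: choices_def space_PiM)

lemma prob_space_choices: "prob_space choices"
  unfolding choices_def by (rule choices.P.prob_space_axioms)

lemma measurable_choices_component [measurable]: "(\<lambda>c. c p) \<in> choices \<rightarrow>\<^sub>M count_space UNIV"
proof -
  have "(\<lambda>c. c p) \<in> PiM UNIV (\<lambda>_. choice) \<rightarrow>\<^sub>M choice" by (rule measurable_component_singleton) simp
  then show ?thesis unfolding choices_def by (simp cong: measurable_cong_sets)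
qed

lemma measurable_cell [measurable]: "(\<lambda>c. cell k c i) \<in> choices \<rightarrow>\<^sub>M count_space UNIV"
proof (induct k arbitrary: i)
  case (Suc k)
  have [measurable]: "(\<lambda>c. slot k c i) \<in> choices \<rightarrow>\<^sub>M count_space UNIV"
    using Suc[of "i div N"] by measurable
  \<comment> \<open>The coordinate that is read depends on \<open>c\<close> itself, but takes only
    countably many values.\<close>
  have [measurable]: "(\<lambda>c. c (k, slot k c i)) \<in> choices \<rightarrow>\<^sub>M count_space UNIV"
    by (rule measurable_compose_countable[where f = "\<lambda>q c. c (k, q)" and g = "\<lambda>c. slot k c i"]) measurable
  show ?case unfolding cell.simps by measurable
qed simp

definition common :: "nat \<Rightarrow> (nat \<times> nat \<Rightarrow> nat) \<Rightarrow> (nat \<times> nat \<Rightarrow> nat) \<Rightarrow> nat set"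
  where "common k c c' = {i. i < N ^ k \<and> cell k c i = cell k c' i}"

lemma finite_common [simp]: "finite (common k c c')"
  by (simp add: common_def)

lemma common_subset: "common k c c' \<subseteq> {..<N ^ k}"
  by (auto simp: common_def)

lemma card_common_le: "card (common k c c') \<le> N ^ k"
  using card_mono[OF _ common_subset, of k c c'] by simp

lemma common_Suc: "common (Suc k) c c' =
  {i. i < N ^ Suc k \<and> i div N \<in> common k c c' \<and> c (k, slot k c' i) mod M = c' (k, slot k c' i) mod M}"
proof -
  have "i div N < N ^ k" if "i < N ^ Suc k" for i
    using that by (simp add: less_mult_imp_div_less mult.commute)
  then show ?thesis unfolding common_def using cell_Suc_eq_iff by auto
qed

lemma measurable_common [measurable]: "Measurable.pred choices (\<lambda>c. common k c c' = S)"
proof -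
  have "common k c c' = S \<longleftrightarrow> S \<subseteq> {..<N ^ k} \<and> (\<forall>i<N ^ k. cell k c i = cell k c' i \<longleftrightarrow> i \<in> S)" for c
    by (auto simp: common_def)
  then show ?thesis by simp
qed

text \<open>The exponential moment of a Bernoulli variable with success probability
  \<open>1 / M\<close>, success being agreement with a given choice \<open>v\<close>.\<close>

lemma nn_integral_choice:
  assumes "v < M" "0 \<le> a"
  shows "(\<integral>\<^sup>+x. ennreal (if x mod M = v then exp a else 1) \<partial>choice) = ennreal (1 + (exp a - 1) / real M)"
proof -
  have ne: "{..<M} \<noteq> {}" "finite {..<M}" using M_pos by (auto simp: lessThan_empty_iff)
  have "(\<integral>\<^sup>+x. ennreal (if x mod M = v then exp a else 1) \<partial>choice) = (\<Sum>x<M. ennreal (if x mod M = v then exp a else 1)) / ennreal (real M)"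
    unfolding choice_def by (subst nn_integral_pmf_of_set[OF ne]) (simp add: ennreal_of_nat_eq_real_of_nat)
  also have "(\<Sum>x<M. ennreal (if x mod M = v then exp a else 1)) = ennreal (\<Sum>x<M. if x mod M = v then exp a else 1)"
    by (rule sum_ennreal) simp
  also have "(\<Sum>x<M. if x mod M = v then exp a else 1) = (\<Sum>x<M. 1 + (if x = v then exp a - 1 else 0))"
    by (rule sum.cong) auto
  also have "(\<Sum>x<M. 1 + (if x = v then exp a - 1 else 0)) = real M + (exp a - 1)"
    using assms(1) by (simp add: sum.distrib)
  also have "ennreal (real M + (exp a - 1)) / ennreal (real M) = ennreal ((real M + (exp a - 1)) / real M)"
    using M_pos assms(2) by (intro divide_ennreal) auto
  also have "(real M + (exp a - 1)) / real M = 1 + (exp a - 1) / real M"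
    using M_pos by (simp add: add_divide_distrib)
  finally show ?thesis .
qed

text \<open>Given the first \<open>k\<close> levels, the number of common cells of level \<open>k + 1\<close> is binomially distributed.\<close>

lemma nn_integral_exp_common_Suc:
  assumes a: "0 \<le> a"
  shows "(\<integral>\<^sup>+c. ennreal (exp (a * real (card (common (Suc k) c c')))) \<partial>choices)
    = (\<integral>\<^sup>+c. ennreal ((1 + (exp a - 1) / real M) ^ (N * card (common k c c'))) \<partial>choices)"
proof -
  let ?S = "Pow {..<N ^ k}"
  define g where "g p x = ennreal (if x mod M = c' p mod M then exp a else 1)" for p :: "nat \<times> nat" and x :: nat
  define I where "I S = {i. i < N ^ Suc k \<and> i div N \<in> S}" for S
  \<comment> \<open>Once the set \<open>S\<close> of common cells is given, the slots below it can
    be computed from the fixed \<open>c'\<close>, so \<open>Q S\<close> is a deterministic set of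
    coordinates of \<open>c\<close>. The event itself reads only the coordinates in
    \<open>A\<close>, of levels below \<open>k\<close>.\<close>
  define Q where "Q S = (\<lambda>i. (k, slot k c' i)) ` I S" for S
  define A where "A = (SIGMA l:{..<k}. {..<(N * M) ^ l * N})"
  have finI: "finite (I S)" for S by (simp add: I_def)
  have injQ: "inj_on (\<lambda>i. (k, slot k c' i)) (I S)" for S
  proof (rule inj_onI)
    fix i i' assume "i \<in> I S" "i' \<in> I S" "(k, slot k c' i) = (k, slot k c' i')"
    then show "i = i'" unfolding I_def prod.inject by (intro slot_inj[of i k i' c']) blast+
  qed
  have cardI: "card (I S) = N * card S" if S: "S \<subseteq> {..<N ^ k}" for S
  proof -
    have "bij_betw (\<lambda>(j, d). j * N + d) (S \<times> {..<N}) (I S)"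
    proof (rule bij_betw_byWitness[where f' = "\<lambda>i. (i div N, i mod N)"])
      show "(\<lambda>(j, d). j * N + d) ` (S \<times> {..<N}) \<subseteq> I S"
      proof (clarsimp simp: I_def)
        fix j d assume j: "j \<in> S" and d: "d < N"
        then have "Suc j * N \<le> N ^ k * N" using S by (intro mult_le_mono1) auto
        then show "j * N + d < N * N ^ k" using d by (simp add: mult.commute)
      qed
    qed (auto simp: I_def)
    then have "card (S \<times> {..<N}) = card (I S)" by (rule bij_betw_same_card)
    then show ?thesis by (simp add: card_cartesian_product mult.commute)
  qed
  have expand: "ennreal (exp (a * real (card (common (Suc k) c c')))) = (\<Prod>p\<in>Q S. g p (c p))"
    if S: "common k c c' = S" for c S
  proof -
    have "common (Suc k) c c' = {i \<in> I S. c (k, slot k c' i) mod M = c' (k, slot k c' i) mod M}"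
      unfolding common_Suc S I_def by auto
    then have e: "exp (a * real (card (common (Suc k) c c'))) = (\<Prod>i\<in>I S. if c (k, slot k c' i) mod M = c' (k, slot k c' i) mod M then exp a else 1)"
      using finI[of S] by (simp add: prod.If_cases exp_of_nat2_mult Int_def)
    have "ennreal (exp (a * real (card (common (Suc k) c c')))) = (\<Prod>i\<in>I S. g (k, slot k c' i) (c (k, slot k c' i)))"
      unfolding g_def e by (rule prod_ennreal[symmetric]) auto
    also have "\<dots> = (\<Prod>p\<in>Q S. g p (c p))"
      using prod.reindex[OF injQ, of "\<lambda>p. g p (c p)" S] by (simp only: Q_def comp_def)
    finally show ?thesis .
  qed
  have split: "(\<integral>\<^sup>+c. indicator {c. common k c c' = S} c * (\<Prod>p\<in>Q S. g p (c p)) \<partial>choices)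
      = (\<integral>\<^sup>+c. indicator {c. common k c c' = S} c * ennreal ((1 + (exp a - 1) / real M) ^ (N * card S)) \<partial>choices)"
    if S: "S \<in> ?S" for S
  proof -
    have "(\<integral>\<^sup>+c. indicator {c. common k c c' = S} c * (\<Prod>p\<in>Q S. g p (c p)) \<partial>choices)
      = (\<integral>\<^sup>+c. indicator {c. common k c c' = S} c \<partial>choices) * (\<Prod>p\<in>Q S. \<integral>\<^sup>+x. g p x \<partial>choice)"
      unfolding choices_def
    proof (rule choices.nn_integral_PiM_split[where A = A])
      show "finite A" by (simp add: A_def)
      show "finite (Q S)" by (simp add: Q_def finI)
      show "A \<inter> Q S = {}" by (auto simp: A_def Q_def)
      have "{c. common k c c' = S} \<in> sets choices"
        using measurable_common[of k c' S] by (simp add: pred_def)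
      then show "indicator {c. common k c c' = S} \<in> borel_measurable (PiM UNIV (\<lambda>_. choice))"
        unfolding choices_def by (rule borel_measurable_indicator)
      fix x y :: "nat \<times> nat \<Rightarrow> nat" assume eq: "\<And>i. i \<in> A \<Longrightarrow> x i = y i"
      have "cell k x i = cell k y i" if "i < N ^ k" for i
        by (rule cell_cong[OF eq that]) (simp add: A_def)
      then have "common k x c' = common k y c'" by (auto simp: common_def)
      then show "indicator {c. common k c c' = S} x = (indicator {c. common k c c' = S} y :: ennreal)"
        by (simp add: indicator_def)
    qed (auto simp: measurable_cong_sets[OF sets_choice refl])
    also have "(\<Prod>p\<in>Q S. \<integral>\<^sup>+x. g p x \<partial>choice) = (\<Prod>p\<in>Q S. ennreal (1 + (exp a - 1) / real M))"
      unfolding g_def by (intro prod.cong refl nn_integral_choice a) simp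
    also have "\<dots> = ennreal ((1 + (exp a - 1) / real M) ^ (N * card S))"
    proof -
      have "card (Q S) = N * card S"
        unfolding Q_def card_image[OF injQ] using S by (intro cardI) auto
      moreover have "0 \<le> 1 + (exp a - 1) / real M" using a by (intro add_nonneg_nonneg divide_nonneg_nonneg) auto
      ultimately show ?thesis by (simp add: ennreal_power)
    qed
    finally show ?thesis
      by (subst nn_integral_multc) (auto simp: measurable_common[unfolded pred_def, simplified])
  qed
  \<comment> \<open>Summation over the finitely many possible sets \<open>S\<close> takes the place
    of conditioning on the first \<open>k\<close> levels.\<close>
  have decomp: "F (common k c c') = (\<Sum>S\<in>?S. indicator {c. common k c c' = S} c * F S)" for F :: "nat set \<Rightarrow> ennreal" and c
  proof -
    have "(\<Sum>S\<in>?S. indicator {c. common k c c' = S} c * F S) = (\<Sum>S\<in>?S. if S = common k c c' then F S else 0)"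
      by (intro sum.cong) (auto simp: indicator_def)
    also have "\<dots> = F (common k c c')" using common_subset[of k c c'] by (simp add: sum.delta)
    finally show ?thesis by simp
  qed
  have ind[measurable]: "{c. common k c c' = S} \<in> sets choices" for S
    using measurable_common[of k c' S] by (simp add: pred_def)
  have gm[measurable]: "(\<lambda>c. g p (c p)) \<in> borel_measurable choices" for p
    by (rule measurable_compose[OF measurable_choices_component]) simp
  have "(\<integral>\<^sup>+c. ennreal (exp (a * real (card (common (Suc k) c c')))) \<partial>choices)
      = (\<integral>\<^sup>+c. (\<Sum>S\<in>?S. indicator {c. common k c c' = S} c * (\<Prod>p\<in>Q S. g p (c p))) \<partial>choices)"
  proof (rule nn_integral_cong)
    fix c
    have "ennreal (exp (a * real (card (common (Suc k) c c')))) = (\<Prod>p\<in>Q (common k c c'). g p (c p))"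
      by (rule expand) simp
    also have "\<dots> = (\<Sum>S\<in>?S. indicator {c. common k c c' = S} c * (\<Prod>p\<in>Q S. g p (c p)))"
      by (rule decomp[of "\<lambda>S. \<Prod>p\<in>Q S. g p (c p)"])
    finally show "ennreal (exp (a * real (card (common (Suc k) c c')))) = (\<Sum>S\<in>?S. indicator {c. common k c c' = S} c * (\<Prod>p\<in>Q S. g p (c p)))" .
  qed
  also have "\<dots> = (\<Sum>S\<in>?S. \<integral>\<^sup>+c. indicator {c. common k c c' = S} c * (\<Prod>p\<in>Q S. g p (c p)) \<partial>choices)"
    by (rule nn_integral_sum) measurable
  also have "\<dots> = (\<Sum>S\<in>?S. \<integral>\<^sup>+c. indicator {c. common k c c' = S} c * ennreal ((1 + (exp a - 1) / real M) ^ (N * card S)) \<partial>choices)"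
    by (rule sum.cong[OF refl split])
  also have "\<dots> = (\<integral>\<^sup>+c. (\<Sum>S\<in>?S. indicator {c. common k c c' = S} c * ennreal ((1 + (exp a - 1) / real M) ^ (N * card S))) \<partial>choices)"
    by (rule nn_integral_sum[symmetric]) measurable
  also have "\<dots> = (\<integral>\<^sup>+c. ennreal ((1 + (exp a - 1) / real M) ^ (N * card (common k c c'))) \<partial>choices)"
    by (intro nn_integral_cong decomp[of "\<lambda>S. ennreal ((1 + (exp a - 1) / real M) ^ (N * card S))", symmetric])
  finally show ?thesis .
qed

definition ratio :: real
  where "ratio = real M / real N"

lemma ratio_bounds: "0 < ratio" "ratio < 1"
  using NM by (auto simp: ratio_def)

text \<open>Going back one level, the exponent \<open>ratio ^ k\<close> grows by a factor \<open>1 + O(ratio ^ k)\<close>; the correction term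
  in \<open>a k\<close> absorbs this growth.\<close>

lemma exp_common_bounded:
  obtains K where "eventually (\<lambda>k. \<forall>c'. (\<integral>\<^sup>+c. ennreal (exp (ratio ^ k * real (card (common k c c')))) \<partial>choices) \<le> ennreal K) sequentially"
proof -
  define r where "r = ratio"
  have r: "0 < r" "r < 1" using ratio_bounds by (auto simp: r_def)
  \<comment> \<open>\<open>C\<close> solves \<open>C * r + 4 * r = C\<close>. The 4 comes from the
    quadratic error: the exponent at level \<open>k\<close> is at most \<open>2 * r ^ k\<close>, and
    this is squared.\<close>
  define C where "C = 4 * r / (1 - r)"
  have C0: "0 \<le> C" using r by (simp add: C_def)
  have C: "C * r + 4 * r = C"
    using r by (simp add: C_def field_simps)
  define a where "a k = r ^ k * (1 + C * r ^ k)" for k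
  have "(\<lambda>k. r ^ k) \<longlonglongrightarrow> 0" using r by (intro LIMSEQ_power_zero) auto
  then have "eventually (\<lambda>k. r ^ k < 1 / (C + 2)) sequentially"
    using C0 by (intro order_tendstoD(2)) auto
  then obtain k1 where k1: "\<And>k. k \<ge> k1 \<Longrightarrow> r ^ k < 1 / (C + 2)"
    by (auto simp: eventually_sequentially)
  have W: "C * r ^ k \<le> 1" "2 * r ^ k \<le> 1" if "k \<ge> k1" for k
  proof -
    have "(C + 2) * r ^ k \<le> 1" using k1[OF that] C0 by (simp add: field_simps)
    moreover have "0 \<le> C * r ^ k" "0 \<le> 2 * r ^ k" using C0 r by auto
    ultimately show "C * r ^ k \<le> 1" "2 * r ^ k \<le> 1" by (simp_all add: distrib_right)
  qed
  have a0: "0 \<le> a k" for k using r C0 by (simp add: a_def)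
  have a1: "a k \<le> 2 * r ^ k" if "k \<ge> k1" for k
    using mult_left_mono[of "1 + C * r ^ k" 2 "r ^ k"] W(1)[OF that] r by (simp add: a_def mult.commute)
  \<comment> \<open>By \<open>1 + x \<le> exp x\<close> and \<open>exp t \<le> 1 + t + t ^ 2\<close>
    the binomial moment is at most \<open>exp ((t + t ^ 2) * N / M)\<close>, and
    \<open>N / M\<close> is \<open>1 / r\<close>; the choice of \<open>C\<close> closes the
    recursion.\<close>
  have step: "(1 + (exp (a (Suc k)) - 1) / real M) ^ N \<le> exp (a k)" if k: "k \<ge> k1" for k
  proof -
    let ?t = "a (Suc k)"
    have t: "0 \<le> ?t" "?t \<le> 1" using a0 a1[of "Suc k"] W(2)[of "Suc k"] k by (simp, linarith)
    have "exp ?t \<le> 1 + ?t + ?t\<^sup>2" using exp_bound[OF t] .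
    have base: "0 \<le> 1 + (exp ?t - 1) / real M" using t by (intro add_nonneg_nonneg divide_nonneg_nonneg) auto
    have "1 + (exp ?t - 1) / real M \<le> exp ((exp ?t - 1) / real M)" by (rule exp_ge_add_one_self)
    also have "\<dots> \<le> exp ((?t + ?t\<^sup>2) / real M)"
      using \<open>exp ?t \<le> 1 + ?t + ?t\<^sup>2\<close> by (simp add: divide_right_mono)
    finally have "(1 + (exp ?t - 1) / real M) ^ N \<le> exp ((?t + ?t\<^sup>2) / real M) ^ N"
      using base by (rule power_mono)
    also have "\<dots> = exp ((?t + ?t\<^sup>2) / r)"
      by (simp add: exp_of_nat_mult[symmetric] r_def ratio_def)
    also have "\<dots> \<le> exp (a k)"
    proof -
      have "?t\<^sup>2 \<le> (2 * r ^ Suc k)\<^sup>2" using a1[of "Suc k"] k t by (intro power_mono) auto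
      then have "?t + ?t\<^sup>2 \<le> r ^ Suc k * (1 + C * r ^ Suc k) + 4 * (r ^ Suc k)\<^sup>2"
        by (simp add: a_def power_mult_distrib)
      also have "\<dots> = r * (r ^ k * (1 + (C * r + 4 * r) * r ^ k))"
        by (simp add: power2_eq_square algebra_simps)
      also have "\<dots> = r * a k" by (simp add: C a_def)
      finally show ?thesis using r by (simp add: pos_divide_le_eq mult.commute)
    qed
    finally show ?thesis .
  qed
  define E where "E k c' = (\<integral>\<^sup>+c. ennreal (exp (a k * real (card (common k c c')))) \<partial>choices)" for k c'
  have E_step: "E (Suc k) c' \<le> E k c'" if k: "k \<ge> k1" for k c'
  proof -
    have "E (Suc k) c' = (\<integral>\<^sup>+c. ennreal ((1 + (exp (a (Suc k)) - 1) / real M) ^ (N * card (common k c c'))) \<partial>choices)"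
      unfolding E_def by (rule nn_integral_exp_common_Suc[OF a0])
    also have "\<dots> \<le> (\<integral>\<^sup>+c. ennreal (exp (a k * real (card (common k c c')))) \<partial>choices)"
    proof (intro nn_integral_mono ennreal_leI)
      fix c
      have "0 \<le> 1 + (exp (a (Suc k)) - 1) / real M" using a0[of "Suc k"] by (intro add_nonneg_nonneg divide_nonneg_nonneg) auto
      then have "((1 + (exp (a (Suc k)) - 1) / real M) ^ N) ^ card (common k c c') \<le> exp (a k) ^ card (common k c c')"
        using step[OF k] by (intro power_mono) auto
      then show "(1 + (exp (a (Suc k)) - 1) / real M) ^ (N * card (common k c c')) \<le> exp (a k * real (card (common k c c')))"
        by (simp add: power_mult exp_of_nat2_mult)
    qed
    finally show ?thesis by (simp add: E_def)
  qed
  have E_bound: "E k c' \<le> E k1 c'" if "k \<ge> k1" for k c'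
    using that by (induct rule: dec_induct) (auto intro: order_trans[OF E_step])
  \<comment> \<open>At the starting level there are at most \<open>N ^ k1\<close> common cells,
    which gives a bound that does not depend on \<open>c'\<close>.\<close>
  have "E k1 c' \<le> ennreal (exp (a k1 * real (N ^ k1)))" for c'
  proof -
    interpret prob_space choices by (rule prob_space_choices)
    have "E k1 c' \<le> (\<integral>\<^sup>+c. ennreal (exp (a k1 * real (N ^ k1))) \<partial>choices)"
      unfolding E_def
      by (intro nn_integral_mono ennreal_leI) (simp only: exp_le_cancel_iff, intro mult_left_mono a0, simp only: of_nat_le_iff card_common_le)
    then show ?thesis using emeasure_space_1 by simp
  qed
  then have "(\<integral>\<^sup>+c. ennreal (exp (ratio ^ k * real (card (common k c c')))) \<partial>choices) \<le> ennreal (exp (a k1 * real (N ^ k1)))"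
    if k: "k \<ge> k1" for k c'
  proof -
    have "ratio ^ k \<le> a k" using r C0 by (simp add: a_def r_def[symmetric] mult_le_cancel_left1)
    then have "(\<integral>\<^sup>+c. ennreal (exp (ratio ^ k * real (card (common k c c')))) \<partial>choices) \<le> E k c'"
      unfolding E_def by (intro nn_integral_mono ennreal_leI) (simp add: mult_right_mono)
    also have "\<dots> \<le> E k1 c'" by (rule E_bound[OF k])
    also have "\<dots> \<le> ennreal (exp (a k1 * real (N ^ k1)))" by fact
    finally show ?thesis .
  qed
  then have "eventually (\<lambda>k. \<forall>c'. (\<integral>\<^sup>+c. ennreal (exp (ratio ^ k * real (card (common k c c')))) \<partial>choices) \<le> ennreal (exp (a k1 * real (N ^ k1)))) sequentially"
    by (intro eventually_sequentiallyI[of k1]) blast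
  then show ?thesis using that by blast
qed

end

section \<open>Correlations of the Fourier coefficients\<close>

definition psd_kernel :: "'v set \<Rightarrow> ('v \<Rightarrow> 'v \<Rightarrow> real) \<Rightarrow> bool"
  where "psd_kernel V K \<longleftrightarrow> (\<forall>q. 0 \<le> (\<Sum>v\<in>V. \<Sum>w\<in>V. q v * q w * K v w))"

text \<open>In the power series of the exponential every term contributes a nonnegative quadratic
  form, because the powers of \<open>f\<close> can be absorbed into the weights \<open>q\<close>;
  the term of order 0 is the left side.\<close>

lemma psd_kernel_mult_exp:
  assumes psd: "psd_kernel V K"
  shows "(\<Sum>v\<in>V. \<Sum>w\<in>V. q v * q w * K v w) \<le> (\<Sum>v\<in>V. \<Sum>w\<in>V. q v * q w * (K v w * exp (f v * f w)))"
proof -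
  let ?T = "\<lambda>n v w. \<Sum>m<n. (f v * f w) ^ m / fact m"
  have "(\<lambda>n. \<Sum>v\<in>V. \<Sum>w\<in>V. q v * q w * (K v w * ?T n v w)) \<longlonglongrightarrow> (\<Sum>v\<in>V. \<Sum>w\<in>V. q v * q w * (K v w * exp (f v * f w)))"
    using exp_converges[where 'a = real] unfolding sums_def
    by (intro tendsto_intros) (simp add: divide_inverse mult.commute scaleR_conv_of_real)
  moreover have "(\<Sum>v\<in>V. \<Sum>w\<in>V. q v * q w * K v w) \<le> (\<Sum>v\<in>V. \<Sum>w\<in>V. q v * q w * (K v w * ?T n v w))" if "n \<ge> 1" for n
  proof -
    define S where "S m = (\<Sum>v\<in>V. \<Sum>w\<in>V. (q v * f v ^ m) * (q w * f w ^ m) * K v w) / fact m" for m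
    have S: "0 \<le> S m" for m
      using psd unfolding psd_kernel_def S_def by (intro divide_nonneg_nonneg) auto
    have "(\<Sum>v\<in>V. \<Sum>w\<in>V. q v * q w * (K v w * ?T n v w)) = (\<Sum>v\<in>V. \<Sum>w\<in>V. \<Sum>m<n. (q v * f v ^ m) * (q w * f w ^ m) * K v w / fact m)"
      by (simp add: sum_distrib_left power_mult_distrib mult_ac)
    also have "\<dots> = (\<Sum>v\<in>V. \<Sum>m<n. \<Sum>w\<in>V. (q v * f v ^ m) * (q w * f w ^ m) * K v w / fact m)"
      by (rule sum.cong[OF refl sum.swap])
    also have "\<dots> = (\<Sum>m<n. \<Sum>v\<in>V. \<Sum>w\<in>V. (q v * f v ^ m) * (q w * f w ^ m) * K v w / fact m)"
      by (rule sum.swap)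
    also have "\<dots> = (\<Sum>m<n. S m)" by (simp add: S_def sum_divide_distrib)
    finally have eq: "(\<Sum>v\<in>V. \<Sum>w\<in>V. q v * q w * (K v w * ?T n v w)) = (\<Sum>m<n. S m)" .
    have "(\<Sum>m\<in>{0}. S m) \<le> (\<Sum>m<n. S m)"
      using that S by (intro sum_mono2) auto
    then show ?thesis unfolding eq by (simp add: S_def)
  qed
  ultimately show ?thesis
    by (intro LIMSEQ_le_const) (auto intro!: exI[of _ 1])
qed

lemma psd_kernel_exp_sum:
  fixes V :: "'v set" and f :: "'p \<Rightarrow> 'v \<Rightarrow> real"
  assumes "finite A"
  shows "psd_kernel V (\<lambda>v w. exp (\<Sum>p\<in>A. f p v * f p w))"
  using assms
proof (induct A)
  case empty
  have "(\<Sum>v\<in>V. \<Sum>w\<in>V. q v * q w * 1) = (\<Sum>v\<in>V. q v)\<^sup>2" for q :: "'v \<Rightarrow> real"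
    by (simp add: power2_eq_square sum_product)
  then show ?case by (simp add: psd_kernel_def)
next
  case (insert p A)
  have eq: "exp (\<Sum>i\<in>insert p A. f i v * f i w) = exp (\<Sum>i\<in>A. f i v * f i w) * exp (f p v * f p w)" for v w
    unfolding exp_add[symmetric] using insert by (simp add: add.commute)
  show ?case
    unfolding psd_kernel_def eq
  proof
    fix q :: "'v \<Rightarrow> real"
    have "0 \<le> (\<Sum>v\<in>V. \<Sum>w\<in>V. q v * q w * exp (\<Sum>i\<in>A. f i v * f i w))"
      using insert(3) unfolding psd_kernel_def by blast
    also have "\<dots> \<le> (\<Sum>v\<in>V. \<Sum>w\<in>V. q v * q w * (exp (\<Sum>i\<in>A. f i v * f i w) * exp (f p v * f p w)))"
      by (rule psd_kernel_mult_exp[OF insert(3)])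
    finally show "0 \<le> (\<Sum>v\<in>V. \<Sum>w\<in>V. q v * q w * (exp (\<Sum>i\<in>A. f i v * f i w) * exp (f p v * f p w)))" .
  qed
qed

text \<open>The exponents may decrease for individual pairs when terms are added; only the quadratic
  form increases, one application of \<open>psd_kernel_mult_exp\<close> for each new term.\<close>

lemma exp_gram_mono:
  fixes f :: "'p \<Rightarrow> 'v \<Rightarrow> real" and q :: "'v \<Rightarrow> real"
  assumes "finite B" "A \<subseteq> B"
  shows "(\<Sum>v\<in>V. \<Sum>w\<in>V. q v * q w * exp (\<Sum>p\<in>A. f p v * f p w)) \<le> (\<Sum>v\<in>V. \<Sum>w\<in>V. q v * q w * exp (\<Sum>p\<in>B. f p v * f p w))"
proof -
  have A: "finite A" using assms by (rule finite_subset[rotated])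
  have "(\<Sum>v\<in>V. \<Sum>w\<in>V. q v * q w * exp (\<Sum>p\<in>A. f p v * f p w)) \<le> (\<Sum>v\<in>V. \<Sum>w\<in>V. q v * q w * exp (\<Sum>p\<in>A \<union> D. f p v * f p w))"
    if "finite D" "D \<inter> A = {}" for D
    using that
  proof (induct D)
    case (insert p D)
    have eq: "exp (\<Sum>i\<in>A \<union> insert p D. f i v * f i w) = exp (\<Sum>i\<in>A \<union> D. f i v * f i w) * exp (f p v * f p w)" for v w
    proof -
      have "(\<Sum>i\<in>A \<union> insert p D. f i v * f i w) = (\<Sum>i\<in>A \<union> D. f i v * f i w) + f p v * f p w"
        using insert A by (simp add: add.commute)
      then show ?thesis by (simp only: exp_add)
    qed
    have "finite (A \<union> D)" using A insert by simp
    from psd_kernel_mult_exp[OF psd_kernel_exp_sum[OF this, of V f], of q "f p"] insert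
    show ?case unfolding eq by simp
  qed simp
  note extend = this
  have BA: "finite (B - A)" "(B - A) \<inter> A = {}" "A \<union> (B - A) = B" using assms by blast+
  show ?thesis using extend[OF BA(1,2)] unfolding BA(3) .
qed

lemma fourier_char_of_nat: "fourier_char (int m) x = fourier_char 1 x ^ m"
proof (induct m)
  case (Suc m)
  have "fourier_char (int (Suc m)) x = fourier_char (1 + int m) x" by simp
  then show ?case unfolding fourier_char_add by (simp add: Suc)
qed simp

text \<open>Discrete orthogonality over a full period of frequencies: for distinct grid points the
  terms run through the powers of a nontrivial \<open>B\<close>-th root of unity \<open>z\<close>.
  The period starts at \<open>- n\<close> so that for \<open>B > 2 * n\<close> it contains all
  frequencies of modulus at most \<open>n\<close>.\<close>

lemma sum_fourier_char_grid:
  assumes p: "p < B" and q: "q < B"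
  shows "(\<Sum>j\<in>{- int n..<int B - int n}. fourier_char j (to_circle (real p / real B)) * cnj (fourier_char j (to_circle (real q / real B))))
    = (if p = q then of_nat B else 0)"
proof -
  let ?x = "to_circle (real p / real B)" and ?y = "to_circle (real q / real B)"
  have unit: "fourier_char j z * cnj (fourier_char j z) = 1" for j z
    using complex_norm_square[of "fourier_char j z"] by simp
  show ?thesis
  proof (cases "p = q")
    case True
    then show ?thesis by (simp add: unit)
  next
    case False
    define z where "z = fourier_char 1 ?x * cnj (fourier_char 1 ?y)"
    have xy: "?x \<noteq> ?y"
    proof
      assume "?x = ?y"
      then have "circle_coord ?x = circle_coord ?y" by simp
      moreover have "circle_coord ?x = real p / real B" "circle_coord ?y = real q / real B"
        using p q by (auto intro!: circle_coord_id)
      ultimately show False using False p by simp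
    qed
    have "z \<noteq> 1"
    proof
      assume "z = 1"
      then have "z * fourier_char 1 ?y = fourier_char 1 ?y" by simp
      moreover have "z * fourier_char 1 ?y = fourier_char 1 ?x"
        using unit[of 1 ?y] by (simp add: z_def mult.assoc mult.commute[of "cnj _"])
      ultimately show False using xy fourier_char_1_inj by metis
    qed
    moreover have "z ^ B = 1"
    proof -
      have root: "fourier_char 1 (to_circle (real r / real B)) ^ B = 1" if "r < B" for r
      proof -
        have "fourier_char 1 (to_circle (real r / real B)) ^ B = fourier_char (int B) (to_circle (real r / real B))"
          by (rule fourier_char_of_nat[symmetric])
        also have "\<dots> = exp (\<i> * of_real (- 2 * pi * of_int (int B) * (real r / real B)))"
          by (rule fourier_char_to_circle)
        also have "\<dots> = exp (complex_of_real (2 * real_of_int (- int r) * pi) * \<i>)"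
          using that by (intro arg_cong[of _ _ exp]) simp
        also have "\<dots> = 1" by (rule exp_integer_2pi) simp
        finally show ?thesis .
      qed
      have "z ^ B = fourier_char 1 ?x ^ B * cnj (fourier_char 1 ?y ^ B)"
        by (simp add: z_def power_mult_distrib)
      then show ?thesis unfolding root[OF p] root[OF q] by simp
    qed
    ultimately have "(\<Sum>m<B. z ^ m) = 0" by (simp add: geometric_sum)
    moreover have "(\<Sum>j\<in>{- int n..<int B - int n}. fourier_char j ?x * cnj (fourier_char j ?y))
        = (\<Sum>m<B. fourier_char (- int n) ?x * cnj (fourier_char (- int n) ?y) * z ^ m)"
    proof (rule sum.reindex_bij_witness[where i = "\<lambda>m. int m - int n" and j = "\<lambda>j. nat (j + int n)"])
      fix j assume "j \<in> {- int n..<int B - int n}"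
      then have "j = - int n + int (nat (j + int n))" by simp
      then have "fourier_char j w = fourier_char (- int n) w * fourier_char 1 w ^ nat (j + int n)" for w
        using fourier_char_add[of "- int n" "int (nat (j + int n))" w] fourier_char_of_nat by metis
      then show "fourier_char (- int n) ?x * cnj (fourier_char (- int n) ?y) * z ^ nat (j + int n) = fourier_char j ?x * cnj (fourier_char j ?y)"
        by (simp add: z_def power_mult_distrib mult_ac)
    qed auto
    ultimately show ?thesis using False by (simp add: sum_distrib_left[symmetric])
  qed
qed

context random_cantor
begin

definition vec_coeff :: "nat \<Rightarrow> (nat \<Rightarrow> nat) \<Rightarrow> int \<Rightarrow> complex"
  where "vec_coeff k v j = (\<Sum>i<N ^ k. fourier_char j (to_circle (real (v i) / real ((N * M) ^ k)))) / of_nat (N ^ k)"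

definition cell_vec :: "nat \<Rightarrow> (nat \<times> nat \<Rightarrow> nat) \<Rightarrow> nat \<Rightarrow> nat"
  where "cell_vec k c = (\<lambda>i. if i < N ^ k then cell k c i else 0)"

text \<open>A finite set of possible values for level \<open>k\<close>, which turns averages over
  \<open>choices\<close> into the weighted finite sums of \<open>exp_gram_mono\<close>. Entries from
  \<open>N ^ k\<close> on are frozen at 0 for this reason.\<close>

definition cell_vecs :: "nat \<Rightarrow> (nat \<Rightarrow> nat) set"
  where "cell_vecs k = {v. \<forall>i. (i \<in> {..<N ^ k} \<longrightarrow> v i \<in> {..<(N * M) ^ k}) \<and> (i \<notin> {..<N ^ k} \<longrightarrow> v i = 0)}"

lemma finite_cell_vecs: "finite (cell_vecs k)"
  unfolding cell_vecs_def by (intro finite_set_of_finite_funs) auto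

lemma cell_vec_in: "cell_vec k c \<in> cell_vecs k"
  unfolding cell_vecs_def cell_vec_def using cell_less by auto

lemma cantor_coeff_eq: "cantor_coeff k c j = vec_coeff k (cell_vec k c) j"
  unfolding cantor_coeff_def vec_coeff_def cell_vec_def by simp

definition corr :: "nat \<Rightarrow> int set \<Rightarrow> (nat \<times> nat \<Rightarrow> nat) \<Rightarrow> (nat \<times> nat \<Rightarrow> nat) \<Rightarrow> real"
  where "corr k A c c' = (\<Sum>j\<in>A. Re (cantor_coeff k c j * cnj (cantor_coeff k c' j)))"

text \<open>By orthogonality only pairs of equal cells survive, and these have equal indices by
  \<open>cell_eq_imp\<close>. Each has weight \<open>(N * M) ^ k / N ^ (2 * k)\<close>, which is
  \<open>ratio ^ k\<close>.\<close>

lemma corr_full: "corr k {- int n..<int ((N * M) ^ k) - int n} c c' = ratio ^ k * real (card (common k c c'))"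
proof -
  let ?B = "(N * M) ^ k" and ?J = "{- int n..<int ((N * M) ^ k) - int n}"
  let ?e = "\<lambda>j c i. fourier_char j (to_circle (real (cell k c i) / real ((N * M) ^ k)))"
  have "(\<Sum>j\<in>?J. cantor_coeff k c j * cnj (cantor_coeff k c' j))
      = (\<Sum>j\<in>?J. \<Sum>i<N ^ k. \<Sum>i'<N ^ k. ?e j c i * cnj (?e j c' i')) / of_nat (N ^ k * N ^ k)"
    unfolding cantor_coeff_def by (simp add: cnj_sum sum_product sum_divide_distrib)
  also have "(\<Sum>j\<in>?J. \<Sum>i<N ^ k. \<Sum>i'<N ^ k. ?e j c i * cnj (?e j c' i'))
      = (\<Sum>i<N ^ k. \<Sum>i'<N ^ k. \<Sum>j\<in>?J. ?e j c i * cnj (?e j c' i'))"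
    by (subst sum.swap, intro sum.cong refl, rule sum.swap)
  also have "\<dots> = (\<Sum>i<N ^ k. \<Sum>i'<N ^ k. if i' = i then (if cell k c i = cell k c' i then of_nat ?B else 0) else 0)"
  proof (intro sum.cong refl)
    fix i i' assume i: "i \<in> {..<N ^ k}" "i' \<in> {..<N ^ k}"
    have "(\<Sum>j\<in>?J. ?e j c i * cnj (?e j c' i')) = (if cell k c i = cell k c' i' then of_nat ?B else 0)"
      by (rule sum_fourier_char_grid) (use i cell_less in auto)
    also have "\<dots> = (if i' = i then (if cell k c i = cell k c' i then of_nat ?B else 0) else 0)"
      using cell_eq_imp[of k c i c' i'] i by auto
    finally show "(\<Sum>j\<in>?J. ?e j c i * cnj (?e j c' i')) = (if i' = i then (if cell k c i = cell k c' i then of_nat ?B else 0) else 0)" .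
  qed
  also have "\<dots> = (\<Sum>i<N ^ k. if cell k c i = cell k c' i then of_nat ?B else 0)"
    by (simp add: sum.delta)
  also have "\<dots> = of_nat (card (common k c c')) * (of_nat ?B :: complex)"
  proof -
    have "common k c c' = {i \<in> {..<N ^ k}. cell k c i = cell k c' i}" by (auto simp: common_def)
    then show ?thesis by (simp only: sum.inter_filter[symmetric] finite_lessThan sum_constant)
  qed
  finally have "(\<Sum>j\<in>?J. cantor_coeff k c j * cnj (cantor_coeff k c' j)) = of_nat (card (common k c c')) * of_nat ?B / of_nat (N ^ k * N ^ k)" .
  also have "\<dots> = complex_of_real (ratio ^ k * real (card (common k c c')))"
    by (simp add: ratio_def power_mult_distrib power_divide)
  finally have "Re (\<Sum>j\<in>?J. cantor_coeff k c j * cnj (cantor_coeff k c' j)) = ratio ^ k * real (card (common k c c'))"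
    by (simp only: Re_complex_of_real)
  then show ?thesis unfolding corr_def by (simp only: Re_sum)
qed

lemma measurable_cantor_coeff [measurable]: "(\<lambda>c. cantor_coeff k c j) \<in> borel_measurable choices"
proof -
  have [measurable]: "(\<lambda>c. fourier_char j (to_circle (real (cell k c i) / real (N * M) ^ k))) \<in> borel_measurable choices" for i
    by (rule measurable_compose[OF measurable_cell]) simp
  show ?thesis unfolding cantor_coeff_def by measurable
qed

lemma nn_integral_cell_vec:
  "(\<integral>\<^sup>+c. F (cell_vec k c) \<partial>choices) = (\<Sum>v\<in>cell_vecs k. F v * emeasure choices {c. cell_vec k c = v})"
proof -
  have [measurable]: "{c. cell_vec k c = v} \<in> sets choices" for v
  proof -
    have "Measurable.pred choices (\<lambda>c. \<forall>i. (if i < N ^ k then cell k c i else 0) = v i)" by measurable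
    moreover have "cell_vec k c = v \<longleftrightarrow> (\<forall>i. (if i < N ^ k then cell k c i else 0) = v i)" for c
      by (simp only: cell_vec_def fun_eq_iff)
    ultimately show ?thesis by (simp add: pred_def)
  qed
  have "F (cell_vec k c) = (\<Sum>v\<in>cell_vecs k. F v * indicator {c. cell_vec k c = v} c)" for c
  proof -
    have "(\<Sum>v\<in>cell_vecs k. F v * indicator {c. cell_vec k c = v} c) = (\<Sum>v\<in>cell_vecs k. if v = cell_vec k c then F v else 0)"
      by (intro sum.cong) (auto simp: indicator_def)
    then show ?thesis using cell_vec_in[of k c] by (simp add: sum.delta finite_cell_vecs)
  qed
  then have "(\<integral>\<^sup>+c. F (cell_vec k c) \<partial>choices) = (\<integral>\<^sup>+c. (\<Sum>v\<in>cell_vecs k. F v * indicator {c. cell_vec k c = v} c) \<partial>choices)"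
    by simp
  also have "\<dots> = (\<Sum>v\<in>cell_vecs k. F v * emeasure choices {c. cell_vec k c = v})"
    by (simp add: nn_integral_sum nn_integral_cmult_indicator)
  finally show ?thesis .
qed

lemma nn_integral_exp_corr_mono:
  assumes "finite B" "A \<subseteq> B"
  shows "(\<integral>\<^sup>+c'. \<integral>\<^sup>+c. ennreal (exp (corr k A c c')) \<partial>choices \<partial>choices) \<le> (\<integral>\<^sup>+c'. \<integral>\<^sup>+c. ennreal (exp (corr k B c c')) \<partial>choices \<partial>choices)"
proof -
  interpret prob_space choices by (rule prob_space_choices)
  \<comment> \<open>One feature for the real and one for the imaginary part of each frequency, since
    \<open>Re (a * cnj b) = Re a * Re b + Im a * Im b\<close>.\<close>
  define f where "f p v = (if snd p then Re (vec_coeff k v (fst p)) else Im (vec_coeff k v (fst p)))" for p :: "int \<times> bool" and v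
  define q where "q v = prob {c. cell_vec k c = v}" for v
  have corr: "corr k A c c' = (\<Sum>p\<in>A \<times> UNIV. f p (cell_vec k c') * f p (cell_vec k c))" for A c c'
  proof -
    have "(\<Sum>p\<in>A \<times> UNIV. f p (cell_vec k c') * f p (cell_vec k c)) = (\<Sum>j\<in>A. \<Sum>t\<in>UNIV. f (j, t) (cell_vec k c') * f (j, t) (cell_vec k c))"
      unfolding sum.cartesian_product by (intro sum.cong refl) auto
    then show ?thesis
      unfolding corr_def cantor_coeff_eq by (simp add: UNIV_bool f_def mult.commute add.commute)
  qed
  have eq: "(\<integral>\<^sup>+c'. \<integral>\<^sup>+c. ennreal (exp (corr k A c c')) \<partial>choices \<partial>choices)
      = ennreal (\<Sum>v\<in>cell_vecs k. \<Sum>w\<in>cell_vecs k. q v * q w * exp (\<Sum>p\<in>A \<times> UNIV. f p v * f p w))" for A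
  proof -
    have "(\<integral>\<^sup>+c'. \<integral>\<^sup>+c. ennreal (exp (corr k A c c')) \<partial>choices \<partial>choices)
        = (\<Sum>v\<in>cell_vecs k. (\<Sum>w\<in>cell_vecs k. ennreal (exp (\<Sum>p\<in>A \<times> UNIV. f p v * f p w)) * ennreal (q w)) * ennreal (q v))"
      unfolding corr q_def emeasure_eq_measure[symmetric]
      by (simp only: nn_integral_cell_vec[of "\<lambda>w. ennreal (exp (\<Sum>p\<in>A \<times> UNIV. f p v * f p w))" k for v]
          nn_integral_cell_vec[of "\<lambda>v. \<Sum>w\<in>cell_vecs k. ennreal (exp (\<Sum>p\<in>A \<times> UNIV. f p v * f p w)) * emeasure choices {c. cell_vec k c = w}" k])
    also have "\<dots> = (\<Sum>v\<in>cell_vecs k. \<Sum>w\<in>cell_vecs k. ennreal (q v * q w * exp (\<Sum>p\<in>A \<times> UNIV. f p v * f p w)))"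
      unfolding sum_distrib_right by (intro sum.cong refl) (simp add: q_def ennreal_mult'[symmetric] mult_ac)
    also have "\<dots> = ennreal (\<Sum>v\<in>cell_vecs k. \<Sum>w\<in>cell_vecs k. q v * q w * exp (\<Sum>p\<in>A \<times> UNIV. f p v * f p w))"
      by (simp add: q_def sum_nonneg)
    finally show ?thesis .
  qed
  show ?thesis
    unfolding eq using assms by (intro ennreal_leI exp_gram_mono) auto
qed

abbreviation spectrum :: "(nat \<times> nat \<Rightarrow> nat) \<Rightarrow> int \<Rightarrow> complex"
  where "spectrum c \<equiv> fourier_transform (cantor_charge c)"

lemma measurable_spectrum [measurable]: "(\<lambda>c. spectrum c j) \<in> borel_measurable choices"
  by (rule borel_measurable_LIMSEQ_metric[OF measurable_cantor_coeff cantor_coeff_tendsto])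

text \<open>The window of frequencies is fixed while the level grows. As soon as the grid has more
  than \<open>2 * n + 1\<close> points, the window is part of a full period, where the correlation
  is explicit; Fatou's lemma, in both integrals, then passes from \<open>cantor_coeff\<close> to
  \<open>spectrum\<close>.\<close>

lemma exp_spectrum_corr_bounded:
  obtains K where "0 \<le> K" "\<And>n :: nat. (\<integral>\<^sup>+c'. \<integral>\<^sup>+c. ennreal (exp (\<Sum>j\<in>{- int n..int n}. Re (spectrum c j * cnj (spectrum c' j)))) \<partial>choices \<partial>choices) \<le> ennreal K"
proof -
  interpret C: prob_space choices by (rule prob_space_choices)
  obtain K0 where K0: "eventually (\<lambda>k. \<forall>c'. (\<integral>\<^sup>+c. ennreal (exp (ratio ^ k * real (card (common k c c')))) \<partial>choices) \<le> ennreal K0) sequentially"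
    using exp_common_bounded by blast
  define K where "K = max 0 K0"
  have "(\<integral>\<^sup>+c'. \<integral>\<^sup>+c. ennreal (exp (\<Sum>j\<in>{- int n..int n}. Re (spectrum c j * cnj (spectrum c' j)))) \<partial>choices \<partial>choices) \<le> ennreal K" for n :: nat
  proof -
    let ?A = "{- int n..int n}"
    have lim: "(\<lambda>k. ennreal (exp (corr k ?A c c'))) \<longlonglongrightarrow> ennreal (exp (\<Sum>j\<in>?A. Re (spectrum c j * cnj (spectrum c' j))))" for c c'
      unfolding corr_def by (intro tendsto_ennrealI tendsto_intros cantor_coeff_tendsto)
    have m1[measurable]: "(\<lambda>c. ennreal (exp (corr k ?A c c'))) \<in> borel_measurable choices" for k c'
      unfolding corr_def by measurable
    have [measurable]: "(\<lambda>x. cantor_coeff k (fst x) j) \<in> borel_measurable (choices \<Otimes>\<^sub>M choices)"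
      "(\<lambda>x. cantor_coeff k (snd x) j) \<in> borel_measurable (choices \<Otimes>\<^sub>M choices)"
      "(\<lambda>x. cnj (cantor_coeff k (fst x) j)) \<in> borel_measurable (choices \<Otimes>\<^sub>M choices)" for k j
      by (rule measurable_compose[OF measurable_fst measurable_cantor_coeff]
          measurable_compose[OF measurable_snd measurable_cantor_coeff]
          measurable_compose[OF measurable_compose[OF measurable_fst measurable_cantor_coeff]
            borel_measurable_continuous_onI[OF continuous_on_cnj[OF continuous_on_id]]])+
    have [measurable]: "(\<lambda>(c', c). ennreal (exp (corr k ?A c c'))) \<in> borel_measurable (choices \<Otimes>\<^sub>M choices)" for k
      unfolding corr_def by measurable
    have m2[measurable]: "(\<lambda>c'. \<integral>\<^sup>+c. ennreal (exp (corr k ?A c c')) \<partial>choices) \<in> borel_measurable choices" for k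
      by measurable
    have "(\<integral>\<^sup>+c'. \<integral>\<^sup>+c. ennreal (exp (\<Sum>j\<in>?A. Re (spectrum c j * cnj (spectrum c' j)))) \<partial>choices \<partial>choices)
        = (\<integral>\<^sup>+c'. \<integral>\<^sup>+c. liminf (\<lambda>k. ennreal (exp (corr k ?A c c'))) \<partial>choices \<partial>choices)"
      by (simp only: lim_imp_Liminf[OF trivial_limit_sequentially lim])
    also have "\<dots> \<le> (\<integral>\<^sup>+c'. liminf (\<lambda>k. \<integral>\<^sup>+c. ennreal (exp (corr k ?A c c')) \<partial>choices) \<partial>choices)"
      by (intro nn_integral_mono nn_integral_liminf m1)
    also have "\<dots> \<le> liminf (\<lambda>k. \<integral>\<^sup>+c'. \<integral>\<^sup>+c. ennreal (exp (corr k ?A c c')) \<partial>choices \<partial>choices)"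
      by (rule nn_integral_liminf[OF m2])
    also have "\<dots> \<le> liminf (\<lambda>k :: nat. ennreal K)"
    proof (rule Liminf_mono)
      have ev: "eventually (\<lambda>k. 1 / real (N * M) ^ k < 1 / real (2 * n + 1)) sequentially"
        by (rule order_tendstoD(2)[OF inverse_mesh_tendsto]) simp
      show "eventually (\<lambda>k. (\<integral>\<^sup>+c'. \<integral>\<^sup>+c. ennreal (exp (corr k ?A c c')) \<partial>choices \<partial>choices) \<le> ennreal K) sequentially"
        using K0 ev
      proof eventually_elim
        case (elim k)
        have "real (2 * n + 1) < real ((N * M) ^ k)"
          using elim(2) mesh_pos by (simp add: divide_less_eq pos_less_divide_eq del: of_nat_mult of_nat_add)
        then have "2 * n + 1 < (N * M) ^ k" by (simp only: of_nat_less_iff)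
        then have "int n + 1 \<le> int ((N * M) ^ k) - int n" by linarith
        then have sub: "?A \<subseteq> {- int n..<int ((N * M) ^ k) - int n}" by auto
        have "(\<integral>\<^sup>+c'. \<integral>\<^sup>+c. ennreal (exp (corr k ?A c c')) \<partial>choices \<partial>choices)
            \<le> (\<integral>\<^sup>+c'. \<integral>\<^sup>+c. ennreal (exp (corr k {- int n..<int ((N * M) ^ k) - int n} c c')) \<partial>choices \<partial>choices)"
          by (rule nn_integral_exp_corr_mono[OF _ sub]) simp
        also have "\<dots> \<le> (\<integral>\<^sup>+c'. ennreal K0 \<partial>choices)"
          unfolding corr_full using elim(1) by (intro nn_integral_mono) blast
        also have "\<dots> = ennreal K0" using C.emeasure_space_1 by simp
        also have "\<dots> \<le> ennreal K" by (rule ennreal_leI) (simp add: K_def)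
        finally show ?case .
      qed
    qed
    also have "\<dots> = ennreal K" by (simp add: Liminf_const)
    finally show ?thesis .
  qed
  then show ?thesis using that[of K] by (simp add: K_def)
qed

end

section \<open>Shifts of the noise\<close>

definition cylinder :: "int set \<Rightarrow> (int \<Rightarrow> complex) set \<Rightarrow> bool"
  where "cylinder F C \<longleftrightarrow> C \<in> sets borel \<and> (\<forall>y y'. (\<forall>j\<in>F. y j = y' j) \<longrightarrow> y \<in> C \<longrightarrow> y' \<in> C)"

lemma cylinder_mono: "cylinder F C \<Longrightarrow> F \<subseteq> G \<Longrightarrow> cylinder G C"
  unfolding cylinder_def by (meson subsetD)

lemma cylinder_iff:
  assumes "cylinder F C" "\<And>j. j \<in> F \<Longrightarrow> y j = y' j"
  shows "y \<in> C \<longleftrightarrow> y' \<in> C"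
  using assms unfolding cylinder_def by metis

lemma cylinder_Compl: "cylinder F C \<Longrightarrow> cylinder F (UNIV - C)"
  unfolding cylinder_def by (metis Diff_iff UNIV_I sets.compl_sets space_borel)

lemma cylinder_UN:
  assumes "finite I" "\<And>i. i \<in> I \<Longrightarrow> cylinder F (C i)"
  shows "cylinder F (\<Union>i\<in>I. C i)"
  unfolding cylinder_def
proof
  show "(\<Union>i\<in>I. C i) \<in> sets borel"
    using assms by (intro sets.finite_UN) (auto simp: cylinder_def)
  show "\<forall>y y'. (\<forall>j\<in>F. y j = y' j) \<longrightarrow> y \<in> (\<Union>i\<in>I. C i) \<longrightarrow> y' \<in> (\<Union>i\<in>I. C i)"
    using assms(2) unfolding cylinder_def by blast
qed

text \<open>The sets approximable in this sense form a sigma-algebra containing the one-coordinate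
  sets. The same \<open>C\<close> serves both measures, because it is to be inserted into an
  inequality that compares them.\<close>

lemma cylinder_approx:
  fixes \<nu>1 \<nu>2 :: "(int \<Rightarrow> complex) measure"
  assumes \<nu>: "finite_measure \<nu>1" "sets \<nu>1 = sets borel" "finite_measure \<nu>2" "sets \<nu>2 = sets borel"
    and B: "B \<in> sets borel" and \<epsilon>: "\<epsilon> > 0"
  shows "\<exists>(n :: nat) C. cylinder {- int n..int n} C \<and> measure \<nu>1 (sym_diff B C) + measure \<nu>2 (sym_diff B C) < \<epsilon>"
proof -
  interpret \<nu>1: finite_measure \<nu>1 by fact
  interpret \<nu>2: finite_measure \<nu>2 by fact
  note [measurable_cong] = \<nu>(2) \<nu>(4)
  have gen: "sets (borel :: (int \<Rightarrow> complex) measure) = sigma_sets UNIV {{y. y i \<in> A} |i A. A \<in> sets borel}"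
    unfolding sets_PiM_equal_borel[symmetric] sets_PiM_single by simp
  have "B \<in> sigma_sets UNIV {{y :: int \<Rightarrow> complex. y i \<in> A} |i A. A \<in> sets borel}"
    using B gen by simp
  then show ?thesis using \<epsilon>
  proof (induct arbitrary: \<epsilon> rule: sigma_sets.induct)
    case (Basic a)
    then obtain i A where a: "a = {y. y i \<in> A}" "A \<in> sets borel" by blast
    have "a \<in> sets borel" unfolding gen using Basic by (intro sigma_sets.Basic)
    then have "cylinder {- int (nat \<bar>i\<bar>)..int (nat \<bar>i\<bar>)} a"
      unfolding cylinder_def
    proof (intro conjI allI impI)
      fix y y' :: "int \<Rightarrow> complex"
      assume eq: "\<forall>j\<in>{- int (nat \<bar>i\<bar>)..int (nat \<bar>i\<bar>)}. y j = y' j" and y: "y \<in> a"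
      have "i \<in> {- int (nat \<bar>i\<bar>)..int (nat \<bar>i\<bar>)}" by auto
      with eq have "y i = y' i" by blast
      then show "y' \<in> a" using y by (simp add: a(1))
    qed
    then show ?case using Basic by (intro exI[of _ "nat \<bar>i\<bar>"] exI[of _ a]) simp
  next
    case Empty
    have "cylinder {- int 0..int 0} {}" by (simp add: cylinder_def)
    then show ?case using Empty by (intro exI[of _ 0] exI[of _ "{}"]) simp
  next
    case (Compl a)
    then obtain n :: nat and C where C: "cylinder {- int n..int n} C" "measure \<nu>1 (sym_diff a C) + measure \<nu>2 (sym_diff a C) < \<epsilon>" by blast
    have "sym_diff (UNIV - a) (UNIV - C) = sym_diff a C" by auto
    then show ?case using C(2) cylinder_Compl[OF C(1)] by metis
  next
    case (Union a)
    have a: "a i \<in> sets borel" for i using Union(1) gen by simp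
    \<comment> \<open>Half of \<open>\<epsilon>\<close> is distributed geometrically over the
      approximations of the single sets; the other half is kept for the tail of the union.\<close>
    define e where "e i = (\<epsilon> / 2) * (1 / 2) ^ Suc i" for i :: nat
    have e: "e i > 0" for i using Union(3) by (simp add: e_def)
    have "\<forall>i. \<exists>(n :: nat) C. cylinder {- int n..int n} C \<and> measure \<nu>1 (sym_diff (a i) C) + measure \<nu>2 (sym_diff (a i) C) < e i"
      using Union(2) e by blast
    then obtain n C where nC: "\<And>i. cylinder {- int (n i)..int (n i :: nat)} (C i)"
      "\<And>i. measure \<nu>1 (sym_diff (a i) (C i)) + measure \<nu>2 (sym_diff (a i) (C i)) < e i"
      by metis
    have C_sets: "C i \<in> sets borel" for i using nC(1)[of i] by (simp add: cylinder_def)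
    let ?U = "\<Union>i. a i"
    have lim: "(\<lambda>m. measure \<nu> (?U - (\<Union>i<m. a i))) \<longlonglongrightarrow> 0" if fin: "finite_measure \<nu>" and s: "sets \<nu> = sets borel" for \<nu>
    proof -
      interpret finite_measure \<nu> by fact
      have "(\<lambda>m. measure \<nu> (\<Union>i<m. a i)) \<longlonglongrightarrow> measure \<nu> (\<Union>m. \<Union>i<m. a i)"
      proof (rule finite_Lim_measure_incseq)
        show "incseq (\<lambda>m. \<Union>i<m. a i)" by (rule incseq_SucI) (auto simp: less_Suc_eq)
      qed (use a s in \<open>auto intro!: sets.finite_UN\<close>)
      also have "(\<Union>m. \<Union>i<m. a i) = ?U" by auto
      finally have "(\<lambda>m. measure \<nu> ?U - measure \<nu> (\<Union>i<m. a i)) \<longlonglongrightarrow> measure \<nu> ?U - measure \<nu> ?U"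
        by (intro tendsto_intros)
      moreover have "measure \<nu> (?U - (\<Union>i<m. a i)) = measure \<nu> ?U - measure \<nu> (\<Union>i<m. a i)" for m
        using a s by (intro finite_measure_Diff) (auto intro!: sets.finite_UN sets.countable_UN)
      ultimately show ?thesis by simp
    qed
    have "(\<lambda>m. measure \<nu>1 (?U - (\<Union>i<m. a i)) + measure \<nu>2 (?U - (\<Union>i<m. a i))) \<longlonglongrightarrow> 0 + 0"
      by (intro tendsto_add lim \<nu>)
    then have "eventually (\<lambda>m. measure \<nu>1 (?U - (\<Union>i<m. a i)) + measure \<nu>2 (?U - (\<Union>i<m. a i)) < \<epsilon> / 2) sequentially"
      using Union(3) by (intro order_tendstoD(2)) auto
    then obtain m where m: "measure \<nu>1 (?U - (\<Union>i<m. a i)) + measure \<nu>2 (?U - (\<Union>i<m. a i)) < \<epsilon> / 2"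
      by (auto dest: eventually_happens)
    define D where "D = (\<Union>i<m. C i)"
    define n' where "n' = Max (insert 0 (n ` {..<m}))"
    have "cylinder {- int n'..int n'} D"
      unfolding D_def
    proof (rule cylinder_UN)
      fix i assume "i \<in> {..<m}"
      then have "n i \<le> n'" by (simp add: n'_def)
      then show "cylinder {- int n'..int n'} (C i)" by (intro cylinder_mono[OF nC(1)]) auto
    qed simp
    moreover have "measure \<nu>1 (sym_diff ?U D) + measure \<nu>2 (sym_diff ?U D) < \<epsilon>"
    proof -
      have bound: "measure \<nu> (sym_diff ?U D) \<le> measure \<nu> (?U - (\<Union>i<m. a i)) + (\<Sum>i<m. measure \<nu> (sym_diff (a i) (C i)))"
        if fin: "finite_measure \<nu>" and s: "sets \<nu> = sets borel" for \<nu>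
      proof -
        interpret finite_measure \<nu> by fact
        have sets1: "?U - (\<Union>i<m. a i) \<in> sets \<nu>" "(\<Union>i<m. sym_diff (a i) (C i)) \<in> sets \<nu>"
          using a C_sets s by (auto intro!: sets.finite_UN sets.countable_UN sets.Diff sets.Un)
        have "measure \<nu> (sym_diff ?U D) \<le> measure \<nu> ((?U - (\<Union>i<m. a i)) \<union> (\<Union>i<m. sym_diff (a i) (C i)))"
          using sets1 by (intro finite_measure_mono) (auto simp: D_def)
        also have "\<dots> \<le> measure \<nu> (?U - (\<Union>i<m. a i)) + measure \<nu> (\<Union>i<m. sym_diff (a i) (C i))"
          by (rule measure_Un_le[OF sets1])
        also have "measure \<nu> (\<Union>i<m. sym_diff (a i) (C i)) \<le> (\<Sum>i<m. measure \<nu> (sym_diff (a i) (C i)))"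
          using a C_sets s by (intro measure_UNION_le) auto
        finally show ?thesis by simp
      qed
      have "(\<Sum>i<m. measure \<nu>1 (sym_diff (a i) (C i))) + (\<Sum>i<m. measure \<nu>2 (sym_diff (a i) (C i))) \<le> (\<Sum>i<m. e i)"
        unfolding sum.distrib[symmetric] using nC(2) by (intro sum_mono less_imp_le)
      also have "\<dots> \<le> \<epsilon> / 2"
      proof -
        have "e sums (\<epsilon> / 2 * 1)" unfolding e_def by (rule sums_mult[OF power_half_series])
        then show ?thesis using sum_le_suminf[of e "{..<m}"] e
          by (simp add: sums_iff less_imp_le)
      qed
      finally show ?thesis using bound[OF \<nu>(1,2)] bound[OF \<nu>(3,4)] m by linarith
    qed
    ultimately show ?case by blast
  qed
qed

context complex_gaussian
begin

lemma measurable_shifted_noise [measurable]: "(\<lambda>\<omega> n. x n + \<xi> n \<omega>) \<in> P \<rightarrow>\<^sub>M borel"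
  by (rule measurable_coordinatewise_then_product) measurable

lemma measurable_noise_seq [measurable]: "(\<lambda>\<omega> n. \<xi> n \<omega>) \<in> P \<rightarrow>\<^sub>M borel"
  by (rule measurable_coordinatewise_then_product) measurable

text \<open>The Cameron-Martin likelihood ratio on the frequencies in \<open>F\<close>, as a
  function on the probability space of the noise.\<close>

definition shift_density :: "int set \<Rightarrow> (int \<Rightarrow> complex) \<Rightarrow> 'w \<Rightarrow> real"
  where "shift_density F x \<omega> = exp (\<Sum>j\<in>F. Re (\<xi> j \<omega> * cnj (x j)) - (norm (x j))\<^sup>2 / 2)"

lemma measurable_shift_density [measurable]: "shift_density F x \<in> borel_measurable P"
  unfolding shift_density_def[abs_def] by measurable

text \<open>The one-frequency formula, multiplied over independent frequencies; off \<open>F\<close>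
  the shift vanishes and the factor is 1.\<close>

lemma emeasure_shifted_box:
  assumes F: "finite F" and J: "finite J" and A: "\<And>j. j \<in> J \<Longrightarrow> A j \<in> sets borel"
    and x: "\<And>j. j \<notin> F \<Longrightarrow> x j = 0"
  shows "emeasure P {\<omega>\<in>space P. \<forall>j\<in>J. x j + \<xi> j \<omega> \<in> A j}
    = (\<integral>\<^sup>+\<omega>. ennreal (shift_density F x \<omega>) * indicator {\<omega>\<in>space P. \<forall>j\<in>J. \<xi> j \<omega> \<in> A j} \<omega> \<partial>P)"
proof -
  let ?G = "F \<union> J"
  have G: "finite ?G" using F J by simp
  define h where "h j z = (indicator (if j \<in> J then A j else UNIV) z :: ennreal)" for j and z :: complex
  have hm[measurable]: "h j \<in> borel_measurable borel" for j
    unfolding h_def[abs_def] using A by (cases "j \<in> J") auto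
  have prod_h: "(\<Prod>j\<in>?G. h j (y j)) = indicator {y. \<forall>j\<in>J. y j \<in> A j} y" for y
  proof (cases "\<forall>j\<in>J. y j \<in> A j")
    case True
    then have "h j (y j) = 1" for j by (simp add: h_def)
    then show ?thesis using True by simp
  next
    case False
    then obtain j where "j \<in> J" "y j \<notin> A j" by blast
    then have "j \<in> ?G" "h j (y j) = 0" by (auto simp: h_def)
    then show ?thesis using False G by (auto simp: prod_zero_iff)
  qed
  have boxes[measurable]: "{\<omega>\<in>space P. \<forall>j\<in>J. x j + \<xi> j \<omega> \<in> A j} \<in> sets P" for x
    using A J by (intro sets.sets_Collect_finite_All) auto
  have "emeasure P {\<omega>\<in>space P. \<forall>j\<in>J. x j + \<xi> j \<omega> \<in> A j} = (\<integral>\<^sup>+\<omega>. (\<Prod>j\<in>?G. h j (x j + \<xi> j \<omega>)) \<partial>P)"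
  proof -
    have "emeasure P {\<omega>\<in>space P. \<forall>j\<in>J. x j + \<xi> j \<omega> \<in> A j} = (\<integral>\<^sup>+\<omega>. indicator {\<omega>\<in>space P. \<forall>j\<in>J. x j + \<xi> j \<omega> \<in> A j} \<omega> \<partial>P)"
      by (rule nn_integral_indicator[symmetric]) measurable
    also have "\<dots> = (\<integral>\<^sup>+\<omega>. (\<Prod>j\<in>?G. h j (x j + \<xi> j \<omega>)) \<partial>P)"
    proof (rule nn_integral_cong)
      fix \<omega> assume "\<omega> \<in> space P"
      then show "indicator {\<omega>\<in>space P. \<forall>j\<in>J. x j + \<xi> j \<omega> \<in> A j} \<omega> = (\<Prod>j\<in>?G. h j (x j + \<xi> j \<omega>))"
        unfolding prod_h[of "\<lambda>j. x j + \<xi> j \<omega>"] by (simp add: indicator_def)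
    qed
    finally show ?thesis .
  qed
  also have "\<dots> = (\<Prod>j\<in>?G. \<integral>\<^sup>+\<omega>. h j (x j + \<xi> j \<omega>) \<partial>P)"
    by (rule nn_integral_noise_prod[OF G, of "\<lambda>j z. h j (x j + z)"]) measurable
  also have "\<dots> = (\<Prod>j\<in>?G. \<integral>\<^sup>+\<omega>. h j (\<xi> j \<omega>) * ennreal (exp (Re (\<xi> j \<omega> * cnj (x j)) - (norm (x j))\<^sup>2 / 2)) \<partial>P)"
    by (intro prod.cong refl nn_integral_noise_shift hm)
  also have "\<dots> = (\<integral>\<^sup>+\<omega>. (\<Prod>j\<in>?G. h j (\<xi> j \<omega>) * ennreal (exp (Re (\<xi> j \<omega> * cnj (x j)) - (norm (x j))\<^sup>2 / 2))) \<partial>P)"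
    by (rule nn_integral_noise_prod[OF G, of "\<lambda>j z. h j z * ennreal (exp (Re (z * cnj (x j)) - (norm (x j))\<^sup>2 / 2))", symmetric]) measurable
  also have "\<dots> = (\<integral>\<^sup>+\<omega>. ennreal (shift_density F x \<omega>) * indicator {\<omega>\<in>space P. \<forall>j\<in>J. \<xi> j \<omega> \<in> A j} \<omega> \<partial>P)"
  proof (rule nn_integral_cong)
    fix \<omega> assume \<omega>: "\<omega> \<in> space P"
    have "(\<Prod>j\<in>?G. ennreal (exp (Re (\<xi> j \<omega> * cnj (x j)) - (norm (x j))\<^sup>2 / 2))) = ennreal (exp (\<Sum>j\<in>?G. Re (\<xi> j \<omega> * cnj (x j)) - (norm (x j))\<^sup>2 / 2))"
      by (subst prod_ennreal) (simp_all add: exp_sum[OF G])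
    also have "(\<Sum>j\<in>?G. Re (\<xi> j \<omega> * cnj (x j)) - (norm (x j))\<^sup>2 / 2) = (\<Sum>j\<in>F. Re (\<xi> j \<omega> * cnj (x j)) - (norm (x j))\<^sup>2 / 2)"
      using G x by (intro sum.mono_neutral_right) auto
    finally show "(\<Prod>j\<in>?G. h j (\<xi> j \<omega>) * ennreal (exp (Re (\<xi> j \<omega> * cnj (x j)) - (norm (x j))\<^sup>2 / 2)))
        = ennreal (shift_density F x \<omega>) * indicator {\<omega>\<in>space P. \<forall>j\<in>J. \<xi> j \<omega> \<in> A j} \<omega>"
      using \<omega> unfolding prod.distrib prod_h[of "\<lambda>j. \<xi> j \<omega>"] shift_density_def
      by (simp add: indicator_def mult.commute)
  qed
  finally show ?thesis .
qed

text \<open>Finite-dimensional boxes determine a finite measure on sequences, so the identity for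
  boxes extends to the laws.\<close>

lemma distr_shifted_noise:
  assumes F: "finite F" and x: "\<And>j. j \<notin> F \<Longrightarrow> x j = 0"
  shows "distr P borel (\<lambda>\<omega> n. x n + \<xi> n \<omega>) = distr (density P (shift_density F x)) borel (\<lambda>\<omega> n. \<xi> n \<omega>)"
proof (rule measure_eqI_PiM_infinite[where I = UNIV and M = "\<lambda>_. borel"])
  show "finite_measure (distr P borel (\<lambda>\<omega> n. x n + \<xi> n \<omega>))"
    by (rule finite_measure_distr) measurable
  fix A :: "int \<Rightarrow> complex set" and J :: "int set" assume J: "finite J" and A: "\<And>i. i \<in> J \<Longrightarrow> A i \<in> sets borel"
  have emb: "prod_emb UNIV (\<lambda>_. borel) J (Pi\<^sub>E J A) = {y. \<forall>j\<in>J. y j \<in> A j}"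
    by (auto simp: prod_emb_def PiE_iff)
  have [measurable]: "{y :: int \<Rightarrow> complex. \<forall>j\<in>J. y j \<in> A j} \<in> sets borel"
  proof -
    have "{y :: int \<Rightarrow> complex. \<forall>j\<in>J. y j \<in> A j} = {y \<in> space borel. \<forall>j\<in>J. y j \<in> A j}" by simp
    also have "\<dots> \<in> sets borel"
    proof (rule sets.sets_Collect_finite_All[OF _ J])
      fix j assume "j \<in> J"
      have "(\<lambda>y :: int \<Rightarrow> complex. y j) \<in> borel_measurable borel"
        by (rule measurable_product_then_coordinatewise) simp
      from measurable_sets[OF this A[OF \<open>j \<in> J\<close>]] show "{y \<in> space borel. y j \<in> A j} \<in> sets borel"
        by (simp add: vimage_def)
    qed
    finally show ?thesis .
  qed
  have "emeasure (distr P borel (\<lambda>\<omega> n. x n + \<xi> n \<omega>)) {y. \<forall>j\<in>J. y j \<in> A j} = emeasure P {\<omega>\<in>space P. \<forall>j\<in>J. x j + \<xi> j \<omega> \<in> A j}"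
    by (subst emeasure_distr) (auto intro!: arg_cong[where f = "emeasure P"])
  also have "\<dots> = (\<integral>\<^sup>+\<omega>. ennreal (shift_density F x \<omega>) * indicator {\<omega>\<in>space P. \<forall>j\<in>J. \<xi> j \<omega> \<in> A j} \<omega> \<partial>P)"
    by (rule emeasure_shifted_box[OF F J A x])
  also have "\<dots> = emeasure (distr (density P (shift_density F x)) borel (\<lambda>\<omega> n. \<xi> n \<omega>)) {y. \<forall>j\<in>J. y j \<in> A j}"
  proof -
    have eq: "(\<lambda>\<omega> n. \<xi> n \<omega>) -` {y. \<forall>j\<in>J. y j \<in> A j} \<inter> space P = {\<omega>\<in>space P. \<forall>j\<in>J. \<xi> j \<omega> \<in> A j}" by auto
    have "{\<omega>\<in>space P. \<forall>j\<in>J. \<xi> j \<omega> \<in> A j} \<in> sets P"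
      unfolding eq[symmetric] by (rule measurable_sets[OF measurable_noise_seq]) measurable
    then have "(\<integral>\<^sup>+\<omega>. ennreal (shift_density F x \<omega>) * indicator {\<omega>\<in>space P. \<forall>j\<in>J. \<xi> j \<omega> \<in> A j} \<omega> \<partial>P)
        = emeasure (density P (shift_density F x)) {\<omega>\<in>space P. \<forall>j\<in>J. \<xi> j \<omega> \<in> A j}"
      by (intro emeasure_density[symmetric]) simp_all
    also have "\<dots> = emeasure (density P (shift_density F x)) ((\<lambda>\<omega> n. \<xi> n \<omega>) -` {y. \<forall>j\<in>J. y j \<in> A j} \<inter> space (density P (shift_density F x)))"
      by (simp only: space_density eq)
    also have "\<dots> = emeasure (distr (density P (shift_density F x)) borel (\<lambda>\<omega> n. \<xi> n \<omega>)) {y. \<forall>j\<in>J. y j \<in> A j}"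
      by (rule emeasure_distr[symmetric]) simp_all
    finally show ?thesis .
  qed
  finally show "emeasure (distr P borel (\<lambda>\<omega> n. x n + \<xi> n \<omega>)) (prod_emb UNIV (\<lambda>_. borel) J (Pi\<^sub>E J A))
      = emeasure (distr (density P (shift_density F x)) borel (\<lambda>\<omega> n. \<xi> n \<omega>)) (prod_emb UNIV (\<lambda>_. borel) J (Pi\<^sub>E J A))"
    unfolding emb .
qed (simp_all add: sets_PiM_equal_borel)

text \<open>A cylinder does not see \<open>x\<close> outside \<open>F\<close>, so \<open>x\<close>
  may be truncated there. Thus arbitrary shifts are covered, also those that are not square
  summable.\<close>

lemma emeasure_shifted_cylinder:
  assumes F: "finite F" and C: "cylinder F C"
  shows "emeasure P {\<omega>\<in>space P. (\<lambda>n. x n + \<xi> n \<omega>) \<in> C}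
    = (\<integral>\<^sup>+\<omega>. ennreal (shift_density F x \<omega>) * indicator C (\<lambda>n. \<xi> n \<omega>) \<partial>P)"
proof -
  define y where "y j = (if j \<in> F then x j else 0)" for j
  have C_sets[measurable]: "C \<in> sets borel" using C by (simp add: cylinder_def)
  have eq: "(\<lambda>\<omega> n. \<xi> n \<omega>) -` C \<inter> space P = {\<omega>\<in>space P. (\<lambda>n. \<xi> n \<omega>) \<in> C}" by auto
  have sC[measurable]: "{\<omega>\<in>space P. (\<lambda>n. \<xi> n \<omega>) \<in> C} \<in> sets P"
    unfolding eq[symmetric] by (rule measurable_sets[OF measurable_noise_seq C_sets])
  have "{\<omega>\<in>space P. (\<lambda>n. x n + \<xi> n \<omega>) \<in> C} = (\<lambda>\<omega> n. y n + \<xi> n \<omega>) -` C \<inter> space P"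
    using cylinder_iff[OF C, of "\<lambda>n. x n + \<xi> n _" "\<lambda>n. y n + \<xi> n _"] by (auto simp: y_def)
  then have "emeasure P {\<omega>\<in>space P. (\<lambda>n. x n + \<xi> n \<omega>) \<in> C} = emeasure (distr P borel (\<lambda>\<omega> n. y n + \<xi> n \<omega>)) C"
    by (simp add: emeasure_distr)
  also have "\<dots> = emeasure (distr (density P (shift_density F y)) borel (\<lambda>\<omega> n. \<xi> n \<omega>)) C"
    by (subst distr_shifted_noise[OF F]) (simp_all add: y_def)
  also have "\<dots> = (\<integral>\<^sup>+\<omega>. ennreal (shift_density F y \<omega>) * indicator {\<omega>\<in>space P. (\<lambda>n. \<xi> n \<omega>) \<in> C} \<omega> \<partial>P)"
    by (subst emeasure_distr) (simp_all add: eq emeasure_density)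
  also have "\<dots> = (\<integral>\<^sup>+\<omega>. ennreal (shift_density F x \<omega>) * indicator C (\<lambda>n. \<xi> n \<omega>) \<partial>P)"
    by (intro nn_integral_cong) (simp add: shift_density_def y_def indicator_def)
  finally show ?thesis .
qed

text \<open>Half of \<open>norm (x + y) ^ 2\<close>, from the Gaussian moment, minus the halves of
  \<open>norm x ^ 2\<close> and \<open>norm y ^ 2\<close>, from the two normalisations, leaves the
  cross term.\<close>

lemma nn_integral_shift_density_mult:
  assumes F: "finite F"
  shows "(\<integral>\<^sup>+\<omega>. ennreal (shift_density F x \<omega>) * ennreal (shift_density F y \<omega>) \<partial>P)
    = ennreal (exp (\<Sum>j\<in>F. Re (x j * cnj (y j))))"
proof -
  define s where "s = (\<Sum>j\<in>F. (norm (x j))\<^sup>2 / 2 + (norm (y j))\<^sup>2 / 2)"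
  have "shift_density F x \<omega> * shift_density F y \<omega> = exp (- s) * exp (Re (\<Sum>j\<in>F. cnj (x j + y j) * \<xi> j \<omega>))" for \<omega>
  proof -
    have "(\<Sum>j\<in>F. Re (\<xi> j \<omega> * cnj (x j)) - (norm (x j))\<^sup>2 / 2) + (\<Sum>j\<in>F. Re (\<xi> j \<omega> * cnj (y j)) - (norm (y j))\<^sup>2 / 2)
        = - s + Re (\<Sum>j\<in>F. cnj (x j + y j) * \<xi> j \<omega>)"
      unfolding s_def Re_sum sum_negf[symmetric] sum.distrib[symmetric]
      by (intro sum.cong refl) (simp add: algebra_simps)
    then show ?thesis unfolding shift_density_def exp_add[symmetric] by simp
  qed
  then have "(\<integral>\<^sup>+\<omega>. ennreal (shift_density F x \<omega>) * ennreal (shift_density F y \<omega>) \<partial>P)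
      = (\<integral>\<^sup>+\<omega>. ennreal (exp (- s)) * ennreal (exp (Re (\<Sum>j\<in>F. cnj (x j + y j) * \<xi> j \<omega>))) \<partial>P)"
    by (intro nn_integral_cong) (simp add: ennreal_mult'[symmetric] shift_density_def)
  also have "\<dots> = ennreal (exp (- s)) * ennreal (exp ((\<Sum>j\<in>F. (norm (cnj (x j + y j)))\<^sup>2) / 2))"
    by (subst nn_integral_cmult) (simp_all only: noise_exp_moment[OF F], measurable)
  also have "\<dots> = ennreal (exp (- s + (\<Sum>j\<in>F. (norm (cnj (x j + y j)))\<^sup>2) / 2))"
    by (subst ennreal_mult'[symmetric]) (simp_all only: exp_add exp_ge_zero)
  also have "- s + (\<Sum>j\<in>F. (norm (cnj (x j + y j)))\<^sup>2) / 2 = (\<Sum>j\<in>F. Re (x j * cnj (y j)))"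
    unfolding s_def sum_divide_distrib sum_negf[symmetric] sum.distrib[symmetric]
    by (intro sum.cong refl)
      (simp only: complex_mod_cnj cmod_power2 plus_complex.sel, simp add: power2_eq_square field_simps)
  finally show ?thesis .
qed

end

section \<open>Non-detection\<close>

text \<open>This is \<open>0 \<le> (2 * a - L) ^ 2\<close> divided by \<open>4 * a\<close>.\<close>

lemma le_AM_GM_ennreal:
  fixes L :: ennreal
  assumes a: "a > 0"
  shows "L \<le> ennreal a + ennreal (1 / (4 * a)) * (L * L)"
proof (cases L rule: ennreal_cases)
  case (real l)
  have "l \<le> a + 1 / (4 * a) * (l * l)"
  proof -
    have "0 \<le> (2 * a - l)\<^sup>2 / (4 * a)" using a by simp
    also have "\<dots> = a + 1 / (4 * a) * (l * l) - l"
      using a by (simp add: power2_eq_square field_simps)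
    finally show ?thesis by simp
  qed
  then have "ennreal l \<le> ennreal (a + 1 / (4 * a) * (l * l))" by (rule ennreal_leI)
  also have "ennreal (a + 1 / (4 * a) * (l * l)) = ennreal a + ennreal (1 / (4 * a) * (l * l))"
    using a real(1) by (intro ennreal_plus) auto
  also have "ennreal (1 / (4 * a) * (l * l)) = ennreal (1 / (4 * a)) * (ennreal l * ennreal l)"
    using a real(1) by (simp only: ennreal_mult' zero_le_divide_1_iff mult_nonneg_nonneg zero_le_numeral less_imp_le)
  finally show ?thesis unfolding real(2) .
next
  case top
  then show ?thesis using a by (simp add: ennreal_mult_top ennreal_top_mult)
qed

context complex_gaussian
begin

context
  fixes N M :: nat and \<alpha> :: real
  assumes cantor: "random_cantor N M" and \<alpha>: "0 < \<alpha>" and dim: "real N < real (N * M) powr \<alpha>"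
begin

interpretation random_cantor N M by (rule cantor)
interpretation C: prob_space choices by (rule prob_space_choices)
interpretation CP: pair_sigma_finite choices P ..

lemma measurable_joint_density:
  "(\<lambda>(c, \<omega>). ennreal (shift_density F (spectrum c) \<omega>)) \<in> borel_measurable (choices \<Otimes>\<^sub>M P)"
proof -
  have [measurable]: "(\<lambda>x. spectrum (fst x) j) \<in> borel_measurable (choices \<Otimes>\<^sub>M P)"
    "(\<lambda>x. \<xi> j (snd x)) \<in> borel_measurable (choices \<Otimes>\<^sub>M P)"
    "(\<lambda>x. cnj (spectrum (fst x) j)) \<in> borel_measurable (choices \<Otimes>\<^sub>M P)" for j
    by (rule measurable_compose[OF measurable_fst measurable_spectrum]
        measurable_compose[OF measurable_snd measurable_noise]
        measurable_compose[OF measurable_compose[OF measurable_fst measurable_spectrum]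
          borel_measurable_continuous_onI[OF continuous_on_cnj[OF continuous_on_id]]])+
  show ?thesis unfolding shift_density_def split_beta by measurable
qed

definition mixture :: "(int \<Rightarrow> complex) measure"
  where "mixture = distr (choices \<Otimes>\<^sub>M P) borel (\<lambda>(c, \<omega>) n. spectrum c n + \<xi> n \<omega>)"

lemma measurable_mixture_map: "(\<lambda>(c, \<omega>) n. spectrum c n + \<xi> n \<omega>) \<in> choices \<Otimes>\<^sub>M P \<rightarrow>\<^sub>M borel"
  unfolding split_beta
proof (rule measurable_coordinatewise_then_product)
  fix n
  have [measurable]: "(\<lambda>x. spectrum (fst x) n) \<in> borel_measurable (choices \<Otimes>\<^sub>M P)"
    "(\<lambda>x. \<xi> n (snd x)) \<in> borel_measurable (choices \<Otimes>\<^sub>M P)"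
    by (rule measurable_compose[OF measurable_fst measurable_spectrum]
        measurable_compose[OF measurable_snd measurable_noise])+
  show "(\<lambda>x. spectrum (fst x) n + \<xi> n (snd x)) \<in> borel_measurable (choices \<Otimes>\<^sub>M P)" by measurable
qed

lemma prob_space_mixture: "prob_space mixture"
  unfolding mixture_def
  by (intro prob_space.prob_space_distr measurable_mixture_map prob_space_pair prob_space_choices prob_space_axioms)

lemma emeasure_mixture:
  assumes B: "B \<in> sets borel"
  shows "emeasure mixture B = (\<integral>\<^sup>+c. emeasure P {\<omega>\<in>space P. (\<lambda>n. spectrum c n + \<xi> n \<omega>) \<in> B} \<partial>choices)"
proof -
  let ?S = "(\<lambda>(c, \<omega>) n. spectrum c n + \<xi> n \<omega>) -` B \<inter> space (choices \<Otimes>\<^sub>M P)"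
  have S: "?S \<in> sets (choices \<Otimes>\<^sub>M P)" by (rule measurable_sets[OF measurable_mixture_map B])
  have "emeasure mixture B = emeasure (choices \<Otimes>\<^sub>M P) ?S"
    unfolding mixture_def by (rule emeasure_distr[OF measurable_mixture_map B])
  also have "\<dots> = (\<integral>\<^sup>+c. emeasure P (Pair c -` ?S) \<partial>choices)"
    by (rule emeasure_pair_measure_alt[OF S])
  also have "\<dots> = (\<integral>\<^sup>+c. emeasure P {\<omega>\<in>space P. (\<lambda>n. spectrum c n + \<xi> n \<omega>) \<in> B} \<partial>choices)"
    by (intro nn_integral_cong arg_cong[where f = "emeasure P"]) (auto simp: space_pair_measure)
  finally show ?thesis .
qed

text \<open>By \<open>L \<le> a + L\<^sup>2 / (4 a)\<close> this reduces to the second moment of the likelihood ratio \<open>L\<close>.\<close>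

lemma mixture_cylinder_le:
  obtains K where "0 \<le> K" "\<And>a (n :: nat) C. a > 0 \<Longrightarrow> cylinder {- int n..int n} C \<Longrightarrow>
    emeasure mixture C \<le> ennreal a * emeasure P {\<omega>\<in>space P. (\<lambda>n. \<xi> n \<omega>) \<in> C} + ennreal (K / (4 * a))"
proof -
  obtain K where K: "0 \<le> K" "\<And>n :: nat. (\<integral>\<^sup>+c'. \<integral>\<^sup>+c. ennreal (exp (\<Sum>j\<in>{- int n..int n}. Re (spectrum c j * cnj (spectrum c' j)))) \<partial>choices \<partial>choices) \<le> ennreal K"
    using exp_spectrum_corr_bounded by blast
  have "emeasure mixture C \<le> ennreal a * emeasure P {\<omega>\<in>space P. (\<lambda>n. \<xi> n \<omega>) \<in> C} + ennreal (K / (4 * a))"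
    if a: "a > 0" and C: "cylinder {- int n..int n} C" for a and n :: nat and C
  proof -
    let ?F = "{- int n..int n}"
    let ?D = "\<lambda>c \<omega>. ennreal (shift_density ?F (spectrum c) \<omega>)"
    let ?I = "\<lambda>\<omega>. indicator C (\<lambda>n. \<xi> n \<omega>) :: ennreal"
    \<comment> \<open>The likelihood ratio of the mixture on the window \<open>?F\<close>. Below,
      \<open>L\<close> times \<open>L\<close> is written as an average over two independent copies
      \<open>c\<close> and \<open>c'\<close>; after exchanging integrals, the noise is integrated
      out first.\<close>
    define L where "L \<omega> = (\<integral>\<^sup>+c. ?D c \<omega> \<partial>choices)" for \<omega>
    have C_sets[measurable]: "C \<in> sets borel" using C by (simp add: cylinder_def)
    have Cm[measurable]: "?I \<in> borel_measurable P"
      by (rule measurable_compose[OF measurable_noise_seq borel_measurable_indicator[OF C_sets]])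
    have Dm[measurable]: "(\<lambda>(c, \<omega>). ?D c \<omega>) \<in> borel_measurable (choices \<Otimes>\<^sub>M P)" by (rule measurable_joint_density)
    have Dc[measurable]: "(\<lambda>c. ?D c \<omega>) \<in> borel_measurable choices" if "\<omega> \<in> space P" for \<omega>
      using measurable_compose[OF measurable_Pair2'[OF that] Dm] by simp
    have D\<omega>[measurable]: "(\<lambda>\<omega>. ?D c \<omega>) \<in> borel_measurable P" for c by measurable
    have Dm': "(\<lambda>(\<omega>, c). ?D c \<omega>) \<in> borel_measurable (P \<Otimes>\<^sub>M choices)"
      using measurable_compose[OF measurable_pair_swap' Dm] by (simp add: split_beta)
    have Lm[measurable]: "L \<in> borel_measurable P"
      unfolding L_def[abs_def] by (rule C.borel_measurable_nn_integral[OF Dm'])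
    have IDm: "(\<lambda>(c, \<omega>). ?D c \<omega> * ?I \<omega>) \<in> borel_measurable (choices \<Otimes>\<^sub>M P)"
    proof -
      have "(\<lambda>x. ?I (snd x)) \<in> borel_measurable (choices \<Otimes>\<^sub>M P)" by (rule measurable_compose[OF measurable_snd Cm])
      then show ?thesis using Dm unfolding split_beta by (intro borel_measurable_times_ennreal)
    qed
    have "emeasure mixture C = (\<integral>\<^sup>+c. \<integral>\<^sup>+\<omega>. ?D c \<omega> * ?I \<omega> \<partial>P \<partial>choices)"
      unfolding emeasure_mixture[OF C_sets] by (subst emeasure_shifted_cylinder[OF _ C]) simp_all
    also have "\<dots> = (\<integral>\<^sup>+\<omega>. \<integral>\<^sup>+c. ?D c \<omega> * ?I \<omega> \<partial>choices \<partial>P)"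
      by (rule CP.Fubini'[OF IDm, symmetric])
    also have "\<dots> = (\<integral>\<^sup>+\<omega>. L \<omega> * ?I \<omega> \<partial>P)"
      unfolding L_def by (intro nn_integral_cong nn_integral_multc Dc)
    also have "\<dots> \<le> (\<integral>\<^sup>+\<omega>. ennreal a * ?I \<omega> + ennreal (1 / (4 * a)) * (L \<omega> * L \<omega>) \<partial>P)"
    proof (rule nn_integral_mono)
      fix \<omega>
      show "L \<omega> * ?I \<omega> \<le> ennreal a * ?I \<omega> + ennreal (1 / (4 * a)) * (L \<omega> * L \<omega>)"
        using le_AM_GM_ennreal[OF a, of "L \<omega>"] by (cases "(\<lambda>n. \<xi> n \<omega>) \<in> C") simp_all
    qed
    also have "\<dots> = ennreal a * (\<integral>\<^sup>+\<omega>. ?I \<omega> \<partial>P) + ennreal (1 / (4 * a)) * (\<integral>\<^sup>+\<omega>. L \<omega> * L \<omega> \<partial>P)"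
      by (simp add: nn_integral_add nn_integral_cmult)
    also have "(\<integral>\<^sup>+\<omega>. ?I \<omega> \<partial>P) = emeasure P {\<omega>\<in>space P. (\<lambda>n. \<xi> n \<omega>) \<in> C}"
    proof -
      have eq: "(\<lambda>\<omega> n. \<xi> n \<omega>) -` C \<inter> space P = {\<omega>\<in>space P. (\<lambda>n. \<xi> n \<omega>) \<in> C}" by auto
      have "{\<omega>\<in>space P. (\<lambda>n. \<xi> n \<omega>) \<in> C} \<in> sets P"
        unfolding eq[symmetric] by (rule measurable_sets[OF measurable_noise_seq C_sets])
      then have "emeasure P {\<omega>\<in>space P. (\<lambda>n. \<xi> n \<omega>) \<in> C} = (\<integral>\<^sup>+\<omega>. indicator {\<omega>\<in>space P. (\<lambda>n. \<xi> n \<omega>) \<in> C} \<omega> \<partial>P)"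
        by (rule nn_integral_indicator[symmetric])
      also have "\<dots> = (\<integral>\<^sup>+\<omega>. ?I \<omega> \<partial>P)" by (intro nn_integral_cong) (simp add: indicator_def)
      finally show ?thesis by simp
    qed
    also have "(\<integral>\<^sup>+\<omega>. L \<omega> * L \<omega> \<partial>P) \<le> ennreal K"
    proof -
      have "(\<integral>\<^sup>+\<omega>. L \<omega> * L \<omega> \<partial>P) = (\<integral>\<^sup>+\<omega>. \<integral>\<^sup>+c'. L \<omega> * ?D c' \<omega> \<partial>choices \<partial>P)"
        by (intro nn_integral_cong) (simp add: nn_integral_cmult Dc, simp add: L_def)
      also have "\<dots> = (\<integral>\<^sup>+c'. \<integral>\<^sup>+\<omega>. L \<omega> * ?D c' \<omega> \<partial>P \<partial>choices)"
      proof (rule CP.Fubini')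
        have "(\<lambda>x. L (snd x)) \<in> borel_measurable (choices \<Otimes>\<^sub>M P)" by (rule measurable_compose[OF measurable_snd Lm])
        then show "(\<lambda>(c', \<omega>). L \<omega> * ?D c' \<omega>) \<in> borel_measurable (choices \<Otimes>\<^sub>M P)"
          using Dm unfolding split_beta by (intro borel_measurable_times_ennreal)
      qed
      also have "\<dots> = (\<integral>\<^sup>+c'. \<integral>\<^sup>+\<omega>. \<integral>\<^sup>+c. ?D c \<omega> * ?D c' \<omega> \<partial>choices \<partial>P \<partial>choices)"
        unfolding L_def by (intro nn_integral_cong nn_integral_multc[symmetric] Dc)
      also have "\<dots> = (\<integral>\<^sup>+c'. \<integral>\<^sup>+c. \<integral>\<^sup>+\<omega>. ?D c \<omega> * ?D c' \<omega> \<partial>P \<partial>choices \<partial>choices)"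
      proof (rule nn_integral_cong, rule CP.Fubini')
        fix c'
        have "(\<lambda>x. ?D c' (snd x)) \<in> borel_measurable (choices \<Otimes>\<^sub>M P)" by (rule measurable_compose[OF measurable_snd D\<omega>])
        then show "(\<lambda>(c, \<omega>). ?D c \<omega> * ?D c' \<omega>) \<in> borel_measurable (choices \<Otimes>\<^sub>M P)"
          using Dm unfolding split_beta by (intro borel_measurable_times_ennreal)
      qed
      also have "\<dots> = (\<integral>\<^sup>+c'. \<integral>\<^sup>+c. ennreal (exp (\<Sum>j\<in>?F. Re (spectrum c j * cnj (spectrum c' j)))) \<partial>choices \<partial>choices)"
        by (subst nn_integral_shift_density_mult) simp_all
      also have "\<dots> \<le> ennreal K" by (rule K(2))
      finally show ?thesis .
    qed
    finally have "emeasure mixture C \<le> ennreal a * emeasure P {\<omega>\<in>space P. (\<lambda>n. \<xi> n \<omega>) \<in> C} + ennreal (1 / (4 * a)) * ennreal K"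
      by (simp add: add_left_mono mult_left_mono)
    also have "ennreal (1 / (4 * a)) * ennreal K = ennreal (K / (4 * a))"
      using a K(1) by (subst ennreal_mult'[symmetric]) simp_all
    finally show ?thesis .
  qed
  with K(1) show ?thesis by (rule that)
qed

text \<open>A detector yields a set \<open>B\<close> that is null for the noise but of full measure
  under every shift by a \<open>spectrum c\<close>, hence under \<open>mixture\<close>. A cylinder
  close to \<open>B\<close> for both laws then contradicts
  \<open>mixture_cylinder_le\<close>.\<close>

lemma not_detection_of_cantor:
  "\<not> admits_detection P \<xi> (fourier_space \<alpha> - {\<lambda>_. 0})"
proof
  assume "admits_detection P \<xi> (fourier_space \<alpha> - {\<lambda>_. 0})"
  then obtain T :: "(int \<Rightarrow> complex) \<Rightarrow> nat" where T: "T \<in> borel \<rightarrow>\<^sub>M count_space {0, 1}"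
    "AE \<omega> in P. T (\<lambda>n. \<xi> n \<omega>) = 0"
    "\<And>x. x \<in> fourier_space \<alpha> - {\<lambda>_. 0} \<Longrightarrow> AE \<omega> in P. T (\<lambda>n. x n + \<xi> n \<omega>) = 1"
    unfolding admits_detection_def by blast
  interpret Q: prob_space mixture by (rule prob_space_mixture)
  let ?P0 = "distr P borel (\<lambda>\<omega> n. \<xi> n \<omega>)"
  interpret P0: prob_space ?P0 by (rule prob_space_distr) measurable
  define B where "B = T -` {1} \<inter> space borel"
  have B[measurable]: "B \<in> sets borel" unfolding B_def by (rule measurable_sets[OF T(1)]) simp
  have vim: "(\<lambda>\<omega> n. x n + \<xi> n \<omega>) -` A \<inter> space P = {\<omega>\<in>space P. (\<lambda>n. x n + \<xi> n \<omega>) \<in> A}" for x A by auto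
  have vim0: "(\<lambda>\<omega> n. \<xi> n \<omega>) -` A \<inter> space P = {\<omega>\<in>space P. (\<lambda>n. \<xi> n \<omega>) \<in> A}" for A by auto
  have P0B: "measure ?P0 B = 0"
  proof -
    have "AE \<omega> in P. (\<lambda>n. \<xi> n \<omega>) \<notin> B" using T(2) by eventually_elim (simp add: B_def)
    then have "AE y in ?P0. y \<notin> B" by (subst AE_distr_iff) (simp_all add: pred_def)
    then show ?thesis by (simp add: P0.prob_eq_0)
  qed
  have QB: "measure mixture B = 1"
  proof -
    have "emeasure P {\<omega>\<in>space P. (\<lambda>n. spectrum c n + \<xi> n \<omega>) \<in> B} = 1" for c
    proof -
      have "AE \<omega> in P. (\<lambda>n. spectrum c n + \<xi> n \<omega>) \<in> B"
        using T(3)[OF fourier_cantor_charge_in_fourier_space[OF \<alpha> dim, of c]]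
        by eventually_elim (simp add: B_def)
      moreover have "{\<omega>\<in>space P. (\<lambda>n. spectrum c n + \<xi> n \<omega>) \<in> B} \<in> sets P"
        unfolding vim[symmetric] by (rule measurable_sets[OF measurable_shifted_noise B])
      ultimately show ?thesis by (intro emeasure_eq_1_AE) auto
    qed
    then have "emeasure mixture B = 1" unfolding emeasure_mixture[OF B] using C.emeasure_space_1 by simp
    then show ?thesis by (simp add: Q.emeasure_eq_measure)
  qed
  obtain K where K: "0 \<le> K" "\<And>a (n :: nat) C. a > 0 \<Longrightarrow> cylinder {- int n..int n} C \<Longrightarrow>
    emeasure mixture C \<le> ennreal a * emeasure P {\<omega>\<in>space P. (\<lambda>n. \<xi> n \<omega>) \<in> C} + ennreal (K / (4 * a))"
    using mixture_cylinder_le by blast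
  \<comment> \<open>This makes \<open>K / (4 * a)\<close> at most 1/4, and \<open>\<epsilon>\<close>
    below satisfies \<open>(a + 1) * \<epsilon> = 1 / 4\<close>; together the estimates would give
    \<open>1 \<le> 1 / 2\<close>.\<close>
  define a where "a = K + 1"
  have a: "a > 0" using K(1) by (simp add: a_def)
  define \<epsilon> where "\<epsilon> = 1 / (4 * (a + 1))"
  have \<epsilon>: "\<epsilon> > 0" using a by (simp add: \<epsilon>_def)
  have sm: "sets mixture = sets borel" by (simp add: mixture_def)
  obtain n :: nat and C where C: "cylinder {- int n..int n} C"
    "measure ?P0 (sym_diff B C) + measure mixture (sym_diff B C) < \<epsilon>"
    using cylinder_approx[OF P0.finite_measure_axioms _ Q.finite_measure_axioms sm B \<epsilon>] by auto
  have C_sets[measurable]: "C \<in> sets borel" using C(1) by (simp add: cylinder_def)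
  have "measure ?P0 C \<le> measure ?P0 (B \<union> sym_diff B C)" by (rule P0.finite_measure_mono) auto
  also have "\<dots> \<le> measure ?P0 B + measure ?P0 (sym_diff B C)" by (rule measure_Un_le) auto
  finally have P0C: "measure ?P0 C \<le> \<epsilon>"
    using P0B C(2) measure_nonneg[of mixture "sym_diff B C"] by linarith
  have "measure mixture B \<le> measure mixture (C \<union> sym_diff B C)"
    by (rule Q.finite_measure_mono) (auto simp: sm)
  also have "\<dots> \<le> measure mixture C + measure mixture (sym_diff B C)" by (rule measure_Un_le) (auto simp: sm)
  finally have QC: "1 - \<epsilon> \<le> measure mixture C"
    using QB C(2) measure_nonneg[of ?P0 "sym_diff B C"] by linarith
  have "emeasure P {\<omega>\<in>space P. (\<lambda>n. \<xi> n \<omega>) \<in> C} = ennreal (measure ?P0 C)"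
    unfolding P0.emeasure_eq_measure[symmetric] by (subst emeasure_distr) (simp_all add: vim0)
  then have "ennreal (measure mixture C) \<le> ennreal (a * measure ?P0 C + K / (4 * a))"
    using K(2)[OF a C(1)] a K(1) by (simp add: Q.emeasure_eq_measure ennreal_mult' ennreal_plus)
  then have "measure mixture C \<le> a * measure ?P0 C + K / (4 * a)"
    using a K(1) by (subst (asm) ennreal_le_iff) auto
  also have "\<dots> \<le> a * \<epsilon> + 1 / 4"
  proof -
    have "K / (4 * a) \<le> 1 / 4" using a K(1) by (simp add: a_def field_simps)
    then show ?thesis using mult_left_mono[OF P0C, of a] a by linarith
  qed
  finally have "1 \<le> (a + 1) * \<epsilon> + 1 / 4" using QC by (simp add: distrib_right)
  moreover have "(a + 1) * \<epsilon> = 1 / 4" using a by (simp add: \<epsilon>_def)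
  ultimately show False by simp
qed

end

lemma not_admits_detection_fourier_space:
  assumes \<alpha>: "1 / 2 < \<alpha>"
  shows "\<not> admits_detection P \<xi> (fourier_space \<alpha> - {\<lambda>_. 0})"
proof -
  \<comment> \<open>For \<open>M\<close> above \<open>2 powr (1 / \<delta>)\<close>, the number
    \<open>2 * M\<close> is less than \<open>M powr (1 + \<delta>)\<close>, that is
    \<open>(M * M) powr \<alpha>\<close>; this leaves room for \<open>N = M + 1\<close>.\<close>
  define \<delta> where "\<delta> = 2 * \<alpha> - 1"
  have \<delta>: "\<delta> > 0" using \<alpha> by (simp add: \<delta>_def)
  obtain M :: nat where M': "max 2 (2 powr (1 / \<delta>)) < real M" using reals_Archimedean2 by blast
  then have M: "2 \<le> M" "2 powr (1 / \<delta>) < real M" by auto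
  have "2 = (2 powr (1 / \<delta>)) powr \<delta>" using \<delta> by (simp add: powr_powr)
  also have "\<dots> < real M powr \<delta>" using M(2) \<delta> by (intro powr_less_mono2) auto
  finally have big: "2 < real M powr \<delta>" .
  have "real (M + 1) \<le> 2 * real M" using M(1) by simp
  also have "\<dots> < real M powr \<delta> * real M" using big M(1) by (intro mult_strict_right_mono) auto
  also have "\<dots> = (real M * real M) powr \<alpha>"
    using M(1) by (simp add: powr_mult powr_add[symmetric] \<delta>_def powr_mult_base mult.commute)
  also have "\<dots> \<le> real ((M + 1) * M) powr \<alpha>"
    using \<alpha> by (intro powr_mono2) (auto intro!: mult_right_mono)
  finally have "real (M + 1) < real ((M + 1) * M) powr \<alpha>" .
  moreover have "random_cantor (M + 1) M" using M(1) by unfold_locales auto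
  moreover have "0 < \<alpha>" using \<alpha> by simp
  ultimately show ?thesis by (intro not_detection_of_cantor[of "M + 1" M]) auto
qed

end

theorem theorem1p1:
  fixes \<alpha> :: real
    and P :: "'w measure"
    and \<xi> :: "int \<Rightarrow> 'w \<Rightarrow> complex"
  assumes "0 \<le> \<alpha>" and "\<alpha> \<le> 1"
    and "complex_gaussian_noise P \<xi>"
  shows "(\<alpha> < 1 / 2 \<longrightarrow> admits_recovery P \<xi> (fourier_space \<alpha>)) \<and>
    (\<alpha> > 1 / 2 \<longrightarrow> \<not> admits_detection P \<xi> (fourier_space \<alpha> - {\<lambda>_. 0}))"
proof -
  interpret complex_gaussian P \<xi> using assms(3) by unfold_locales
  show ?thesis
    using admits_recovery_fourier_space[OF assms(1)] not_admits_detection_fourier_space by blast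
qed

end
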